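(* Let $D$ be a commutative Dedekind domain, let $\sigma \neq 1$ be an automorphism of $D$, let $\delta \neq 0$ be an inner (left) $\sigma$-derivation on $D$, and let $R = D[x;\sigma,\delta]$ be the Ore extension. Then: (1) The set $$\{\, \mathfrak{p}[x;\sigma,\delta],\ P \ \mid\ \mathfrak{p} \text{ is a nonzero } \sigma\text{-prime ideal of } D \text{ and } P \in \mathrm{Spec}_0(R) \text{ with } P \neq (0) \,\}$$ consists of all minimal prime ideals of $R$ (i.e. it is exactly the set of minimal prime ideals of $R$). (2) Let $P \in \mathrm{Spec}(R)$ with $P \neq (0)$. Then $P$ is invertible if and only if it is a minimal prime ideal of $R$.
   Context: A (left) $\sigma$-derivation on $D$ is an additive map $\delta: D \to D$ with $\delta(ab) = \sigma(a)\delta(b) + \delta(a)b$ for all $a,b \in D$. It is called inner if there exists $a \in D$ such that $\delta(b) = ab - \sigma(b)a$ for all $b \in D$. The Ore extension $D[x;\sigma,\delta]$ is the ring of polynomials $a_n x^n + \cdots + a_0$ with left coefficients $a_i \in D$ (a free left $D$-module on $1, x, x^2, \dots$), with multiplication determined by $xa = \sigma(a)x + \delta(a)$ for $a \in D$. For an ideal $\mathfrak{p}$ of $D$, $\mathfrak{p}[x;\sigma,\delta]$ denotes the set of elements of $R$ all of whose left coefficients lie in $\mathfrak{p}$. A $\sigma$-ideal of $D$ is an ideal $I$ of $D$ with $\sigma(I) \subseteq I$. A $\sigma$-prime ideal of $D$ is a proper $\sigma$-ideal $I$ such that whenever $J, K$ are $\sigma$-ideals of $D$ with $JK \subseteq I$,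 then $J \subseteq I$ or $K \subseteq I$. $\mathrm{Spec}(R)$ is the set of all prime ideals of $R$, and $\mathrm{Spec}_0(R)$ is the set of all prime ideals $P$ of $R$ with $P \cap D = (0)$. Convention: since $R$ is a domain, a minimal prime ideal of $R$ means a nonzero prime ideal of $R$ that properly contains no nonzero prime ideal of $R$. Invertibility of an ideal $P$ of $R$ is in the usual sense inside the quotient division ring $Q(R)$ of the noetherian domain $R$: there is an $R$-$R$-subbimodule $P'$ of $Q(R)$ with $PP' = P'P = R$. *)

theory Defs
  imports "HOL-Algebra.Algebra"
begin

section \<open>Commutative Dedekind domains\<close>

text \<open>
  The displayed equation is the monic equation
  \<open>(a/b)\<^sup>n + c\<^sub>n\<^sub>-\<^sub>1 (a/b)\<^sup>n\<^sup>-\<^sup>1 + \<dots> + c\<^sub>0 = 0\<close> over \<open>D\<close> for the fraction \<open>a/b\<close>, multiplied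
  by \<open>b\<^sup>n\<close>; \<open>b divides a\<close> says that the fraction lies in \<open>D\<close>. This avoids constructing
  the field of fractions.
\<close>

definition integrally_closed :: "('a, 'm) ring_scheme \<Rightarrow> bool" where
  "integrally_closed D \<longleftrightarrow>
     (\<forall>a \<in> carrier D. \<forall>b \<in> carrier D - {\<zero>\<^bsub>D\<^esub>}.
        (\<exists>n > 0. \<exists>c \<in> {..<n} \<rightarrow> carrier D.
           a [^]\<^bsub>D\<^esub> (n::nat) \<oplus>\<^bsub>D\<^esub>
             (\<Oplus>\<^bsub>D\<^esub>i \<in> {..<n}. c i \<otimes>\<^bsub>D\<^esub> a [^]\<^bsub>D\<^esub> i \<otimes>\<^bsub>D\<^esub> b [^]\<^bsub>D\<^esub> (n - i)) = \<zero>\<^bsub>D\<^esub>)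
        \<longrightarrow> b divides\<^bsub>D\<^esub> a)"

text \<open>Fields are allowed as degenerate Dedekind domains.\<close>

definition dedekind_domain :: "('a, 'm) ring_scheme \<Rightarrow> bool" where
  "dedekind_domain D \<longleftrightarrow>
     noetherian_domain D \<and> integrally_closed D \<and>
     (\<forall>\<pp>. primeideal \<pp> D \<and> \<pp> \<noteq> {\<zero>\<^bsub>D\<^esub>} \<longrightarrow> maximalideal \<pp> D)"


section \<open>Skew derivations and Ore extensions\<close>

definition skew_derivation :: "('a, 'm) ring_scheme \<Rightarrow> ('a \<Rightarrow> 'a) \<Rightarrow> ('a \<Rightarrow> 'a) \<Rightarrow> bool" where
  "skew_derivation D \<sigma> \<delta> \<longleftrightarrow>
     \<delta> \<in> carrier D \<rightarrow> carrier D \<and>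
     (\<forall>a \<in> carrier D. \<forall>b \<in> carrier D. \<delta> (a \<oplus>\<^bsub>D\<^esub> b) = \<delta> a \<oplus>\<^bsub>D\<^esub> \<delta> b) \<and>
     (\<forall>a \<in> carrier D. \<forall>b \<in> carrier D.
        \<delta> (a \<otimes>\<^bsub>D\<^esub> b) = \<sigma> a \<otimes>\<^bsub>D\<^esub> \<delta> b \<oplus>\<^bsub>D\<^esub> \<delta> a \<otimes>\<^bsub>D\<^esub> b)"

definition inner_skew_derivation :: "('a, 'm) ring_scheme \<Rightarrow> ('a \<Rightarrow> 'a) \<Rightarrow> ('a \<Rightarrow> 'a) \<Rightarrow> bool" where
  "inner_skew_derivation D \<sigma> \<delta> \<longleftrightarrow>
     skew_derivation D \<sigma> \<delta> \<and>
     (\<exists>a \<in> carrier D. \<forall>b \<in> carrier D. \<delta> b = a \<otimes>\<^bsub>D\<^esub> b \<ominus>\<^bsub>D\<^esub> \<sigma> b \<otimes>\<^bsub>D\<^esub> a)"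

text \<open>
  A polynomial \<open>\<Sum>\<^sub>n a\<^sub>n x\<^sup>n\<close> with left coefficients is represented, as in
  \<^theory>\<open>HOL-Algebra.UnivPoly\<close>, by the finitely supported function \<open>n \<mapsto> a\<^sub>n\<close>.
  Left multiplication by \<open>x\<close> is forced by \<open>x a = \<sigma>(a) x + \<delta>(a)\<close> to be
  \<open>x (\<Sum>\<^sub>n q\<^sub>n x\<^sup>n) = \<Sum>\<^sub>n \<sigma>(q\<^sub>n) x\<^sup>n\<^sup>+\<^sup>1 + \<Sum>\<^sub>n \<delta>(q\<^sub>n) x\<^sup>n\<close>,
  and then \<open>(\<Sum>\<^sub>i p\<^sub>i x\<^sup>i) q = \<Sum>\<^sub>i p\<^sub>i (x\<^sup>i q)\<close>.
\<close>

definition ore_shift :: "('a, 'm) ring_scheme \<Rightarrow> ('a \<Rightarrow> 'a) \<Rightarrow> ('a \<Rightarrow> 'a) \<Rightarrow> (nat \<Rightarrow> 'a) \<Rightarrow> nat \<Rightarrow> 'a" where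
  "ore_shift D \<sigma> \<delta> q = (\<lambda>n. (case n of 0 \<Rightarrow> \<zero>\<^bsub>D\<^esub> | Suc m \<Rightarrow> \<sigma> (q m)) \<oplus>\<^bsub>D\<^esub> \<delta> (q n))"

definition ore_extension ::
    "('a, 'm) ring_scheme \<Rightarrow> ('a \<Rightarrow> 'a) \<Rightarrow> ('a \<Rightarrow> 'a) \<Rightarrow> (nat \<Rightarrow> 'a) ring" where
  "ore_extension D \<sigma> \<delta> =
     \<lparr> carrier = up D,
       monoid.mult = (\<lambda>p q n. \<Oplus>\<^bsub>D\<^esub>i \<in> {i. p i \<noteq> \<zero>\<^bsub>D\<^esub>}. p i \<otimes>\<^bsub>D\<^esub> ((ore_shift D \<sigma> \<delta> ^^ i) q) n),
       monoid.one = (\<lambda>n. if n = 0 then \<one>\<^bsub>D\<^esub> else \<zero>\<^bsub>D\<^esub>),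
       ring.zero = (\<lambda>n. \<zero>\<^bsub>D\<^esub>),
       ring.add = (\<lambda>p q n. p n \<oplus>\<^bsub>D\<^esub> q n) \<rparr>"

definition ore_const :: "('a, 'm) ring_scheme \<Rightarrow> 'a \<Rightarrow> nat \<Rightarrow> 'a" where
  "ore_const D a = (\<lambda>n. if n = 0 then a else \<zero>\<^bsub>D\<^esub>)"

definition ore_coeff_ideal ::
    "('a, 'm) ring_scheme \<Rightarrow> ('a \<Rightarrow> 'a) \<Rightarrow> ('a \<Rightarrow> 'a) \<Rightarrow> 'a set \<Rightarrow> (nat \<Rightarrow> 'a) set" where
  "ore_coeff_ideal D \<sigma> \<delta> \<pp> = {f \<in> carrier (ore_extension D \<sigma> \<delta>). \<forall>n. f n \<in> \<pp>}"


section \<open>Prime ideals\<close>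

definition sigma_ideal :: "'a set \<Rightarrow> ('a, 'm) ring_scheme \<Rightarrow> ('a \<Rightarrow> 'a) \<Rightarrow> bool" where
  "sigma_ideal I D \<sigma> \<longleftrightarrow> ideal I D \<and> \<sigma> ` I \<subseteq> I"

definition sigma_prime_ideal :: "'a set \<Rightarrow> ('a, 'm) ring_scheme \<Rightarrow> ('a \<Rightarrow> 'a) \<Rightarrow> bool" where
  "sigma_prime_ideal I D \<sigma> \<longleftrightarrow>
     sigma_ideal I D \<sigma> \<and> I \<noteq> carrier D \<and>
     (\<forall>J K. sigma_ideal J D \<sigma> \<and> sigma_ideal K D \<sigma> \<and> J \<cdot>\<^bsub>D\<^esub> K \<subseteq> I \<longrightarrow> J \<subseteq> I \<or> K \<subseteq> I)"

text \<open>
  The library's \<^const>\<open>primeideal\<close> is restricted to commutative rings (and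
  elementwise), so primeness of two-sided ideals is defined here.
\<close>

definition Spec :: "('a, 'm) ring_scheme \<Rightarrow> 'a set set" where
  "Spec R = {P. ideal P R \<and> P \<noteq> carrier R \<and>
     (\<forall>I J. ideal I R \<and> ideal J R \<and> I \<cdot>\<^bsub>R\<^esub> J \<subseteq> P \<longrightarrow> I \<subseteq> P \<or> J \<subseteq> P)}"

definition Spec0 :: "('a, 'm) ring_scheme \<Rightarrow> ('a \<Rightarrow> 'a) \<Rightarrow> ('a \<Rightarrow> 'a) \<Rightarrow> (nat \<Rightarrow> 'a) set set" where
  "Spec0 D \<sigma> \<delta> =
     {P \<in> Spec (ore_extension D \<sigma> \<delta>).
        P \<inter> ore_const D ` carrier D = {\<zero>\<^bsub>ore_extension D \<sigma> \<delta>\<^esub>}}"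

definition minimal_primes :: "('a, 'm) ring_scheme \<Rightarrow> 'a set set" where
  "minimal_primes R =
     {P \<in> Spec R. P \<noteq> {\<zero>\<^bsub>R\<^esub>} \<and> \<not> (\<exists>P' \<in> Spec R. P' \<noteq> {\<zero>\<^bsub>R\<^esub>} \<and> P' \<subset> P)}"


section \<open>Quotient division rings and invertibility\<close>

definition skew_field :: "('q, 'n) ring_scheme \<Rightarrow> bool" where
  "skew_field Q \<longleftrightarrow> ring Q \<and> \<one>\<^bsub>Q\<^esub> \<noteq> \<zero>\<^bsub>Q\<^esub> \<and> Units Q = carrier Q - {\<zero>\<^bsub>Q\<^esub>}"

text \<open>
  \<open>Q\<close>, with the embedding \<open>\<iota>\<close> of \<open>R\<close>, is the (two-sided) quotient division ring of the
  domain \<open>R\<close>. This determines \<open>(Q, \<iota>)\<close> up to a unique isomorphism over \<open>R\<close>.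
\<close>

definition quotient_division_ring ::
    "('r, 'm) ring_scheme \<Rightarrow> ('q, 'n) ring_scheme \<Rightarrow> ('r \<Rightarrow> 'q) \<Rightarrow> bool" where
  "quotient_division_ring R Q \<iota> \<longleftrightarrow>
     skew_field Q \<and> \<iota> \<in> ring_hom R Q \<and> inj_on \<iota> (carrier R) \<and>
     (\<forall>z \<in> carrier Q.
        (\<exists>r \<in> carrier R. \<exists>s \<in> carrier R - {\<zero>\<^bsub>R\<^esub>}. z = \<iota> r \<otimes>\<^bsub>Q\<^esub> inv\<^bsub>Q\<^esub> (\<iota> s)) \<and>
        (\<exists>r \<in> carrier R. \<exists>s \<in> carrier R - {\<zero>\<^bsub>R\<^esub>}. z = inv\<^bsub>Q\<^esub> (\<iota> s) \<otimes>\<^bsub>Q\<^esub> \<iota> r))"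

definition subbimodule ::
    "'q set \<Rightarrow> ('r, 'm) ring_scheme \<Rightarrow> ('q, 'n) ring_scheme \<Rightarrow> ('r \<Rightarrow> 'q) \<Rightarrow> bool" where
  "subbimodule M R Q \<iota> \<longleftrightarrow>
     additive_subgroup M Q \<and>
     (\<forall>r \<in> carrier R. \<forall>m \<in> M. \<iota> r \<otimes>\<^bsub>Q\<^esub> m \<in> M \<and> m \<otimes>\<^bsub>Q\<^esub> \<iota> r \<in> M)"

text \<open>\<^const>\<open>ideal_prod\<close> is used for arbitrary additive subgroups: finite sums of products.\<close>

definition invertible_ideal ::
    "'r set \<Rightarrow> ('r, 'm) ring_scheme \<Rightarrow> ('q, 'n) ring_scheme \<Rightarrow> ('r \<Rightarrow> 'q) \<Rightarrow> bool" where
  "invertible_ideal P R Q \<iota> \<longleftrightarrow>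
     (\<exists>P'. subbimodule P' R Q \<iota> \<and>
        (\<iota> ` P) \<cdot>\<^bsub>Q\<^esub> P' = \<iota> ` carrier R \<and> P' \<cdot>\<^bsub>Q\<^esub> (\<iota> ` P) = \<iota> ` carrier R)"

end

theory Submission
  imports Defs
begin

text \<open>
  Let \<open>\<delta>(b) = a b - \<sigma>(b) a\<close>. Then \<open>y = x - a\<close> satisfies \<open>y b = \<sigma>(b) y\<close>, so that \<open>R = D[y; \<sigma>]\<close>.

  A nonzero prime \<open>P\<close> meeting \<open>D\<close> trivially either contains \<open>y\<close>, and then \<open>P = y R\<close>, or it contains a
  central element \<open>f\<close> of minimal degree with \<open>\<sigma>\<close>-invariant coefficients. Gauss's lemma for the content
  ideal \<open>c(f)\<close> then gives \<open>P = c(f)\<^sup>-\<^sup>1 f R\<close>, which is invertible. A prime with \<open>P \<inter> D = \<pp> \<noteq> 0\<close> contains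
  \<open>y R\<close> or \<open>\<pp> R\<close>, and \<open>\<pp> R\<close> is invertible because \<open>\<pp>\<close> is. So every nonzero prime contains a prime of
  one of the two kinds in (1), and all of these are invertible.

  Invertible primes \<open>P\<^sub>0 \<subset> P\<close> cannot exist: \<open>P (P\<^sup>-\<^sup>1 P\<^sub>0) = P\<^sub>0\<close> forces \<open>P\<^sup>-\<^sup>1 P\<^sub>0 \<subseteq> P\<^sub>0\<close> and hence
  \<open>P\<^sup>-\<^sup>1 \<subseteq> R\<close>. This gives (2); for (1) it remains to check that the primes of the
  two kinds are pairwise incomparable.
\<close>

subsection \<open>Ideals and noetherian rings\<close>

text \<open>The field of fractions of \<open>D\<close> is never formed. A fractional inverse of an
  ideal \<open>I\<close> is carried as a pair \<open>I'\<close>, \<open>c\<close> with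
  \<open>I I' = c D\<close>, and dividing by \<open>c\<close> means cancelling it in an equation
  over \<open>D\<close>. Two obstacles shape the treatment of primes with
  \<open>P \<inter> D = 0\<close>. Constants do not commute with \<open>y\<close>, which is why an
  element of minimal degree is replaced by a multiple with invariant coefficients that commutes with
  everything. Leading coefficients need not be units, so dividing by \<open>f\<close> only gives
  \<open>c g = q f\<close> with a nonzero invariant constant \<open>c\<close>. Removing
  \<open>c\<close> is the task of Gauss's lemma, and as contents need not be principal,
  \<open>P\<close> is in general \<open>c(f)^-1 f R\<close> rather than \<open>f R\<close>. The
  existence of a central \<open>f\<close> forces a positive power of \<sigma> to be the identity. If
  \<sigma> has infinite order, \<open>y R\<close> is therefore the only nonzero prime that meets
  \<open>D\<close> trivially.\<close>

lemma (in ring) ideal_if_closed: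
  assumes "I \<subseteq> carrier R" "\<zero> \<in> I"
    and "\<And>x y. x \<in> I \<Longrightarrow> y \<in> I \<Longrightarrow> x \<oplus> y \<in> I"
    and "\<And>x r. x \<in> I \<Longrightarrow> r \<in> carrier R \<Longrightarrow> r \<otimes> x \<in> I"
    and "\<And>x r. x \<in> I \<Longrightarrow> r \<in> carrier R \<Longrightarrow> x \<otimes> r \<in> I"
  shows "ideal I R"
proof (rule idealI)
  show "subgroup I (add_monoid R)"
  proof (rule add.subgroupI)
    show "\<ominus> x \<in> I" if "x \<in> I" for x
    proof -
      have "\<ominus> x = (\<ominus> \<one>) \<otimes> x"
        using that assms(1) l_minus[of \<one> x] by (simp add: subset_iff)
      then show ?thesis
        using that assms(4)[of x "\<ominus> \<one>"] by simp
    qed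
  qed (use assms in auto)
qed (use assms ring_axioms in auto)

lemma (in cring) ideal_if_closed_comm:
  assumes "I \<subseteq> carrier R" "\<zero> \<in> I"
    and "\<And>x y. x \<in> I \<Longrightarrow> y \<in> I \<Longrightarrow> x \<oplus> y \<in> I"
    and "\<And>x r. x \<in> I \<Longrightarrow> r \<in> carrier R \<Longrightarrow> r \<otimes> x \<in> I"
  shows "ideal I R"
proof (rule ideal_if_closed[OF assms])
  show "x \<otimes> r \<in> I" if "x \<in> I" "r \<in> carrier R" for x r
    using assms(4)[OF that] m_comm[of x r] assms(1) that by auto
qed

lemma (in cring) multiples_ideal:
  assumes "ideal I R" "a \<in> carrier R"
  shows "ideal ((\<otimes>) a ` I) R"
proof -
  interpret I: ideal I R by fact
  show ?thesis
  proof (rule ideal_if_closed_comm)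
    show "x \<oplus> y \<in> (\<otimes>) a ` I" if xy: "x \<in> (\<otimes>) a ` I" "y \<in> (\<otimes>) a ` I" for x y
    proof -
      obtain i j where "i \<in> I" "x = a \<otimes> i" "j \<in> I" "y = a \<otimes> j"
        using xy by blast
      then show ?thesis
        using assms(2) I.Icarr by (intro image_eqI[of _ _ "i \<oplus> j"]) (auto simp: r_distr)
    qed
    show "r \<otimes> x \<in> (\<otimes>) a ` I" if x: "x \<in> (\<otimes>) a ` I" and r: "r \<in> carrier R" for x r
    proof -
      obtain i where "i \<in> I" "x = a \<otimes> i"
        using x by blast
      then show ?thesis
        using assms(2) r I.Icarr I.I_l_closed by (intro image_eqI[of _ _ "r \<otimes> i"]) (auto simp: m_lcomm)
    qed
  qed (use assms(2) I.Icarr in \<open>auto intro!: image_eqI[of _ _ \<zero>]\<close>)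
qed

lemma (in cring) colon_ideal:
  assumes "ideal J R" "A \<subseteq> carrier R"
  shows "ideal {y \<in> carrier R. \<forall>z \<in> A. z \<otimes> y \<in> J} R" (is "ideal ?C R")
proof -
  interpret J: ideal J R by fact
  have A: "z \<in> carrier R" if "z \<in> A" for z
    using assms(2) that by blast
  show ?thesis
    by (rule ideal_if_closed_comm) (use A J.I_l_closed in \<open>auto simp: r_distr m_lcomm\<close>)
qed

lemma divides_iff_multiple: "a divides\<^bsub>R\<^esub> b \<longleftrightarrow> b \<in> (\<otimes>\<^bsub>R\<^esub>) a ` carrier R"
  unfolding factor_def by blast

lemma ideal_prod_closed:
  assumes "x \<in> I \<cdot>\<^bsub>R\<^esub> J"
    and "\<And>i j. i \<in> I \<Longrightarrow> j \<in> J \<Longrightarrow> i \<otimes>\<^bsub>R\<^esub> j \<in> A"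
    and "\<And>u v. u \<in> A \<Longrightarrow> v \<in> A \<Longrightarrow> u \<oplus>\<^bsub>R\<^esub> v \<in> A"
  shows "x \<in> A"
  using assms(1) by induction (use assms in auto)

lemma (in ideal) finsum_in:
  assumes "finite A" "\<And>i. i \<in> A \<Longrightarrow> f i \<in> I"
  shows "(\<Oplus>i\<in>A. f i) \<in> I"
  using assms by (induction A) (auto simp: Pi_iff)

lemma (in ideal) add_in_cancel:
  assumes "x \<oplus> y \<in> I" "y \<in> I" "x \<in> carrier R"
  shows "x \<in> I"
proof -
  have "x \<oplus> y \<oplus> \<ominus> y \<in> I"
    using assms by auto
  then show ?thesis
    using assms by (simp add: a_assoc r_neg)
qed

lemma (in ideal) finsum_in_remaining:
  assumes "finite A" "u \<in> A" "\<And>i. i \<in> A \<Longrightarrow> f i \<in> carrier R"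
    and "\<And>i. i \<in> A \<Longrightarrow> i \<noteq> u \<Longrightarrow> f i \<in> I" "(\<Oplus>i\<in>A. f i) \<in> I"
  shows "f u \<in> I"
proof -
  have "(\<Oplus>i\<in>A. f i) = (\<Oplus>i\<in>insert u (A - {u}). f i)"
    using assms(2) by (simp add: insert_absorb)
  also have "\<dots> = f u \<oplus> (\<Oplus>i\<in>A - {u}. f i)"
    using assms(1,2,3) by (subst finsum_insert) auto
  finally show ?thesis
    using add_in_cancel[of "f u" "\<Oplus>i\<in>A - {u}. f i"] assms finsum_in[of "A - {u}" f] by auto
qed

text \<open>A nonempty chain of ideals in a noetherian ring contains its own union, so Zorn's lemma
  applies to every family, without closure under unions. Noetherianity is used below in this
  form.\<close>

lemma (in noetherian_ring) maximal_in_family: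
  assumes "\<F> \<noteq> {}" "\<And>I. I \<in> \<F> \<Longrightarrow> ideal I R"
  obtains M where "M \<in> \<F>" "\<And>Y. Y \<in> \<F> \<Longrightarrow> M \<subseteq> Y \<Longrightarrow> Y = M"
proof -
  have "\<exists>M\<in>\<F>. \<forall>Y\<in>\<F>. M \<subseteq> Y \<longrightarrow> Y = M"
  proof (rule subset_Zorn_nonempty[OF assms(1)])
    fix C assume C: "C \<noteq> {}" "subset.chain \<F> C"
    then have "subset.chain {I. ideal I R} C"
      using assms(2) by (auto simp: subset.chain_def)
    then have "\<Union>C \<in> C"
      using ideal_chain_is_trivial C(1) by blast
    then show "\<Union>C \<in> \<F>"
      using C(2) by (auto simp: subset.chain_def)
  qed
  then show thesis
    using that by blast
qed

lemma (in noetherian_ring) proper_ideal_below_maximal: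
  assumes "ideal I R" "I \<noteq> carrier R"
  obtains M where "maximalideal M R" "I \<subseteq> M"
proof -
  let ?S = "{J. ideal J R \<and> I \<subseteq> J \<and> J \<noteq> carrier R}"
  obtain M where M: "M \<in> ?S" "\<And>Y. Y \<in> ?S \<Longrightarrow> M \<subseteq> Y \<Longrightarrow> Y = M"
    by (rule maximal_in_family[of ?S]) (use assms in auto)
  then have "maximalideal M R"
    by (intro maximalidealI) auto
  then show thesis
    using that M by blast
qed

text \<open>The ideals \<open>I n\<close>, generated by \<open>w 0, ..., w (n - 1)\<close>, ascend.
  At a maximal \<open>I n\<close> the next generator \<open>w n\<close> brings nothing new.\<close>

lemma (in noetherian_ring) sequence_in_span:
  fixes w :: "nat \<Rightarrow> 'a"
  assumes "cring R" and w: "\<And>i. w i \<in> carrier R"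
  obtains n d where "\<And>i. d i \<in> carrier R" "w n = (\<Oplus>i\<in>{..<n}. d i \<otimes> w i)"
proof -
  interpret cring R by fact
  define I where "I = rec_nat {\<zero>} (\<lambda>n J. J <+> PIdl (w n))"
  have I_simps: "I 0 = {\<zero>}" "I (Suc n) = I n <+> PIdl (w n)" for n
    unfolding I_def by simp_all
  have I_ideal: "ideal (I n) R" for n
    by (induction n) (auto simp: I_simps zeroideal intro: add_ideals cgenideal_ideal w)
  have Suc_I: "h \<oplus> r \<otimes> w n \<in> I (Suc n)" if "h \<in> I n" "r \<in> carrier R" for h r n
    using that unfolding I_simps set_add_def' cgenideal_def by blast
  have span: "\<exists>d. (\<forall>i. d i \<in> carrier R) \<and> x = (\<Oplus>i\<in>{..<n}. d i \<otimes> w i)" if "x \<in> I n" for x n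
    using that
  proof (induction n arbitrary: x)
    case 0
    then show ?case
      by (auto simp: I_simps intro!: exI[of _ "\<lambda>_. \<zero>"])
  next
    case (Suc n)
    then obtain h r where h: "h \<in> I n" "r \<in> carrier R" "x = h \<oplus> r \<otimes> w n"
      unfolding I_simps set_add_def' cgenideal_def by blast
    obtain d where d: "\<And>i. d i \<in> carrier R" "h = (\<Oplus>i\<in>{..<n}. d i \<otimes> w i)"
      using Suc.IH[OF h(1)] by blast
    let ?d = "d(n := r)"
    have "(\<Oplus>i\<in>{..<Suc n}. ?d i \<otimes> w i) = r \<otimes> w n \<oplus> (\<Oplus>i\<in>{..<n}. ?d i \<otimes> w i)"
      using d(1) h(2) w unfolding lessThan_Suc by (subst finsum_insert) auto
    also have "(\<Oplus>i\<in>{..<n}. ?d i \<otimes> w i) = h"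
      unfolding d(2) using d(1) w by (intro finsum_cong') auto
    finally have "x = (\<Oplus>i\<in>{..<Suc n}. ?d i \<otimes> w i)"
      using h w ideal.Icarr[OF I_ideal h(1)] by (simp add: a_comm)
    then show ?case
      using d(1) h(2) by (intro exI[of _ ?d]) auto
  qed
  obtain M where M: "M \<in> range I" "\<And>Y. Y \<in> range I \<Longrightarrow> M \<subseteq> Y \<Longrightarrow> Y = M"
    by (rule maximal_in_family[of "range I"]) (use I_ideal in auto)
  then obtain n where n: "M = I n"
    by blast
  have "I n \<subseteq> I (Suc n)"
  proof
    show "x \<in> I (Suc n)" if "x \<in> I n" for x
      using Suc_I[OF that zero_closed] w ideal.Icarr[OF I_ideal that] by simp
  qed
  then have "I (Suc n) = I n"
    using M(2)[OF rangeI] n by simp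
  moreover have "w n \<in> I (Suc n)"
    using Suc_I[OF _ one_closed, of \<zero> n] w additive_subgroup.zero_closed[OF ideal.axioms(1)[OF I_ideal]]
    by simp
  ultimately show thesis
    using span[of "w n" n] that by auto
qed

subsection \<open>Ideals of Dedekind domains\<close>

locale dedekind = noetherian_domain D for D (structure) +
  assumes int_closed: "integrally_closed D"
    and nonzero_prime_maximal: "\<lbrakk>primeideal \<pp> D; \<pp> \<noteq> {\<zero>}\<rbrakk> \<Longrightarrow> maximalideal \<pp> D"

lemma dedekind_domain_iff: "dedekind_domain D \<longleftrightarrow> dedekind D"
  unfolding dedekind_domain_def dedekind_def dedekind_axioms_def by blast

context dedekind
begin

text \<open>
  By noetherianity some \<open>c (b/a)\<^sup>n\<close> is a combination of the \<open>c (b/a)\<^sup>i\<close> with \<open>i < n\<close>;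
  dividing by \<open>c\<close> gives an integral equation for \<open>b/a\<close>.
\<close>
lemma almost_integral_divides:
  fixes w :: "nat \<Rightarrow> 'a"
  assumes a: "a \<in> carrier D" "a \<noteq> \<zero>" and b: "b \<in> carrier D"
    and c: "c \<in> carrier D" "c \<noteq> \<zero>" and w: "\<And>n. w n \<in> carrier D"
    and eq: "\<And>n. c \<otimes> b [^] n = w n \<otimes> a [^] n"
  shows "a divides b"
proof -
  obtain n d where d: "\<And>i. d i \<in> carrier D" "w n = (\<Oplus>i\<in>{..<n}. d i \<otimes> w i)"
    by (rule sequence_in_span[OF is_cring, of w, OF w]) (rule that)
  note dc = d(1)
  \<comment> \<open>Integral closedness asks for an equation of positive degree. For
    \<open>n = 0\<close> the empty sum would give \<open>w 0 = 0\<close>, whereas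
    \<open>w 0 = c\<close>.\<close>
  have "n > 0"
  proof (rule ccontr)
    assume "\<not> n > 0"
    then have "w 0 = \<zero>"
      using d by simp
    then show False
      using eq[of 0] c w by simp
  qed
  have "c \<otimes> b [^] n = (\<Oplus>i\<in>{..<n}. d i \<otimes> w i) \<otimes> a [^] n"
    using eq d by simp
  also have "\<dots> = (\<Oplus>i\<in>{..<n}. d i \<otimes> w i \<otimes> a [^] n)"
    using a w d(1) by (intro finsum_ldistr) (auto simp: Pi_iff)
  also have "\<dots> = (\<Oplus>i\<in>{..<n}. c \<otimes> (d i \<otimes> b [^] i \<otimes> a [^] (n - i)))"
  proof (intro finsum_cong')
    fix i assume i: "i \<in> {..<n}"
    have "a [^] n = a [^] i \<otimes> a [^] (n - i)"
      using i a by (simp add: nat_pow_mult)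
    then have "d i \<otimes> w i \<otimes> a [^] n = d i \<otimes> (w i \<otimes> a [^] i) \<otimes> a [^] (n - i)"
      using i dc w a by (simp add: m_assoc)
    also have "\<dots> = d i \<otimes> (c \<otimes> b [^] i) \<otimes> a [^] (n - i)"
      by (simp add: eq)
    also have "\<dots> = c \<otimes> (d i \<otimes> b [^] i \<otimes> a [^] (n - i))"
      using i dc b c a by (simp add: m_ac)
    finally show "d i \<otimes> w i \<otimes> a [^] n = c \<otimes> (d i \<otimes> b [^] i \<otimes> a [^] (n - i))" .
  qed (use dc a b c in auto)
  also have "\<dots> = c \<otimes> (\<Oplus>i\<in>{..<n}. d i \<otimes> b [^] i \<otimes> a [^] (n - i))"
    using dc a b c by (intro finsum_rdistr[symmetric]) auto
  finally have pow: "b [^] n = (\<Oplus>i\<in>{..<n}. d i \<otimes> b [^] i \<otimes> a [^] (n - i))"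
    using c b dc a m_lcancel[of c] by (auto simp: Pi_iff)
  have "(\<Oplus>i\<in>{..<n}. (\<ominus> d i) \<otimes> b [^] i \<otimes> a [^] (n - i))
      = (\<Oplus>i\<in>{..<n}. (\<ominus> \<one>) \<otimes> (d i \<otimes> b [^] i \<otimes> a [^] (n - i)))"
    using dc a b by (intro finsum_cong') (auto simp: l_minus)
  also have "\<dots> = (\<ominus> \<one>) \<otimes> (\<Oplus>i\<in>{..<n}. d i \<otimes> b [^] i \<otimes> a [^] (n - i))"
    using dc a b by (intro finsum_rdistr[symmetric]) auto
  also have "\<dots> = \<ominus> (b [^] n)"
    using b by (simp add: pow[symmetric] l_minus)
  finally have eqn: "b [^] n \<oplus> (\<Oplus>i\<in>{..<n}. (\<ominus> d i) \<otimes> b [^] i \<otimes> a [^] (n - i)) = \<zero>"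
    using b by (simp add: r_neg)
  have "(\<lambda>i. \<ominus> d i) \<in> {..<n} \<rightarrow> carrier D"
    using dc by auto
  then have "\<exists>e \<in> {..<n} \<rightarrow> carrier D.
      b [^] n \<oplus> (\<Oplus>i\<in>{..<n}. e i \<otimes> b [^] i \<otimes> a [^] (n - i)) = \<zero>"
    by (rule bexI[of _ "\<lambda>i. \<ominus> d i", rotated]) (rule eqn)
  with \<open>n > 0\<close> have "\<exists>n::nat>0. \<exists>e \<in> {..<n} \<rightarrow> carrier D.
      b [^] n \<oplus> (\<Oplus>i\<in>{..<n}. e i \<otimes> b [^] i \<otimes> a [^] (n - i)) = \<zero>"
    by blast
  then show ?thesis
    using int_closed[unfolded integrally_closed_def, rule_format, of b a] a b by simp
qed

text \<open>The hypothesis \<open>stab\<close> says that the fraction \<open>w/a\<close> maps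
  \<open>I\<close> into itself. For a nonzero \<open>c\<close> in \<open>I\<close> all
  \<open>c (w/a)^n\<close> then stay in \<open>I\<close>, so \<open>w/a\<close> is almost integral
  over \<open>D\<close>.\<close>

lemma stabilized_ideal_divides:
  assumes I: "ideal I D" "I \<noteq> {\<zero>}" and a: "a \<in> carrier D" "a \<noteq> \<zero>" and w: "w \<in> carrier D"
    and stab: "\<And>y. y \<in> I \<Longrightarrow> \<exists>z \<in> I. w \<otimes> y = a \<otimes> z"
  shows "a divides w"
proof -
  interpret I: ideal I D by fact
  obtain c where c: "c \<in> I" "c \<noteq> \<zero>"
    using I(2) I.zero_closed by blast
  have "\<exists>x \<in> I. c \<otimes> w [^] n = x \<otimes> a [^] n" for n :: nat
  proof (induction n)
    case 0
    then show ?case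
      using c I.Icarr by auto
  next
    case (Suc n)
    then obtain x where x: "x \<in> I" "c \<otimes> w [^] n = x \<otimes> a [^] n"
      by blast
    obtain z where z: "z \<in> I" "w \<otimes> x = a \<otimes> z"
      using stab x by blast
    have "c \<otimes> w [^] Suc n = w \<otimes> (c \<otimes> w [^] n)"
      using c w I.Icarr by (simp add: m_ac)
    also have "\<dots> = (w \<otimes> x) \<otimes> a [^] n"
      using x w a I.Icarr by (simp add: m_assoc)
    also have "\<dots> = z \<otimes> a [^] Suc n"
      using z(1) a I.Icarr by (simp add: z(2) m_ac)
    finally show ?case
      using z by blast
  qed
  then have "\<forall>n. \<exists>x. x \<in> I \<and> c \<otimes> w [^] (n::nat) = x \<otimes> a [^] n"
    by blast
  then obtain x where x: "\<And>n :: nat. x n \<in> I" "\<And>n :: nat. c \<otimes> w [^] n = x n \<otimes> a [^] n"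
    using choice[of "\<lambda>n x. x \<in> I \<and> c \<otimes> w [^] (n::nat) = x \<otimes> a [^] n"] by blast
  show ?thesis
    using almost_integral_divides[of a w c x] x c a w I.Icarr by blast
qed

text \<open>
  A colon ideal \<open>(aD : w)\<close> maximal among those contained in \<open>\<mm>\<close> is prime, hence equals \<open>\<mm>\<close>.
\<close>
lemma maximal_ideal_colon:
  assumes m: "maximalideal \<mm> D" and a: "a \<in> \<mm>" "a \<noteq> \<zero>"
  obtains w where "w \<in> carrier D" "\<not> a divides w" "\<And>y. y \<in> \<mm> \<Longrightarrow> a divides (w \<otimes> y)"
proof -
  interpret m: maximalideal \<mm> D by fact
  interpret mp: primeideal \<mm> D
    using m by (rule maximalideal_prime)
  have ac: "a \<in> carrier D"
    using a m.Icarr by blast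
  define colon where "colon w = {y \<in> carrier D. a divides (w \<otimes> y)}" for w
  have colon_ideal: "ideal (colon w) D" if "w \<in> carrier D" for w
    using colon_ideal[OF multiples_ideal[OF oneideal ac], of "{w}"] that
    unfolding colon_def divides_iff_multiple by simp
  let ?S = "{colon w | w. w \<in> carrier D \<and> colon w \<subseteq> \<mm>}"
  have "colon \<one> \<subseteq> \<mm>"
    using a ac m.I_r_closed unfolding colon_def factor_def by auto
  then have "?S \<noteq> {}"
    by blast
  then obtain q where q: "q \<in> ?S" "\<And>Y. Y \<in> ?S \<Longrightarrow> q \<subseteq> Y \<Longrightarrow> Y = q"
    by (rule maximal_in_family[of ?S]) (use colon_ideal in auto)
  obtain w where w: "w \<in> carrier D" "q = colon w" "colon w \<subseteq> \<mm>"
    using q(1) by auto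
  \<comment> \<open>An element \<open>v\<close> outside \<open>q\<close> makes
    \<open>colon (w u)\<close> strictly larger than \<open>q\<close>, so by maximality it leaves
    \<open>\<mm>\<close>. Primality of \<open>q\<close> follows by using this twice: first
    \<open>v\<close>, then \<open>u\<close> is traded for an element outside \<open>\<mm>\<close>,
    and the product \<open>s t\<close> of the two lies in \<open>q \<subseteq> \<mm>\<close>,
    against primality of \<open>\<mm>\<close>.\<close>
  have not_sub: "\<exists>s \<in> carrier D - \<mm>. a divides (w \<otimes> u \<otimes> s)"
    if u: "u \<in> carrier D" and v: "v \<in> carrier D" "v \<notin> q" "a divides (w \<otimes> u \<otimes> v)" for u v
  proof -
    have "q \<subseteq> colon (w \<otimes> u)"
    proof
      fix y assume "y \<in> q"
      then have y: "y \<in> carrier D" "u \<otimes> y \<in> q"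
        using w(2) ideal.Icarr[OF colon_ideal[OF w(1)]] ideal.I_l_closed[OF colon_ideal[OF w(1)] _ u] by auto
      then show "y \<in> colon (w \<otimes> u)"
        using w u unfolding colon_def by (simp add: m_assoc)
    qed
    moreover have "v \<in> colon (w \<otimes> u)"
      using v u w unfolding colon_def by simp
    ultimately have "\<not> colon (w \<otimes> u) \<subseteq> \<mm>"
      using q(2)[of "colon (w \<otimes> u)"] v(2) u w(1) by blast
    then show ?thesis
      unfolding colon_def by blast
  qed
  have "primeideal q D"
  proof (rule primeidealI)
    show "ideal q D"
      using colon_ideal w by blast
    show "cring D"
      by (rule is_cring)
    show "carrier D \<noteq> q"
      using w m.I_notcarr m.Icarr by blast
    fix u v assume u: "u \<in> carrier D" and v: "v \<in> carrier D" and uv: "u \<otimes> v \<in> q"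
    show "u \<in> q \<or> v \<in> q"
    proof (rule ccontr)
      assume no: "\<not> (u \<in> q \<or> v \<in> q)"
      have "a divides (w \<otimes> u \<otimes> v)"
        using uv u v w unfolding colon_def by (simp add: m_assoc)
      then obtain s where s: "s \<in> carrier D" "s \<notin> \<mm>" "a divides (w \<otimes> u \<otimes> s)"
        using not_sub[of u v] u v no by blast
      then have "a divides (w \<otimes> s \<otimes> u)"
        using u w by (simp add: m_ac)
      then obtain t where t: "t \<in> carrier D" "t \<notin> \<mm>" "a divides (w \<otimes> s \<otimes> t)"
        using not_sub[of s u] u s no by blast
      then have "s \<otimes> t \<in> q"
        using w s unfolding colon_def by (simp add: m_assoc)
      then show False
        using w s t mp.I_prime by blast
    qed
  qed
  moreover have "a \<in> q"
    using w ac unfolding colon_def factor_def by (auto intro!: bexI[of _ w] simp: m_comm)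
  ultimately have "maximalideal q D"
    using nonzero_prime_maximal a by blast
  then have "q = \<mm>"
    using maximalideal.I_maximal[of q D \<mm>] m.ideal_axioms w m.I_notcarr m.a_subset by blast
  moreover have "\<one> \<notin> q"
    using \<open>q = \<mm>\<close> m.one_imp_carrier m.I_notcarr by blast
  moreover have "a divides (w \<otimes> y)" if "y \<in> q" for y
    using that w(2) unfolding colon_def by simp
  moreover have "\<not> a divides w" if "\<one> \<notin> q"
    using that w(1,2) unfolding colon_def by simp
  ultimately show thesis
    using that[of w] w(1) by simp
qed

text \<open>This encodes \<open>I I' = c D\<close>, that is \<open>I^-1 = c^-1 I'\<close>, by data
  inside \<open>D\<close>: the last two clauses are the inclusions of \<open>c D\<close> in
  \<open>I I'\<close> and of \<open>I I'\<close> in \<open>c D\<close>.\<close>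

definition inverse_pair :: "'a set \<Rightarrow> 'a set \<Rightarrow> 'a \<Rightarrow> bool" where
  "inverse_pair I I' c \<longleftrightarrow> ideal I' D \<and> c \<in> carrier D \<and> c \<noteq> \<zero> \<and> c \<in> I \<cdot> I' \<and>
     (\<forall>i \<in> I. \<forall>j \<in> I'. c divides (i \<otimes> j))"

text \<open>
  A maximal non-invertible \<open>M\<close> lies in some \<open>\<mm> = (aD : w)\<close>. As \<open>w/a\<close> is not integral,
  \<open>J = M + (w/a) M = M (D + (w/a) D)\<close> is strictly larger, hence invertible, and so is its factor \<open>M\<close>.
\<close>
theorem nonzero_ideal_invertible:
  assumes "ideal I D" "I \<noteq> {\<zero>}"
  obtains I' c where "inverse_pair I I' c"
proof -
  let ?S = "{I. ideal I D \<and> I \<noteq> {\<zero>} \<and> (\<nexists>I' c. inverse_pair I I' c)}"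
  have "?S = {}"
  proof (rule ccontr)
    assume "?S \<noteq> {}"
    then obtain M where M: "M \<in> ?S" "\<And>Y. Y \<in> ?S \<Longrightarrow> M \<subseteq> Y \<Longrightarrow> Y = M"
      by (rule maximal_in_family[of ?S]) auto
    interpret M: ideal M D
      using M by blast
    have "inverse_pair (carrier D) (carrier D) \<one>"
      using ideal_prod.prod[of \<one> "carrier D" \<one> "carrier D" D]
      unfolding inverse_pair_def factor_def by (auto simp: oneideal)
    then have "M \<noteq> carrier D"
      using M(1) by blast
    then obtain \<mm> where m: "maximalideal \<mm> D" "M \<subseteq> \<mm>"
      using proper_ideal_below_maximal M.ideal_axioms by blast
    interpret m: maximalideal \<mm> D by fact
    obtain a where a: "a \<in> \<mm>" "a \<noteq> \<zero>"
      using M(1) m(2) M.zero_closed by blast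
    have ac: "a \<in> carrier D"
      using a m.Icarr by blast
    obtain w where w: "w \<in> carrier D" "\<not> a divides w" "\<And>y. y \<in> \<mm> \<Longrightarrow> a divides (w \<otimes> y)"
      using maximal_ideal_colon[OF m(1) a] by blast
    \<comment> \<open>The sum \<open>M + (w/a) M\<close> with its denominator cleared. The second
      summand lies in \<open>D\<close> because \<open>M \<subseteq> \<mm>\<close> and
      \<open>a\<close> divides \<open>w \<mm>\<close>.\<close>
    define J where "J = {z \<in> carrier D. \<exists>x \<in> M. \<exists>y \<in> M. a \<otimes> z = a \<otimes> x \<oplus> w \<otimes> y}"
    have J: "ideal J D"
    proof -
      have "J = {z \<in> carrier D. \<forall>b \<in> {a}. b \<otimes> z \<in> (\<otimes>) a ` M <+> (\<otimes>) w ` M}"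
        unfolding J_def set_add_def' by auto
      then show ?thesis
        using colon_ideal[OF add_ideals[OF multiples_ideal multiples_ideal], of M a M w "{a}"]
          M.ideal_axioms ac w(1) by simp
    qed
    interpret J: ideal J D by fact
    have J_shift: "z \<in> J" if "z \<in> carrier D" "y \<in> M" "w \<otimes> y = a \<otimes> z" for y z
    proof -
      have "a \<otimes> z = a \<otimes> \<zero> \<oplus> w \<otimes> y"
        using that ac by simp
      then show ?thesis
        using that(1,2) M.zero_closed unfolding J_def by blast
    qed
    have MJ: "M \<subseteq> J"
    proof
      fix x assume "x \<in> M"
      moreover from this have "a \<otimes> x = a \<otimes> x \<oplus> w \<otimes> \<zero>"
        using ac M.Icarr w(1) by simp
      ultimately show "x \<in> J"
        using M.zero_closed M.Icarr[of x] unfolding J_def by blast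
    qed
    have "J \<noteq> M"
    proof
      assume "J = M"
      have "\<exists>z \<in> M. w \<otimes> y = a \<otimes> z" if "y \<in> M" for y
        using w(3)[of y] that m(2) J_shift[of _ y] unfolding \<open>J = M\<close> factor_def by blast
      then show False
        using stabilized_ideal_divides[of M a w] M(1) ac a w by blast
    qed
    moreover have "J \<noteq> {\<zero>}"
      using MJ M(1) M.zero_closed by blast
    ultimately obtain J' c where J': "inverse_pair J J' c"
      using M(2)[of J] J MJ by blast
    interpret J': ideal J' D
      using J' unfolding inverse_pair_def by blast
    have c: "c \<in> carrier D" "c \<noteq> \<zero>" "c \<in> J \<cdot> J'"
      and cdiv: "\<And>i j. i \<in> J \<Longrightarrow> j \<in> J' \<Longrightarrow> c divides (i \<otimes> j)"
      using J' unfolding inverse_pair_def by auto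
    \<comment> \<open>This is \<open>(aD + wD) J'\<close>. Since \<open>a J = M (aD + wD)\<close>
      and \<open>J J' = c D\<close>, the expected relation is \<open>M I' = a c D\<close>.\<close>
    define I' where "I' = {u. \<exists>j \<in> J'. \<exists>k \<in> J'. u = a \<otimes> j \<oplus> w \<otimes> k}"
    have I'I: "a \<otimes> j \<oplus> w \<otimes> k \<in> I'" if "j \<in> J'" "k \<in> J'" for j k
      using that unfolding I'_def by blast
    have "I' = (\<otimes>) a ` J' <+> (\<otimes>) w ` J'"
      unfolding I'_def set_add_def' by blast
    then have "ideal I' D"
      using add_ideals[OF multiples_ideal multiples_ideal] J'.ideal_axioms ac w(1) by simp
    moreover have "a \<otimes> c \<in> M \<cdot> I'"
    proof -
      have "c \<in> {z \<in> carrier D. a \<otimes> z \<in> M \<cdot> I'}"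
      proof (rule ideal_prod_closed[OF c(3)])
        fix z j assume z: "z \<in> J" and j: "j \<in> J'"
        obtain x y where xy: "x \<in> M" "y \<in> M" "a \<otimes> z = a \<otimes> x \<oplus> w \<otimes> y"
          using z unfolding J_def by auto
        have "a \<otimes> (z \<otimes> j) = (a \<otimes> z) \<otimes> j"
          using ac J.Icarr J'.Icarr z j by (simp add: m_assoc)
        also have "\<dots> = x \<otimes> (a \<otimes> j) \<oplus> y \<otimes> (w \<otimes> j)"
          using ac w(1) M.Icarr J'.Icarr j xy(1,2) by (subst xy(3), subst l_distr) (auto simp: m_ac)
        also have "\<dots> \<in> M \<cdot> I'"
          using I'I[of j \<zero>] I'I[of \<zero> j] j ac w(1) J'.Icarr J'.zero_closed xy
          by (intro ideal_prod.sum ideal_prod.prod) auto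
        finally show "z \<otimes> j \<in> {z \<in> carrier D. a \<otimes> z \<in> M \<cdot> I'}"
          using J.Icarr J'.Icarr z j by simp
      qed (use ac in \<open>auto simp: r_distr intro: ideal_prod.sum\<close>)
      then show ?thesis
        by simp
    qed
    moreover have "(a \<otimes> c) divides (x \<otimes> u)" if x: "x \<in> M" and u: "u \<in> I'" for x u
    proof -
      obtain j k where jk: "j \<in> J'" "k \<in> J'" "u = a \<otimes> j \<oplus> w \<otimes> k"
        using u unfolding I'_def by auto
      obtain x' where x': "x' \<in> carrier D" "w \<otimes> x = a \<otimes> x'"
        using w(3)[of x] x m(2) unfolding factor_def by blast
      then have "x' \<in> J"
        using J_shift x by blast
      then have "c divides (x \<otimes> j)" "c divides (x' \<otimes> k)"
        using cdiv jk(1,2) subsetD[OF MJ x] by blast+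
      then obtain d e where de: "d \<in> carrier D" "x \<otimes> j = c \<otimes> d" "e \<in> carrier D" "x' \<otimes> k = c \<otimes> e"
        unfolding factor_def by blast
      have "x \<otimes> u = a \<otimes> (x \<otimes> j) \<oplus> (w \<otimes> x) \<otimes> k"
        using ac w(1) J'.Icarr M.Icarr x jk(1,2) by (simp add: jk(3) r_distr m_ac)
      also have "\<dots> = a \<otimes> (x \<otimes> j) \<oplus> a \<otimes> (x' \<otimes> k)"
        using ac J'.Icarr jk(2) x'(1) by (simp add: x'(2) m_assoc)
      also have "\<dots> = (a \<otimes> c) \<otimes> (d \<oplus> e)"
        using ac c(1) de(1,3) by (simp add: de(2,4) r_distr m_assoc)
      finally show ?thesis
        using de(1,3) unfolding factor_def by auto
    qed
    ultimately have "inverse_pair M I' (a \<otimes> c)"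
      using ac c a integral_iff[of a c] unfolding inverse_pair_def by auto
    then show False
      using M(1) by blast
  qed
  then show thesis
    using assms that by blast
qed

text \<open>If every quotient \<open>i j / c\<close> lay in \<open>\<mm>\<close>, then
  \<open>c\<close>, being a sum of products \<open>i j\<close>, would lie in \<open>c \<mm>\<close>,
  and cancelling \<open>c\<close> would put 1 into \<open>\<mm>\<close>.\<close>

lemma inverse_pair_not_in_multiple:
  assumes "inverse_pair I I' c" "ideal \<mm> D" "\<mm> \<noteq> carrier D"
  obtains i j d where "i \<in> I" "j \<in> I'" "d \<in> carrier D" "i \<otimes> j = c \<otimes> d" "d \<notin> \<mm>"
proof (rule ccontr)
  assume no: "\<not> thesis"
  interpret m: ideal \<mm> D by fact
  have c: "c \<in> carrier D" "c \<noteq> \<zero>" "c \<in> I \<cdot> I'"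
    and cdiv: "\<And>i j. i \<in> I \<Longrightarrow> j \<in> I' \<Longrightarrow> \<exists>d \<in> carrier D. i \<otimes> j = c \<otimes> d"
    using assms(1) unfolding inverse_pair_def factor_def by auto
  interpret cm: ideal "(\<otimes>) c ` \<mm>" D
    using multiples_ideal[OF assms(2) c(1)] .
  have "c \<in> (\<otimes>) c ` \<mm>"
  proof (rule ideal_prod_closed[OF c(3)])
    fix i j assume ij: "i \<in> I" "j \<in> I'"
    obtain d where d: "d \<in> carrier D" "i \<otimes> j = c \<otimes> d"
      using cdiv[OF ij] by blast
    then show "i \<otimes> j \<in> (\<otimes>) c ` \<mm>"
      using no that[OF ij d] by blast
  qed (rule cm.a_closed)
  then obtain d where d: "d \<in> \<mm>" "c \<otimes> \<one> = c \<otimes> d"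
    using c by auto
  then have "\<one> = d"
    using c m.Icarr m_lcancel[of c \<one> d] by auto
  then show False
    using d m.one_imp_carrier assms(3) by auto
qed

end

text \<open>The coefficient at the sum of the two lowest indices outside \<open>\<mm>\<close> survives.\<close>
lemma (in primeideal) convolution_notin:
  fixes F G :: "nat \<Rightarrow> 'a"
  assumes F: "\<And>n. F n \<in> carrier R" and G: "\<And>n. G n \<in> carrier R"
    and "F k \<notin> I" "G l \<notin> I"
  obtains n where "(\<Oplus>i\<in>{..n}. G i \<otimes> F (n - i)) \<notin> I"
proof -
  define a where "a = (LEAST n. F n \<notin> I)"
  define b where "b = (LEAST n. G n \<notin> I)"
  have a: "F a \<notin> I" "\<And>i. i < a \<Longrightarrow> F i \<in> I"
    using LeastI[of "\<lambda>n. F n \<notin> I" k] assms(3) not_less_Least[of _ "\<lambda>n. F n \<notin> I"]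
    unfolding a_def by blast+
  have b: "G b \<notin> I" "\<And>i. i < b \<Longrightarrow> G i \<in> I"
    using LeastI[of "\<lambda>n. G n \<notin> I" l] assms(4) not_less_Least[of _ "\<lambda>n. G n \<notin> I"]
    unfolding b_def by blast+
  have "(\<Oplus>i\<in>{..a + b}. G i \<otimes> F (a + b - i)) \<notin> I"
  proof
    assume "(\<Oplus>i\<in>{..a + b}. G i \<otimes> F (a + b - i)) \<in> I"
    then have "G b \<otimes> F (a + b - b) \<in> I"
    proof (rule finsum_in_remaining[rotated -1])
      fix i assume i: "i \<in> {..a + b}" "i \<noteq> b"
      show "G i \<otimes> F (a + b - i) \<in> I"
      proof (cases "i < b")
        case True
        then show ?thesis
          using b F I_r_closed by auto
      next
        case False
        then have "a + b - i < a"
          using i by auto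
        then show ?thesis
          using a G I_l_closed by auto
      qed
    qed (use F G in auto)
    then show False
      using a b I_prime[of "G b" "F a"] F G by auto
  qed
  then show thesis
    by (rule that)
qed

section \<open>Contents of coefficient sequences and Gauss's lemma\<close>

context dedekind
begin

text \<open>Clears the content of \<open>g\<close> locally at \<open>\<mm>\<close>:
  \<open>v/t\<close> ranges over the inverse of the content, so all \<open>F = (v/t) g\<close> are
  integral. Were all of them contained in \<open>\<mm>\<close>, the product of the content with
  \<open>K\<close> would lie in \<open>t \<mm>\<close>, which
  \<open>inverse_pair_not_in_multiple\<close> excludes.\<close>

lemma inverse_pair_scaled_notin:
  fixes g :: "nat \<Rightarrow> 'a"
  assumes g: "\<And>n. g n \<in> carrier D" and K: "inverse_pair (Idl (range g)) K t"
    and m: "ideal \<mm> D" "\<mm> \<noteq> carrier D"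
  obtains v k F where "v \<in> K" "\<And>n. F n \<in> carrier D" "\<And>n. v \<otimes> g n = t \<otimes> F n" "F k \<notin> \<mm>"
proof (rule ccontr)
  note found = that
  assume no: "\<not> thesis"
  interpret m: ideal \<mm> D by fact
  interpret K: ideal K D
    using K unfolding inverse_pair_def by blast
  have t: "t \<in> carrier D" "t \<noteq> \<zero>"
    using K unfolding inverse_pair_def by auto
  have tdvd: "\<exists>d \<in> carrier D. i \<otimes> j = t \<otimes> d" if "i \<in> Idl (range g)" "j \<in> K" for i j
    using K that unfolding inverse_pair_def factor_def by simp
  have K_sub: "K \<subseteq> carrier D"
    using K.Icarr by blast
  let ?C = "{x \<in> carrier D. \<forall>v \<in> K. v \<otimes> x \<in> (\<otimes>) t ` \<mm>}"
  have "range g \<subseteq> ?C"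
  proof
    fix x assume "x \<in> range g"
    then obtain n where x: "x = g n"
      by blast
    have "v \<otimes> g n \<in> (\<otimes>) t ` \<mm>" if v: "v \<in> K" for v
    proof -
      have "\<exists>d. d \<in> carrier D \<and> v \<otimes> g n = t \<otimes> d" for n
        using tdvd[of "g n" v] genideal_self[of "range g"] g v K.Icarr m_comm[of v "g n"] by auto
      then obtain F where F: "\<And>n. F n \<in> carrier D" "\<And>n. v \<otimes> g n = t \<otimes> F n"
        by metis
      then have "F n \<in> \<mm>"
        using no found[OF v F] by blast
      then show ?thesis
        using F(2) by blast
    qed
    then show "x \<in> ?C"
      using g x by blast
  qed
  then have sub: "Idl (range g) \<subseteq> ?C"
    using genideal_minimal[OF colon_ideal[OF multiples_ideal[OF m(1) t(1)] K_sub]] by blast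
  obtain i j d where ij: "i \<in> Idl (range g)" "j \<in> K" "d \<in> carrier D" "i \<otimes> j = t \<otimes> d" "d \<notin> \<mm>"
    by (rule inverse_pair_not_in_multiple[OF K m])
  then obtain b where b: "b \<in> \<mm>" "j \<otimes> i = t \<otimes> b"
    using subsetD[OF sub ij(1)] by blast
  have "t \<otimes> d = t \<otimes> b"
    using b(2) ij(4) m_comm[of i j] subsetD[OF sub ij(1)] K.Icarr[OF ij(2)] by simp
  then have "d = b"
    using m_lcancel[of t d b] t ij(3) m.Icarr[OF b(1)] by simp
  then show False
    using b(1) ij(5) by simp
qed

text \<open>The part of Gauss's lemma \<open>c(qf) = c(q) c(f)\<close> that is needed: \<open>c(qf) \<subseteq> c \<cdot> c(f)\<close> implies \<open>c(q) \<subseteq> cD\<close>.\<close>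
lemma gauss:
  fixes q f :: "nat \<Rightarrow> 'a"
  assumes q: "\<And>n. q n \<in> carrier D" and f: "\<And>n. f n \<in> carrier D" and f0: "f k \<noteq> \<zero>"
    and c: "c \<in> carrier D"
    and prod: "\<And>n. \<exists>j \<in> Idl (range f). (\<Oplus>i\<in>{..n}. q i \<otimes> f (n - i)) = c \<otimes> j"
  shows "c divides (q l)"
proof (cases "\<forall>l. q l = \<zero>")
  case True
  then show ?thesis
    using c by (auto simp: divides_zero)
next
  case False
  have rf: "range f \<subseteq> carrier D" and rq: "range q \<subseteq> carrier D"
    using f q by auto
  let ?J = "Idl (range f)" and ?C = "Idl (range q)"
  have J: "ideal ?J D" "range f \<subseteq> ?J" and C: "ideal ?C D" "range q \<subseteq> ?C"
    using genideal_ideal genideal_self rf rq by auto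
  obtain J' e where J': "inverse_pair ?J J' e"
    using nonzero_ideal_invertible[OF J(1)] f0 J(2) by blast
  obtain C' s where C': "inverse_pair ?C C' s"
    using nonzero_ideal_invertible[OF C(1)] False C(2) by blast
  interpret J': ideal J' D
    using J' unfolding inverse_pair_def by blast
  interpret C': ideal C' D
    using C' unfolding inverse_pair_def by blast
  have e: "e \<in> carrier D" "e \<noteq> \<zero>" and s: "s \<in> carrier D" "s \<noteq> \<zero>"
    and edvd: "\<And>i j. i \<in> ?J \<Longrightarrow> j \<in> J' \<Longrightarrow> e divides (i \<otimes> j)"
    and sdvd: "\<And>i j. i \<in> ?C \<Longrightarrow> j \<in> C' \<Longrightarrow> s divides (i \<otimes> j)"
    using J' C' unfolding inverse_pair_def by auto
  \<comment> \<open>The conductor of \<open>c(q)\<close> into \<open>c D\<close>; the claim is that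
    it contains 1. If it were proper, it would lie in a maximal ideal \<open>\<mm>\<close>, and an
    element of \<open>N\<close> outside \<open>\<mm>\<close> gives the contradiction.\<close>
  define N where "N = {z \<in> carrier D. \<forall>i. c divides (z \<otimes> q i)}"
  have N: "ideal N D"
  proof -
    have "N = {z \<in> carrier D. \<forall>b \<in> range q. b \<otimes> z \<in> (\<otimes>) c ` carrier D}"
      unfolding N_def divides_iff_multiple using q by (auto simp: m_comm)
    then show ?thesis
      using colon_ideal[OF multiples_ideal[OF oneideal c] rq] by simp
  qed
  have "N = carrier D"
  proof (rule ccontr)
    assume "N \<noteq> carrier D"
    then obtain \<mm> where "maximalideal \<mm> D" and N\<mm>: "N \<subseteq> \<mm>"
      using proper_ideal_below_maximal N by blast
    interpret m: primeideal \<mm> D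
      using \<open>maximalideal \<mm> D\<close> by (rule maximalideal_prime)
    \<comment> \<open>\<open>F = (v/e) f\<close> and \<open>G = (u/s) q\<close> both have a
      coefficient outside \<open>\<mm>\<close>, hence so does their product. That coefficient
      \<open>z\<close> is the element of \<open>N\<close> sought: \<open>z = (u/s) c d\<close> by
      the hypothesis on \<open>q f\<close>, so \<open>z q_i = c d G_i\<close>.\<close>
    obtain v k' F where F: "v \<in> J'" "\<And>n. F n \<in> carrier D" "\<And>n. v \<otimes> f n = e \<otimes> F n" "F k' \<notin> \<mm>"
      by (rule inverse_pair_scaled_notin[OF f J' m.ideal_axioms]) (use m.I_notcarr in auto)
    obtain u l' G where G: "u \<in> C'" "\<And>n. G n \<in> carrier D" "\<And>n. u \<otimes> q n = s \<otimes> G n" "G l' \<notin> \<mm>"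
      by (rule inverse_pair_scaled_notin[OF q C' m.ideal_axioms]) (use m.I_notcarr in auto)
    obtain n where n: "(\<Oplus>i\<in>{..n}. G i \<otimes> F (n - i)) \<notin> \<mm>" (is "?z \<notin> _")
      using m.convolution_notin[of F G k' l'] F(2,4) G(2,4) by blast
    have uv: "u \<in> carrier D" "v \<in> carrier D"
      using F G J'.Icarr C'.Icarr by auto
    have z: "?z \<in> carrier D"
      using F G by (auto intro!: finsum_closed)
    obtain j where j: "j \<in> ?J" "(\<Oplus>i\<in>{..n}. q i \<otimes> f (n - i)) = c \<otimes> j"
      using prod[of n] by auto
    obtain d where d: "d \<in> carrier D" "j \<otimes> v = e \<otimes> d"
      using edvd[OF j(1) F(1)] unfolding factor_def by auto
    have jc: "j \<in> carrier D"
      using j(1) J(1) ideal.Icarr by metis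
    have "(s \<otimes> e) \<otimes> ?z = (\<Oplus>i\<in>{..n}. (s \<otimes> e) \<otimes> (G i \<otimes> F (n - i)))"
      using s e F G by (intro finsum_rdistr) auto
    also have "\<dots> = (\<Oplus>i\<in>{..n}. (u \<otimes> v) \<otimes> (q i \<otimes> f (n - i)))"
    proof (intro finsum_cong')
      fix i
      have "(s \<otimes> e) \<otimes> (G i \<otimes> F (n - i)) = (s \<otimes> G i) \<otimes> (e \<otimes> F (n - i))"
        using s e F G by (simp add: m_ac)
      also have "\<dots> = (u \<otimes> q i) \<otimes> (v \<otimes> f (n - i))"
        by (simp add: F G)
      also have "\<dots> = (u \<otimes> v) \<otimes> (q i \<otimes> f (n - i))"
        using uv q f by (simp add: m_ac)
      finally show "(s \<otimes> e) \<otimes> (G i \<otimes> F (n - i)) = (u \<otimes> v) \<otimes> (q i \<otimes> f (n - i))" .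
    qed (use uv q f in auto)
    also have "\<dots> = (u \<otimes> v) \<otimes> (c \<otimes> j)"
      using uv q f by (subst j(2)[symmetric], intro finsum_rdistr[symmetric]) auto
    also have "\<dots> = u \<otimes> c \<otimes> (j \<otimes> v)"
      using uv c jc by (simp add: m_ac)
    also have "\<dots> = e \<otimes> (u \<otimes> c \<otimes> d)"
      using uv c d e by (simp add: m_ac)
    finally have "e \<otimes> (s \<otimes> ?z) = e \<otimes> (u \<otimes> c \<otimes> d)"
      using s e z by (simp add: m_ac)
    then have sz: "s \<otimes> ?z = u \<otimes> c \<otimes> d"
      using m_lcancel[of e "s \<otimes> ?z" "u \<otimes> c \<otimes> d"] s e z uv c d by auto
    have "c divides (?z \<otimes> q i)" for i
    proof -
      have "s \<otimes> (?z \<otimes> q i) = (s \<otimes> ?z) \<otimes> q i"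
        by (rule m_assoc[symmetric]) (use s z q in blast)+
      also have "\<dots> = (u \<otimes> c \<otimes> d) \<otimes> q i"
        by (simp only: sz)
      also have "\<dots> = c \<otimes> d \<otimes> (u \<otimes> q i)"
        using uv c d q by (simp add: m_ac)
      also have "\<dots> = s \<otimes> (c \<otimes> (d \<otimes> G i))"
        using uv c d G(2) s by (simp add: G(3) m_ac)
      finally have "?z \<otimes> q i = c \<otimes> (d \<otimes> G i)"
        using m_lcancel[of s "?z \<otimes> q i" "c \<otimes> (d \<otimes> G i)"] s z q c d G(2) by auto
      then show ?thesis
        using d G(2) unfolding factor_def by blast
    qed
    then show False
      using z n N\<mm> unfolding N_def by blast
  qed
  then have "\<one> \<in> N"
    by simp
  then show ?thesis
    using q unfolding N_def by auto
qed

end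

subsection \<open>The Ore extension is a ring\<close>

text \<open>Peels index 0 off a sum over the support; multiplication and evaluation of skew
  polynomials both get their recursion from it. The value \<open>a\<close> may be \<open>z\<close>,
  so the support is first enlarged by indices whose summands vanish.\<close>

lemma (in abelian_monoid) finsum_case_nat:
  fixes p :: "nat \<Rightarrow> 'c"
  assumes fin: "finite {i. p i \<noteq> z}" and z: "\<And>i. g i z = \<zero>"
    and g: "\<And>i b. b \<in> B \<Longrightarrow> g i b \<in> carrier G" and a: "a \<in> B" and p: "\<And>i. p i \<in> B"
  shows "(\<Oplus>i\<in>{i. case_nat a p i \<noteq> z}. g i (case_nat a p i))
    = g 0 a \<oplus> (\<Oplus>i\<in>{i. p i \<noteq> z}. g (Suc i) (p i))"
proof -
  let ?h = "\<lambda>i. g i (case_nat a p i)"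
  have h: "?h i \<in> carrier G" for i
    using g a p by (cases i) auto
  have "(\<Oplus>i\<in>{i. case_nat a p i \<noteq> z}. ?h i) = (\<Oplus>i\<in>insert 0 (Suc ` {i. p i \<noteq> z}). ?h i)"
  proof (rule add.finprod_mono_neutral_cong_left)
    show "{i. case_nat a p i \<noteq> z} \<subseteq> insert 0 (Suc ` {i. p i \<noteq> z})"
    proof (rule subsetI)
      fix i assume "i \<in> {i. case_nat a p i \<noteq> z}"
      then show "i \<in> insert 0 (Suc ` {i. p i \<noteq> z})"
        by (cases i) auto
    qed
    show "?h i = \<zero>" if "i \<in> insert 0 (Suc ` {i. p i \<noteq> z}) - {i. case_nat a p i \<noteq> z}" for i
      using z that by auto
  qed (use fin h a g p in auto)
  also have "\<dots> = g 0 a \<oplus> (\<Oplus>i\<in>Suc ` {i. p i \<noteq> z}. ?h i)"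
    using fin h a g p by (subst finsum_insert) auto
  also have "(\<Oplus>i\<in>Suc ` {i. p i \<noteq> z}. ?h i) = (\<Oplus>i\<in>{i. p i \<noteq> z}. g (Suc i) (p i))"
    using g p by (subst finsum_reindex) auto
  finally show ?thesis .
qed

context ring
begin

lemma upI:
  assumes "\<And>n. f n \<in> carrier R" "\<And>m. m \<ge> n \<Longrightarrow> f m = \<zero>"
  shows "f \<in> up R"
  using assms unfolding up_def bound_def by (auto intro!: exI[of _ n])

lemma upE:
  assumes "f \<in> up R"
  obtains n where "\<And>m. m \<ge> n \<Longrightarrow> f m = \<zero>"
proof -
  obtain n where "bound \<zero> n f"
    using assms unfolding up_def by blast
  then show thesis
    using that[of "Suc n"] by (auto simp: bound_def)
qed

lemmas up_closed = mem_upD [of _ R]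

lemma up_zero: "(\<lambda>_. \<zero>) \<in> up R"
  by (rule upI) auto

lemma up_case_nat:
  assumes a: "a \<in> carrier R" and p: "p \<in> up R"
  shows "case_nat a p \<in> up R"
proof -
  obtain n where n: "\<And>m. m \<ge> n \<Longrightarrow> p m = \<zero>"
    using upE[OF p] by blast
  show ?thesis
    by (rule upI[of _ "Suc n"]) (use a n up_closed[OF p] in \<open>auto split: nat.splits\<close>)
qed

lemma up_tail:
  assumes "p \<in> up R"
  shows "(\<lambda>n. p (Suc n)) \<in> up R"
proof -
  obtain n where n: "\<And>m. m \<ge> n \<Longrightarrow> p m = \<zero>"
    using upE[OF assms] by blast
  show ?thesis
    by (rule upI[of _ n]) (use n up_closed[OF assms] in auto)
qed

lemma case_nat_tail: "case_nat (p 0) (\<lambda>n. p (Suc n)) = p"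
  by (rule ext) (simp split: nat.split)

lemma up_finite_support:
  assumes "p \<in> up R"
  shows "finite {i. p i \<noteq> \<zero>}"
proof -
  obtain n where n: "\<And>m. m \<ge> n \<Longrightarrow> p m = \<zero>"
    using upE[OF assms] by blast
  have "{i. p i \<noteq> \<zero>} \<subseteq> {..<n}"
    using n not_le by blast
  then show ?thesis
    using finite_subset by blast
qed

text \<open>Reading \<open>case_nat a p\<close> as \<open>a + p x\<close>, this is induction by
  splitting off the constant coefficient. The ring laws are proved with it, so that no double sums
  have to be rearranged.\<close>

lemma up_induct [consumes 1, case_names zero case_nat]:
  assumes "p \<in> up R"
    and zero: "P (\<lambda>_. \<zero>)"
    and step: "\<And>a p. a \<in> carrier R \<Longrightarrow> p \<in> up R \<Longrightarrow> P p \<Longrightarrow> P (case_nat a p)"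
  shows "P p"
proof -
  obtain n where "\<And>m. m \<ge> n \<Longrightarrow> p m = \<zero>"
    using upE[OF assms(1)] by blast
  with assms(1) show ?thesis
  proof (induction n arbitrary: p)
    case 0
    then have "p = (\<lambda>_. \<zero>)"
      by auto
    then show ?case
      using zero by simp
  next
    case (Suc n)
    have "P (\<lambda>n. p (Suc n))"
      using Suc.prems up_tail by (intro Suc.IH) auto
    then show ?case
      using step[of "p 0" "\<lambda>n. p (Suc n)"] up_closed up_tail Suc.prems(1) by (simp add: case_nat_tail)
  qed
qed

lemma up_map:
  assumes p: "p \<in> up R" and h: "\<And>n a. a \<in> carrier R \<Longrightarrow> h n a \<in> carrier R" "\<And>n. h n \<zero> = \<zero>"
  shows "(\<lambda>n. h n (p n)) \<in> up R"
proof -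
  obtain k where k: "\<And>m. m \<ge> k \<Longrightarrow> p m = \<zero>"
    using upE[OF p] by blast
  show ?thesis
    by (rule upI[of _ k]) (use k h up_closed p in auto)
qed

lemma ore_const_eq: "ore_const R a = case_nat a (\<lambda>_. \<zero>)"
  unfolding ore_const_def by (rule ext) (simp split: nat.split)

lemma ore_const_simps [simp]:
  "ore_const R a 0 = a" "ore_const R a (Suc n) = \<zero>"
  unfolding ore_const_def by auto

lemma up_ore_const: "a \<in> carrier R \<Longrightarrow> ore_const R a \<in> up R"
  unfolding ore_const_eq by (intro up_case_nat up_zero)

end

locale ore = ring D for D (structure) +
  fixes \<sigma> \<delta> :: "'a \<Rightarrow> 'a"
  assumes \<sigma>_hom: "\<sigma> \<in> ring_hom D D" and \<delta>_der: "skew_derivation D \<sigma> \<delta>"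
begin

abbreviation R where "R \<equiv> ore_extension D \<sigma> \<delta>"
abbreviation S where "S \<equiv> ore_shift D \<sigma> \<delta>"
abbreviation K where "K \<equiv> ore_const D"
abbreviation "x_var \<equiv> case_nat \<zero> (K \<one>)"

abbreviation ore_mult (infixl \<open>\<star>\<close> 70) where "p \<star> q \<equiv> p \<otimes>\<^bsub>R\<^esub> q"

lemma \<sigma>_simps [simp]:
  "a \<in> carrier D \<Longrightarrow> \<sigma> a \<in> carrier D"
  "a \<in> carrier D \<Longrightarrow> b \<in> carrier D \<Longrightarrow> \<sigma> (a \<oplus> b) = \<sigma> a \<oplus> \<sigma> b"
  "a \<in> carrier D \<Longrightarrow> b \<in> carrier D \<Longrightarrow> \<sigma> (a \<otimes> b) = \<sigma> a \<otimes> \<sigma> b"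
  "\<sigma> \<one> = \<one>"
  using \<sigma>_hom by (auto simp: ring_hom_def)

lemma \<sigma>_zero [simp]: "\<sigma> \<zero> = \<zero>"
  using ring_hom_zero[OF \<sigma>_hom ring_axioms ring_axioms] .

lemma \<delta>_simps:
  "a \<in> carrier D \<Longrightarrow> \<delta> a \<in> carrier D"
  "a \<in> carrier D \<Longrightarrow> b \<in> carrier D \<Longrightarrow> \<delta> (a \<oplus> b) = \<delta> a \<oplus> \<delta> b"
  "a \<in> carrier D \<Longrightarrow> b \<in> carrier D \<Longrightarrow> \<delta> (a \<otimes> b) = \<sigma> a \<otimes> \<delta> b \<oplus> \<delta> a \<otimes> b"
  using \<delta>_der by (auto simp: skew_derivation_def)

lemma \<delta>_zero: "\<delta> \<zero> = \<zero>"
proof -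
  have "\<delta> \<zero> \<oplus> \<delta> \<zero> = \<delta> \<zero> \<oplus> \<zero>"
    using \<delta>_simps(2)[of \<zero> \<zero>] \<delta>_simps(1)[of \<zero>] by simp
  then show ?thesis
    using add.l_cancel[of "\<delta> \<zero>" "\<delta> \<zero>" \<zero>] \<delta>_simps(1)[of \<zero>] by simp
qed

lemma \<delta>_one: "\<delta> \<one> = \<zero>"
proof -
  have "\<delta> \<one> \<oplus> \<delta> \<one> = \<delta> \<one> \<oplus> \<zero>"
    using \<delta>_simps(3)[of \<one> \<one>] \<delta>_simps(1)[of \<one>] by simp
  then show ?thesis
    using add.l_cancel[of "\<delta> \<one>" "\<delta> \<one>" \<zero>] \<delta>_simps(1)[of \<one>] by simp
qed

lemma R_simps:
  "carrier R = up D"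
  "\<zero>\<^bsub>R\<^esub> = (\<lambda>_. \<zero>)"
  "\<one>\<^bsub>R\<^esub> = K \<one>"
  "p \<oplus>\<^bsub>R\<^esub> q = (\<lambda>n. p n \<oplus> q n)"
  unfolding ore_extension_def ore_const_def by auto

context
  notes \<delta>_simps [simp] \<delta>_zero [simp] \<delta>_one [simp] R_simps [simp]
begin

lemma R_mult: "p \<star> q = (\<lambda>n. \<Oplus>i\<in>{i. p i \<noteq> \<zero>}. p i \<otimes> (S ^^ i) q n)"
  unfolding ore_extension_def by simp

text \<open>With \<open>S\<close> as left multiplication by \<open>x\<close>, this is
  \<open>x (a + q x) = \<delta>(a) + (\<sigma>(a) + x q) x\<close>.\<close>

lemma S_case_nat:
  assumes "a \<in> carrier D" "q \<in> up D"
  shows "S (case_nat a q) = case_nat (\<delta> a) (\<lambda>n. K (\<sigma> a) n \<oplus> S q n)"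
  using assms up_closed[OF assms(2)]
  unfolding ore_shift_def ore_const_def by (auto split: nat.splits simp: fun_eq_iff)

lemma S_case_nat_zero:
  assumes "q \<in> up D"
  shows "S (case_nat \<zero> q) = case_nat \<zero> (S q)"
  using assms up_closed[OF assms(1)]
  unfolding ore_shift_def by (auto split: nat.splits simp: fun_eq_iff)

lemma S_zero [simp]: "S (\<lambda>_. \<zero>) = (\<lambda>_. \<zero>)"
  unfolding ore_shift_def by (auto split: nat.splits simp: fun_eq_iff)

lemma S_K_one: "S (K \<one>) = x_var"
  unfolding ore_shift_def ore_const_def by (auto split: nat.splits simp: fun_eq_iff)

lemma S_closed [simp]:
  assumes "q \<in> up D"
  shows "S q \<in> up D"
proof -
  have "(\<lambda>n. case_nat \<zero> (\<lambda>m. \<sigma> (q m)) n \<oplus> \<delta> (q n)) \<in> up D"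
    using assms by (intro up_add_closed up_case_nat up_map[of q "\<lambda>_. \<sigma>"] up_map[of q "\<lambda>_. \<delta>"]) auto
  then show ?thesis
    unfolding ore_shift_def by simp
qed

lemma S_pow_closed: "q \<in> up D \<Longrightarrow> (S ^^ i) q \<in> up D"
  by (induction i) auto

lemma S_add:
  assumes "p \<in> up D" "q \<in> up D"
  shows "S (\<lambda>n. p n \<oplus> q n) = (\<lambda>n. S p n \<oplus> S q n)"
  using up_closed[OF assms(1)] up_closed[OF assms(2)]
  unfolding ore_shift_def by (auto split: nat.splits simp: fun_eq_iff a_ac)

lemma S_smult:
  assumes "a \<in> carrier D" "q \<in> up D"
  shows "S (\<lambda>n. a \<otimes> q n) = (\<lambda>n. \<sigma> a \<otimes> S q n \<oplus> \<delta> a \<otimes> q n)"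
  using assms(1) up_closed[OF assms(2)]
  unfolding ore_shift_def by (auto split: nat.splits simp: fun_eq_iff a_ac r_distr)

lemma zero_mult: "(\<lambda>_. \<zero>) \<star> q = (\<lambda>_. \<zero>)"
  unfolding R_mult by simp

text \<open>The recursion \<open>(a + p x) q = a q + p (x q)\<close> in the left factor, on which
  the following inductions run.\<close>

lemma case_nat_mult:
  assumes "a \<in> carrier D" "p \<in> up D" "q \<in> up D"
  shows "case_nat a p \<star> q = (\<lambda>n. a \<otimes> q n \<oplus> (p \<star> S q) n)"
proof
  fix n
  have "(case_nat a p \<star> q) n
    = a \<otimes> (S ^^ 0) q n \<oplus> (\<Oplus>i\<in>{i. p i \<noteq> \<zero>}. p i \<otimes> (S ^^ Suc i) q n)"
    unfolding R_mult using assms up_closed[OF assms(2)] up_closed[OF S_pow_closed[OF assms(3)]]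
    by (intro finsum_case_nat[where B = "carrier D" and g = "\<lambda>i b. b \<otimes> (S ^^ i) q n"])
      (auto simp: up_finite_support simp del: funpow.simps)
  then show "(case_nat a p \<star> q) n = a \<otimes> q n \<oplus> (p \<star> S q) n"
    by (simp add: R_mult funpow_Suc_right del: funpow.simps(2))
qed

lemma K_mult:
  assumes "a \<in> carrier D" "q \<in> up D"
  shows "K a \<star> q = (\<lambda>n. a \<otimes> q n)"
  using assms up_closed[OF assms(2)]
  by (simp add: ore_const_eq case_nat_mult up_zero zero_mult)

lemma mult_closed:
  assumes "p \<in> up D" "q \<in> up D"
  shows "p \<star> q \<in> up D"
  using assms
proof (induction p arbitrary: q rule: up_induct)
  case zero
  then show ?case
    by (simp add: zero_mult up_zero)
next
  case (case_nat a p)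
  then show ?case
    by (simp add: case_nat_mult up_add_closed up_smult_closed)
qed

lemma mult_r_distr:
  assumes "p \<in> up D" "q \<in> up D" "r \<in> up D"
  shows "p \<star> (\<lambda>n. q n \<oplus> r n) = (\<lambda>n. (p \<star> q) n \<oplus> (p \<star> r) n)"
  using assms
proof (induction p arbitrary: q r rule: up_induct)
  case zero
  then show ?case
    by (simp add: zero_mult)
next
  case (case_nat a p)
  have "(p \<star> S q) n \<in> carrier D" "(p \<star> S r) n \<in> carrier D" "q n \<in> carrier D" "r n \<in> carrier D" for n
    using up_closed[OF mult_closed[OF case_nat(2) S_closed]] up_closed case_nat by auto
  then show ?case
    using case_nat by (simp add: case_nat_mult up_add_closed S_add fun_eq_iff r_distr a_ac)
qed

lemma mult_l_distr:
  assumes "p \<in> up D" "q \<in> up D" "r \<in> up D"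
  shows "(\<lambda>n. p n \<oplus> q n) \<star> r = (\<lambda>n. (p \<star> r) n \<oplus> (q \<star> r) n)"
  using assms
proof (induction p arbitrary: q r rule: up_induct)
  case zero
  then have "q n \<in> carrier D" "(q \<star> r) n \<in> carrier D" for n
    using up_closed mult_closed by auto
  then show ?case
    by (simp add: zero_mult)
next
  case (case_nat a p)
  let ?q = "\<lambda>n. q (Suc n)"
  have q: "q 0 \<in> carrier D" "?q \<in> up D"
    using case_nat up_closed up_tail by auto
  have sum: "(\<lambda>n. case_nat a p n \<oplus> q n) = case_nat (a \<oplus> q 0) (\<lambda>n. p n \<oplus> ?q n)"
    by (auto split: nat.splits)
  have "(p \<star> S r) n \<in> carrier D" "(?q \<star> S r) n \<in> carrier D" "r n \<in> carrier D" for n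
    using up_closed mult_closed S_closed case_nat q by auto
  then have "case_nat (a \<oplus> q 0) (\<lambda>n. p n \<oplus> ?q n) \<star> r
    = (\<lambda>n. (case_nat a p \<star> r) n \<oplus> (case_nat (q 0) ?q \<star> r) n)"
    using case_nat q by (simp add: case_nat_mult up_add_closed fun_eq_iff l_distr a_ac)
  then show ?case
    unfolding sum by (simp add: case_nat_tail)
qed

lemma smult_mult:
  assumes "p \<in> up D" "a \<in> carrier D" "q \<in> up D"
  shows "(\<lambda>n. a \<otimes> p n) \<star> q = (\<lambda>n. a \<otimes> (p \<star> q) n)"
  using assms
proof (induction p arbitrary: q rule: up_induct)
  case zero
  then show ?case
    by (simp add: zero_mult)
next
  case (case_nat b p)
  have eq: "(\<lambda>n. a \<otimes> case_nat b p n) = case_nat (a \<otimes> b) (\<lambda>n. a \<otimes> p n)"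
    by (auto split: nat.splits)
  have "(p \<star> S q) n \<in> carrier D" "q n \<in> carrier D" for n
    using up_closed mult_closed S_closed case_nat by auto
  then show ?case
    unfolding eq using case_nat by (simp add: case_nat_mult up_smult_closed fun_eq_iff r_distr m_assoc)
qed

text \<open>Associativity for \<open>x\<close> as left factor, from which \<open>mult_assoc\<close>
  follows by induction. The skew Leibniz rule enters through \<open>S_smult\<close>.\<close>

lemma S_mult:
  assumes "q \<in> up D" "r \<in> up D"
  shows "S q \<star> r = S (q \<star> r)"
  using assms
proof (induction q arbitrary: r rule: up_induct)
  case zero
  then show ?case
    by (simp add: zero_mult)
next
  case (case_nat a q)
  have "S q \<star> S r = S (q \<star> S r)"
    using case_nat by simp
  moreover have "S (q \<star> S r) n \<in> carrier D" "r n \<in> carrier D" "S r n \<in> carrier D" for n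
    using up_closed mult_closed S_closed case_nat by auto
  ultimately show ?case
    using case_nat by (simp add: S_case_nat case_nat_mult up_add_closed up_smult_closed up_ore_const mult_l_distr
        K_mult S_add S_smult mult_closed fun_eq_iff a_ac)
qed

lemma mult_assoc:
  assumes "p \<in> up D" "q \<in> up D" "r \<in> up D"
  shows "(p \<star> q) \<star> r = p \<star> (q \<star> r)"
  using assms
proof (induction p arbitrary: q r rule: up_induct)
  case zero
  then show ?case
    by (simp add: zero_mult)
next
  case (case_nat a p)
  then show ?case
    by (simp add: case_nat_mult mult_l_distr up_smult_closed mult_closed smult_mult S_mult)
qed

lemma mult_case_nat_zero:
  assumes "p \<in> up D" "q \<in> up D"
  shows "p \<star> case_nat \<zero> q = case_nat \<zero> (p \<star> q)"
  using assms
proof (induction p arbitrary: q rule: up_induct)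
  case zero
  then show ?case
    by (auto simp: zero_mult split: nat.splits)
next
  case (case_nat a p)
  then show ?case
    by (auto simp: case_nat_mult up_case_nat S_case_nat_zero split: nat.splits)
qed

lemma mult_one:
  assumes "p \<in> up D"
  shows "p \<star> K \<one> = p"
  using assms
proof (induction p rule: up_induct)
  case zero
  then show ?case
    by (simp add: zero_mult)
next
  case (case_nat a p)
  have "p n \<in> carrier D" for n
    using up_closed case_nat by auto
  then show ?case
    using case_nat by (auto simp: case_nat_mult up_ore_const S_K_one mult_case_nat_zero fun_eq_iff
        split: nat.splits)
qed

theorem R_ring: "ring R"
proof (rule ringI)
  show "abelian_group R"
  proof (rule abelian_groupI)
    fix p assume "p \<in> carrier R"
    then have "(\<lambda>n. \<ominus> p n) \<in> carrier R" "\<And>n. p n \<in> carrier D"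
      using up_map[of p "\<lambda>_ a. \<ominus> a"] up_closed by auto
    then show "\<exists>q\<in>carrier R. q \<oplus>\<^bsub>R\<^esub> p = \<zero>\<^bsub>R\<^esub>"
      by (intro bexI[of _ "\<lambda>n. \<ominus> p n"]) (auto simp: l_neg)
  qed (auto simp: up_add_closed up_zero fun_eq_iff up_closed a_ac)
  show "monoid R"
    by (rule monoidI) (auto simp: mult_closed up_ore_const mult_assoc mult_one K_mult up_closed)
qed (auto simp: mult_l_distr mult_r_distr)

lemma x_var_closed: "x_var \<in> carrier R"
  by (simp add: up_case_nat up_ore_const)

lemma mult_x_var:
  assumes "p \<in> up D"
  shows "p \<star> x_var = case_nat \<zero> p"
  using assms by (simp add: mult_case_nat_zero up_ore_const mult_one)

lemma x_var_mult:
  assumes "p \<in> up D"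
  shows "x_var \<star> p = S p"
  using assms up_closed[OF S_closed[OF assms]]
  by (simp add: case_nat_mult up_ore_const K_mult up_closed)

lemma case_nat_decomp:
  assumes "a \<in> carrier D" "p \<in> up D"
  shows "case_nat a p = K a \<oplus>\<^bsub>R\<^esub> p \<star> x_var"
  using assms up_closed[OF assms(2)]
  by (auto simp: mult_x_var fun_eq_iff split: nat.splits)

lemma K_hom: "K \<in> ring_hom D R"
proof (rule ring_hom_memI)
  show "K (a \<otimes> b) = K a \<star> K b" if "a \<in> carrier D" "b \<in> carrier D" for a b
    using that by (simp add: K_mult up_ore_const) (auto simp: ore_const_def)
qed (auto simp: up_ore_const, auto simp: ore_const_def)

lemma x_var_K:
  assumes "a \<in> carrier D"
  shows "x_var \<star> K a = K (\<sigma> a) \<star> x_var \<oplus>\<^bsub>R\<^esub> K (\<delta> a)"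
  using assms
  by (simp add: x_var_mult mult_x_var up_ore_const) (auto simp: ore_shift_def ore_const_def split: nat.splits)

text \<open>Right multiples stay inside because left coefficients get multiplied by elements of
  \<open>D\<close>. Left multiples apply powers of \<open>S\<close> to the element, and this is
  where stability under both \<sigma> and \<delta> is needed.\<close>

lemma coeff_ideal_ideal:
  assumes I: "ideal I D" and stable: "\<sigma> ` I \<subseteq> I" "\<delta> ` I \<subseteq> I"
  shows "ideal (ore_coeff_ideal D \<sigma> \<delta> I) R"
proof -
  interpret I: ideal I D by fact
  interpret R: ring R
    by (rule R_ring)
  have S_in: "(S ^^ i) q n \<in> I" if "\<And>n. q n \<in> I" for i q n
  proof (induction i arbitrary: n)
    case (Suc i)
    then have "\<sigma> ((S ^^ i) q n) \<in> I" "\<delta> ((S ^^ i) q n) \<in> I" for n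
      using stable by blast+
    then show ?case
      using I.Icarr by (cases n) (auto simp: ore_shift_def[of D \<sigma> \<delta> "(S ^^ i) q"])
  qed (use that in simp)
  show ?thesis
  proof (rule R.ideal_if_closed)
    show "r \<star> f \<in> ore_coeff_ideal D \<sigma> \<delta> I" "f \<star> r \<in> ore_coeff_ideal D \<sigma> \<delta> I"
      if f: "f \<in> ore_coeff_ideal D \<sigma> \<delta> I" and r: "r \<in> carrier R" for f r
    proof -
      have f': "f \<in> up D" "\<And>n. f n \<in> I" and r': "r \<in> up D"
        using f r by (auto simp: ore_coeff_ideal_def)
      have "(r \<star> f) n \<in> I" for n
        unfolding R_mult using up_closed[OF r'] S_in[OF f'(2)]
        by (intro I.finsum_in up_finite_support r' I.I_l_closed)
      moreover have "(f \<star> r) n \<in> I" for n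
        unfolding R_mult using f' up_closed[OF S_pow_closed[OF r']]
        by (intro I.finsum_in up_finite_support I.I_r_closed)
      ultimately show "r \<star> f \<in> ore_coeff_ideal D \<sigma> \<delta> I" "f \<star> r \<in> ore_coeff_ideal D \<sigma> \<delta> I"
        using f' r' by (auto simp: ore_coeff_ideal_def mult_closed)
    qed
  qed (auto simp: ore_coeff_ideal_def up_zero up_add_closed)
qed

text \<open>The constants and \<open>x\<close> generate the ring, by
  \<open>case_nat_decomp\<close>.\<close>

lemma hom_eqI:
  assumes "f \<in> ring_hom R M" "g \<in> ring_hom R M" "f x_var = g x_var"
    and const: "\<And>a. a \<in> carrier D \<Longrightarrow> f (K a) = g (K a)"
    and "p \<in> up D"
  shows "f p = g p"
  using \<open>p \<in> up D\<close>
proof (induction p rule: up_induct)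
  case zero
  then show ?case
    using const[of \<zero>] by (simp add: ore_const_def)
next
  case (case_nat a p)
  interpret R: ring R
    by (rule R_ring)
  have "K a \<in> carrier R" "p \<in> carrier R" "p \<star> x_var \<in> carrier R"
    using case_nat x_var_closed by (auto simp: up_ore_const mult_closed)
  then show ?case
    using case_nat(1,2,3) const x_var_closed assms(3)
    unfolding case_nat_decomp[OF case_nat(1,2)]
    by (simp only: ring_hom_add[OF assms(1)] ring_hom_add[OF assms(2)] ring_hom_mult[OF assms(1)]
        ring_hom_mult[OF assms(2)])
qed

end

end

section \<open>Universal property: evaluation homomorphisms out of an Ore extension\<close>

locale ore_eval = ore D \<sigma> \<delta> + M: ring M for D (structure) and \<sigma> \<delta> and M (structure) +
  fixes \<eta> :: "'a \<Rightarrow> 'c" and y :: 'c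
  assumes \<eta>_hom: "\<eta> \<in> ring_hom D M" and y_closed [simp]: "y \<in> carrier M"
    and y_comm: "\<And>a. a \<in> carrier D \<Longrightarrow> y \<otimes>\<^bsub>M\<^esub> \<eta> a = \<eta> (\<sigma> a) \<otimes>\<^bsub>M\<^esub> y \<oplus>\<^bsub>M\<^esub> \<eta> (\<delta> a)"
begin

definition ev :: "(nat \<Rightarrow> 'a) \<Rightarrow> 'c" where
  "ev p = (\<Oplus>\<^bsub>M\<^esub>i\<in>{i. p i \<noteq> \<zero>}. \<eta> (p i) \<otimes>\<^bsub>M\<^esub> y [^]\<^bsub>M\<^esub> i)"

lemma \<eta>_simps [simp]:
  "a \<in> carrier D \<Longrightarrow> \<eta> a \<in> carrier M"
  "a \<in> carrier D \<Longrightarrow> b \<in> carrier D \<Longrightarrow> \<eta> (a \<oplus> b) = \<eta> a \<oplus>\<^bsub>M\<^esub> \<eta> b"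
  "a \<in> carrier D \<Longrightarrow> b \<in> carrier D \<Longrightarrow> \<eta> (a \<otimes> b) = \<eta> a \<otimes>\<^bsub>M\<^esub> \<eta> b"
  "\<eta> \<one> = \<one>\<^bsub>M\<^esub>"
  using \<eta>_hom by (auto simp: ring_hom_def)

lemma \<eta>_zero [simp]: "\<eta> \<zero> = \<zero>\<^bsub>M\<^esub>"
  using ring_hom_zero[OF \<eta>_hom ring_axioms M.ring_axioms] .

lemma ev_zero [simp]: "ev (\<lambda>_. \<zero>) = \<zero>\<^bsub>M\<^esub>"
  unfolding ev_def by simp

lemma ev_case_nat:
  assumes a: "a \<in> carrier D" and p: "p \<in> up D"
  shows "ev (case_nat a p) = \<eta> a \<oplus>\<^bsub>M\<^esub> ev p \<otimes>\<^bsub>M\<^esub> y"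
proof -
  note pc = up_closed[OF p]
  have "ev (case_nat a p) = \<eta> a \<otimes>\<^bsub>M\<^esub> y [^]\<^bsub>M\<^esub> (0::nat)
    \<oplus>\<^bsub>M\<^esub> (\<Oplus>\<^bsub>M\<^esub>i\<in>{i. p i \<noteq> \<zero>}. \<eta> (p i) \<otimes>\<^bsub>M\<^esub> y [^]\<^bsub>M\<^esub> Suc i)"
    unfolding ev_def using a pc
    by (intro M.finsum_case_nat[where B = "carrier D" and g = "\<lambda>i b. \<eta> b \<otimes>\<^bsub>M\<^esub> y [^]\<^bsub>M\<^esub> i"])
      (auto simp: up_finite_support[OF p])
  also have "(\<Oplus>\<^bsub>M\<^esub>i\<in>{i. p i \<noteq> \<zero>}. \<eta> (p i) \<otimes>\<^bsub>M\<^esub> y [^]\<^bsub>M\<^esub> Suc i)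
    = (\<Oplus>\<^bsub>M\<^esub>i\<in>{i. p i \<noteq> \<zero>}. \<eta> (p i) \<otimes>\<^bsub>M\<^esub> y [^]\<^bsub>M\<^esub> i \<otimes>\<^bsub>M\<^esub> y)"
    using pc by (intro M.finsum_cong') (auto simp: M.m_assoc)
  also have "\<dots> = ev p \<otimes>\<^bsub>M\<^esub> y"
    unfolding ev_def using pc by (intro M.finsum_ldistr[symmetric]) (auto simp: up_finite_support[OF p])
  finally show ?thesis
    using a by simp
qed

lemma ev_closed [simp]: "p \<in> up D \<Longrightarrow> ev p \<in> carrier M"
  by (induction p rule: up_induct) (auto simp: ev_case_nat)

lemma ev_K: "a \<in> carrier D \<Longrightarrow> ev (K a) = \<eta> a"
  by (simp add: ore_const_eq ev_case_nat up_zero)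

lemma ev_x_var: "ev x_var = y"
  by (simp add: ev_case_nat up_ore_const ev_K)

lemma ev_add:
  assumes "p \<in> up D" "q \<in> up D"
  shows "ev (\<lambda>n. p n \<oplus> q n) = ev p \<oplus>\<^bsub>M\<^esub> ev q"
  using assms
proof (induction p arbitrary: q rule: up_induct)
  case zero
  then show ?case
    by (simp add: up_closed)
next
  case (case_nat a p)
  let ?q = "\<lambda>n. q (Suc n)"
  have q: "q 0 \<in> carrier D" "?q \<in> up D"
    using case_nat up_closed up_tail by auto
  have sum: "(\<lambda>n. case_nat a p n \<oplus> q n) = case_nat (a \<oplus> q 0) (\<lambda>n. p n \<oplus> ?q n)"
    by (auto split: nat.splits)
  have "ev q = ev (case_nat (q 0) ?q)"
    by (simp add: case_nat_tail)
  then show ?case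
    unfolding sum using case_nat q by (simp add: ev_case_nat up_add_closed M.l_distr M.a_ac)
qed

lemma ev_smult:
  assumes "p \<in> up D" "a \<in> carrier D"
  shows "ev (\<lambda>n. a \<otimes> p n) = \<eta> a \<otimes>\<^bsub>M\<^esub> ev p"
  using assms
proof (induction p rule: up_induct)
  case zero
  then show ?case
    by simp
next
  case (case_nat b p)
  have eq: "(\<lambda>n. a \<otimes> case_nat b p n) = case_nat (a \<otimes> b) (\<lambda>n. a \<otimes> p n)"
    by (auto split: nat.splits)
  show ?case
    unfolding eq using case_nat by (simp add: ev_case_nat up_smult_closed M.r_distr M.m_assoc)
qed

text \<open>The relation \<open>y_comm\<close> is exactly what turns left multiplication by
  \<open>x\<close> into left multiplication by \<open>y\<close>; multiplicativity of
  \<open>ev\<close> rests on it.\<close>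

lemma ev_S:
  assumes "p \<in> up D"
  shows "ev (S p) = y \<otimes>\<^bsub>M\<^esub> ev p"
  using assms
proof (induction p rule: up_induct)
  case zero
  then show ?case
    by simp
next
  case (case_nat a p)
  then have "ev (S (case_nat a p)) = \<eta> (\<delta> a) \<oplus>\<^bsub>M\<^esub> (\<eta> (\<sigma> a) \<oplus>\<^bsub>M\<^esub> y \<otimes>\<^bsub>M\<^esub> ev p) \<otimes>\<^bsub>M\<^esub> y"
    by (simp add: S_case_nat ev_case_nat up_add_closed up_ore_const ev_add ev_K \<delta>_simps)
  also have "\<dots> = y \<otimes>\<^bsub>M\<^esub> \<eta> a \<oplus>\<^bsub>M\<^esub> y \<otimes>\<^bsub>M\<^esub> (ev p \<otimes>\<^bsub>M\<^esub> y)"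
    unfolding y_comm[OF case_nat(1)] using case_nat by (simp add: M.l_distr M.a_ac M.m_assoc \<delta>_simps)
  also have "\<dots> = y \<otimes>\<^bsub>M\<^esub> ev (case_nat a p)"
    using case_nat by (simp add: ev_case_nat M.r_distr)
  finally show ?case .
qed

lemma ev_mult:
  assumes "p \<in> up D" "q \<in> up D"
  shows "ev (p \<star> q) = ev p \<otimes>\<^bsub>M\<^esub> ev q"
  using assms
proof (induction p arbitrary: q rule: up_induct)
  case zero
  then show ?case
    by (simp add: zero_mult)
next
  case (case_nat a p)
  then have "ev (case_nat a p \<star> q) = \<eta> a \<otimes>\<^bsub>M\<^esub> ev q \<oplus>\<^bsub>M\<^esub> ev p \<otimes>\<^bsub>M\<^esub> (y \<otimes>\<^bsub>M\<^esub> ev q)"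
    by (simp add: case_nat_mult ev_add up_smult_closed mult_closed ev_smult ev_S)
  also have "\<dots> = ev (case_nat a p) \<otimes>\<^bsub>M\<^esub> ev q"
    using case_nat by (simp add: ev_case_nat M.l_distr M.m_assoc)
  finally show ?case .
qed

lemma ev_in_ideal:
  assumes "ideal \<PP> M" "\<And>a. a \<in> I \<Longrightarrow> \<eta> a \<in> \<PP>" "p \<in> ore_coeff_ideal D \<sigma> \<delta> I"
  shows "ev p \<in> \<PP>"
proof -
  interpret P: ideal \<PP> M by fact
  have p: "p \<in> up D" "\<And>n. p n \<in> I"
    using assms(3) by (auto simp: ore_coeff_ideal_def R_simps)
  then show ?thesis
    unfolding ev_def using assms(2)
    by (intro P.finsum_in up_finite_support P.I_r_closed) auto
qed

lemma ev_hom: "ev \<in> ring_hom R M"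
  by (rule ring_hom_memI) (auto simp: R_simps ev_mult ev_add ev_K)

end

subsection \<open>Prime ideals of noncommutative rings\<close>

lemma (in ring) left_colon_ideal:
  assumes "ideal J R" "ideal P R"
  shows "ideal {u \<in> carrier R. \<forall>v \<in> J. u \<otimes> v \<in> P} R" (is "ideal ?C R")
proof -
  interpret J: ideal J R by fact
  interpret P: ideal P R by fact
  show ?thesis
  proof (rule ideal_if_closed)
    show "u \<otimes> s \<in> ?C" if "u \<in> ?C" "s \<in> carrier R" for u s
      using that J.Icarr J.I_l_closed by (auto simp: m_assoc)
    show "s \<otimes> u \<in> ?C" if "u \<in> ?C" "s \<in> carrier R" for u s
      using that J.Icarr P.I_l_closed by (auto simp: m_assoc)
  qed (use J.Icarr in \<open>auto simp: l_distr\<close>)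
qed

lemma (in ring) right_colon_ideal:
  assumes "ideal J R" "ideal P R"
  shows "ideal {u \<in> carrier R. \<forall>v \<in> J. v \<otimes> u \<in> P} R" (is "ideal ?C R")
proof -
  interpret J: ideal J R by fact
  interpret P: ideal P R by fact
  show ?thesis
  proof (rule ideal_if_closed)
    show "u \<otimes> s \<in> ?C" if "u \<in> ?C" "s \<in> carrier R" for u s
      using that J.Icarr P.I_r_closed by (auto simp flip: m_assoc)
    show "s \<otimes> u \<in> ?C" if "u \<in> ?C" "s \<in> carrier R" for u s
      using that J.Icarr J.I_r_closed by (auto simp flip: m_assoc)
  qed (use J.Icarr in \<open>auto simp: r_distr\<close>)
qed

text \<open>Instead of the ideals generated by \<open>a\<close> and \<open>b\<close>, annihilators
  modulo \<open>P\<close> are used: \<open>J\<close> consists of all \<open>v\<close> with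
  \<open>a R v \<subseteq> P\<close>, and \<open>I\<close> of all \<open>u\<close> with
  \<open>u J \<subseteq> P\<close>. Both are two-sided, \<open>I J \<subseteq> P\<close>, and they
  contain \<open>b\<close> and \<open>a\<close> respectively.\<close>

lemma Spec_elementwise:
  assumes P: "P \<in> Spec R" and ab: "a \<in> carrier R" "b \<in> carrier R"
    and prod: "\<And>r. r \<in> carrier R \<Longrightarrow> a \<otimes>\<^bsub>R\<^esub> r \<otimes>\<^bsub>R\<^esub> b \<in> P"
  shows "a \<in> P \<or> b \<in> P"
proof -
  interpret P: ideal P R
    using P unfolding Spec_def by blast
  define J where "J = {v \<in> carrier R. \<forall>r \<in> carrier R. a \<otimes>\<^bsub>R\<^esub> r \<otimes>\<^bsub>R\<^esub> v \<in> P}"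
  define I where "I = {u \<in> carrier R. \<forall>v \<in> J. u \<otimes>\<^bsub>R\<^esub> v \<in> P}"
  have Jc: "v \<in> carrier R" if "v \<in> J" for v
    using that unfolding J_def by simp
  have JD: "a \<otimes>\<^bsub>R\<^esub> r \<otimes>\<^bsub>R\<^esub> v \<in> P" if "v \<in> J" "r \<in> carrier R" for r v
    using that unfolding J_def by simp
  have JI: "v \<in> J" if "v \<in> carrier R" "\<And>r. r \<in> carrier R \<Longrightarrow> a \<otimes>\<^bsub>R\<^esub> r \<otimes>\<^bsub>R\<^esub> v \<in> P" for v
    using that unfolding J_def by simp
  have J: "ideal J R"
  proof (rule P.ideal_if_closed)
    show "v \<oplus>\<^bsub>R\<^esub> v' \<in> J" if "v \<in> J" "v' \<in> J" for v v'
    proof -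
      have "a \<otimes>\<^bsub>R\<^esub> r \<otimes>\<^bsub>R\<^esub> (v \<oplus>\<^bsub>R\<^esub> v') \<in> P" if "r \<in> carrier R" for r
        using JD[OF \<open>v \<in> J\<close> that] JD[OF \<open>v' \<in> J\<close> that] Jc[OF \<open>v \<in> J\<close>] Jc[OF \<open>v' \<in> J\<close>] that ab
        by (simp add: P.r_distr)
      then show ?thesis
        using Jc[OF \<open>v \<in> J\<close>] Jc[OF \<open>v' \<in> J\<close>] by (intro JI) simp_all
    qed
    show "s \<otimes>\<^bsub>R\<^esub> v \<in> J" if "v \<in> J" "s \<in> carrier R" for v s
    proof -
      have "a \<otimes>\<^bsub>R\<^esub> r \<otimes>\<^bsub>R\<^esub> (s \<otimes>\<^bsub>R\<^esub> v) = a \<otimes>\<^bsub>R\<^esub> (r \<otimes>\<^bsub>R\<^esub> s) \<otimes>\<^bsub>R\<^esub> v" if "r \<in> carrier R" for r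
        using that \<open>s \<in> carrier R\<close> Jc[OF \<open>v \<in> J\<close>] ab by (simp add: P.m_assoc)
      then show ?thesis
        using JD[OF \<open>v \<in> J\<close>] Jc[OF \<open>v \<in> J\<close>] \<open>s \<in> carrier R\<close> by (intro JI) simp_all
    qed
    show "v \<otimes>\<^bsub>R\<^esub> s \<in> J" if "v \<in> J" "s \<in> carrier R" for v s
    proof -
      have "a \<otimes>\<^bsub>R\<^esub> r \<otimes>\<^bsub>R\<^esub> (v \<otimes>\<^bsub>R\<^esub> s) = (a \<otimes>\<^bsub>R\<^esub> r \<otimes>\<^bsub>R\<^esub> v) \<otimes>\<^bsub>R\<^esub> s" if "r \<in> carrier R" for r
        using that \<open>s \<in> carrier R\<close> Jc[OF \<open>v \<in> J\<close>] ab by (simp add: P.m_assoc)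
      then show ?thesis
        using JD[OF \<open>v \<in> J\<close>] Jc[OF \<open>v \<in> J\<close>] \<open>s \<in> carrier R\<close> P.I_r_closed by (intro JI) simp_all
    qed
  qed (use ab in \<open>auto simp: J_def\<close>)
  have I: "ideal I R"
    unfolding I_def by (rule P.left_colon_ideal[OF J P.ideal_axioms])
  have "I \<cdot>\<^bsub>R\<^esub> J \<subseteq> P"
  proof
    fix z assume "z \<in> I \<cdot>\<^bsub>R\<^esub> J"
    then show "z \<in> P"
      by (rule ideal_prod_closed) (auto simp: I_def)
  qed
  then have "I \<subseteq> P \<or> J \<subseteq> P"
    using P I J unfolding Spec_def by blast
  moreover have "a \<in> I"
    using ab JD[OF _ P.one_closed] unfolding I_def by simp
  moreover have "b \<in> J"
    using ab prod unfolding J_def by simp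
  ultimately show ?thesis
    by blast
qed

lemma SpecI:
  assumes P: "ideal P R" "P \<noteq> carrier R"
    and prime: "\<And>a b. a \<in> carrier R \<Longrightarrow> b \<in> carrier R \<Longrightarrow>
      (\<And>r. r \<in> carrier R \<Longrightarrow> a \<otimes>\<^bsub>R\<^esub> r \<otimes>\<^bsub>R\<^esub> b \<in> P) \<Longrightarrow> a \<in> P \<or> b \<in> P"
  shows "P \<in> Spec R"
proof -
  have "I \<subseteq> P \<or> J \<subseteq> P" if I: "ideal I R" and J: "ideal J R" and IJ: "I \<cdot>\<^bsub>R\<^esub> J \<subseteq> P" for I J
  proof (rule ccontr)
    assume "\<not> (I \<subseteq> P \<or> J \<subseteq> P)"
    then obtain a b where ab: "a \<in> I" "a \<notin> P" "b \<in> J" "b \<notin> P"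
      by blast
    have "a \<otimes>\<^bsub>R\<^esub> r \<otimes>\<^bsub>R\<^esub> b \<in> P" if "r \<in> carrier R" for r
      using ideal_prod.prod[OF ideal.I_r_closed[OF I ab(1) that] ab(3)] IJ by blast
    then show False
      using prime[of a b] ab ideal.Icarr[OF I] ideal.Icarr[OF J] by blast
  qed
  then show ?thesis
    using P unfolding Spec_def by blast
qed


subsection \<open>The skew polynomial ring \<open>D[y; \<sigma>]\<close>\<close>

locale skew_poly = dedekind D for D (structure) +
  fixes \<sigma> :: "'a \<Rightarrow> 'a"
  assumes \<sigma>_iso: "\<sigma> \<in> ring_iso D D"

sublocale skew_poly \<subseteq> ore D \<sigma> "\<lambda>_. \<zero>"
proof unfold_locales
  show hom: "\<sigma> \<in> ring_hom D D"
    using \<sigma>_iso by (simp add: ring_iso_def)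
  show "skew_derivation D \<sigma> (\<lambda>_. \<zero>)"
    using ring_hom_closed[OF hom] by (simp add: skew_derivation_def)
qed

context skew_poly
begin

abbreviation skew_mult (infixl \<open>\<star>\<close> 70) where "p \<star> q \<equiv> p \<otimes>\<^bsub>R\<^esub> q"

sublocale R: ring R
  by (rule R_ring)

definition "y = x_var"
abbreviation "CI \<equiv> ore_coeff_ideal D \<sigma> (\<lambda>_. \<zero>)"

definition "\<tau> = inv_into (carrier D) \<sigma>"

lemma \<sigma>_inj: "a \<in> carrier D \<Longrightarrow> b \<in> carrier D \<Longrightarrow> \<sigma> a = \<sigma> b \<Longrightarrow> a = b"
  using \<sigma>_iso unfolding ring_iso_def bij_betw_def by (auto dest: inj_onD)

lemma \<tau>_simps [simp]:
  assumes "a \<in> carrier D"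
  shows "\<tau> a \<in> carrier D" "\<sigma> (\<tau> a) = a" "\<tau> (\<sigma> a) = a"
proof -
  have "\<sigma> ` carrier D = carrier D" "inj_on \<sigma> (carrier D)"
    using \<sigma>_iso unfolding ring_iso_def bij_betw_def by auto
  then show "\<tau> a \<in> carrier D" "\<sigma> (\<tau> a) = a" "\<tau> (\<sigma> a) = a"
    using assms unfolding \<tau>_def by (auto intro: inv_into_into f_inv_into_f inv_into_f_f)
qed

lemma \<tau>_zero [simp]: "\<tau> \<zero> = \<zero>"
  using \<tau>_simps(3)[of \<zero>] by simp

lemma \<sigma>_eq_zero: "a \<in> carrier D \<Longrightarrow> \<sigma> a = \<zero> \<longleftrightarrow> a = \<zero>"
  using \<sigma>_inj[of a \<zero>] by auto

lemma \<sigma>_pow_simps [simp]: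
  "a \<in> carrier D \<Longrightarrow> (\<sigma> ^^ i) a \<in> carrier D"
  "(\<sigma> ^^ i) \<zero> = \<zero>"
  "(\<sigma> ^^ i) \<one> = \<one>"
  "a \<in> carrier D \<Longrightarrow> (\<sigma> ^^ i) a = \<zero> \<longleftrightarrow> a = \<zero>"
proof -
  show c: "(\<sigma> ^^ i) a \<in> carrier D" if "a \<in> carrier D" for i a
    using that by (induction i) auto
  show "(\<sigma> ^^ i) \<zero> = \<zero>" "(\<sigma> ^^ i) \<one> = \<one>"
    by (induction i) auto
  show "(\<sigma> ^^ i) a = \<zero> \<longleftrightarrow> a = \<zero>" if "a \<in> carrier D"
    using that c by (induction i) (auto simp: \<sigma>_eq_zero)
qed

lemma \<sigma>_pow_add: "a \<in> carrier D \<Longrightarrow> b \<in> carrier D \<Longrightarrow> (\<sigma> ^^ i) (a \<oplus> b) = (\<sigma> ^^ i) a \<oplus> (\<sigma> ^^ i) b"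
  by (induction i) auto

lemma \<sigma>_pow_mult: "a \<in> carrier D \<Longrightarrow> b \<in> carrier D \<Longrightarrow> (\<sigma> ^^ i) (a \<otimes> b) = (\<sigma> ^^ i) a \<otimes> (\<sigma> ^^ i) b"
  by (induction i) auto

lemma carrier_coeff [simp]: "p \<in> carrier R \<Longrightarrow> p n \<in> carrier D"
  by (simp add: R_simps(1) up_closed)

lemma zero_coeff [simp]: "\<zero>\<^bsub>R\<^esub> n = \<zero>"
  by (simp add: R_simps(2))

lemma add_coeff [simp]: "(p \<oplus>\<^bsub>R\<^esub> q) n = p n \<oplus> q n"
  by (simp add: R_simps(4))

lemma minus_coeff [simp]:
  assumes "p \<in> carrier R"
  shows "(\<ominus>\<^bsub>R\<^esub> p) n = \<ominus> p n"
proof -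
  have "(\<ominus>\<^bsub>R\<^esub> p \<oplus>\<^bsub>R\<^esub> p) n = \<zero>"
    using assms by (subst R.l_neg) auto
  then show ?thesis
    using assms by (intro minus_equality[symmetric]) auto
qed

lemma diff_coeff [simp]:
  assumes "p \<in> carrier R" "q \<in> carrier R"
  shows "(p \<ominus>\<^bsub>R\<^esub> q) n = p n \<ominus> q n"
  using assms unfolding R.minus_eq by (simp add: a_minus_def)

lemma K_closed [simp]: "a \<in> carrier D \<Longrightarrow> K a \<in> carrier R"
  by (simp add: R_simps up_ore_const)

lemma y_closed [simp]: "y \<in> carrier R"
  unfolding y_def by (rule x_var_closed)

lemma K_zero [simp]: "K \<zero> = \<zero>\<^bsub>R\<^esub>"
  by (auto simp: R_simps(2) ore_const_def)

lemma K_one [simp]: "K \<one> = \<one>\<^bsub>R\<^esub>"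
  by (simp only: R_simps(3))

lemma K_add: "a \<in> carrier D \<Longrightarrow> b \<in> carrier D \<Longrightarrow> K (a \<oplus> b) = K a \<oplus>\<^bsub>R\<^esub> K b"
  using ring_hom_add[OF K_hom] .

lemma K_times: "a \<in> carrier D \<Longrightarrow> b \<in> carrier D \<Longrightarrow> K (a \<otimes> b) = K a \<star> K b"
  using ring_hom_mult[OF K_hom] .

lemma K_inj: "K a = K b \<Longrightarrow> a = b"
  by (metis ore_const_simps(1))

lemma K_eq_zero: "K a = \<zero>\<^bsub>R\<^esub> \<longleftrightarrow> a = \<zero>"
  using K_inj[of a \<zero>] by auto

lemma carrier_map:
  assumes "p \<in> carrier R" "\<And>n a. a \<in> carrier D \<Longrightarrow> h n a \<in> carrier D" "\<And>n. h n \<zero> = \<zero>"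
  shows "(\<lambda>n. h n (p n)) \<in> carrier R"
  using assms up_map[of p h] by (simp add: R_simps(1))

lemma carrier_tail: "p \<in> carrier R \<Longrightarrow> (\<lambda>n. p (Suc n)) \<in> carrier R"
  using up_tail by (simp add: R_simps(1))

lemma carrier_bounded:
  assumes "p \<in> carrier R"
  obtains n where "\<And>m. m \<ge> n \<Longrightarrow> p m = \<zero>"
  using upE[of p] assms by (auto simp: R_simps(1))

lemma carrier_eq_zeroI: "(\<And>n. p n = \<zero>) \<Longrightarrow> p = \<zero>\<^bsub>R\<^esub>"
  by (auto simp: R_simps(2))

lemma carrier_top:
  assumes "p \<in> carrier R" "p \<noteq> \<zero>\<^bsub>R\<^esub>"
  obtains m where "p m \<noteq> \<zero>" "\<And>i. i > m \<Longrightarrow> p i = \<zero>"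
proof -
  have fin: "finite {i. p i \<noteq> \<zero>}"
    using up_finite_support[of p] assms(1) by (simp add: R_simps(1))
  have "{i. p i \<noteq> \<zero>} \<noteq> {}"
    using assms(2) carrier_eq_zeroI[of p] by auto
  then show thesis
    using that[of "Max {i. p i \<noteq> \<zero>}"] Max_in[OF fin] Max_ge[OF fin] by fastforce
qed

lemma S_pow_apply:
  assumes "q \<in> carrier R"
  shows "(S ^^ i) q n = (if n < i then \<zero> else (\<sigma> ^^ i) (q (n - i)))"
  using assms
proof (induction i arbitrary: n)
  case 0
  then show ?case
    by simp
next
  case (Suc i)
  then show ?case
    by (auto simp: ore_shift_def split: nat.splits)
qed

lemma mult_apply:
  assumes "p \<in> carrier R" "q \<in> carrier R"
  shows "(p \<star> q) n = (\<Oplus>i\<in>{..n}. p i \<otimes> (\<sigma> ^^ i) (q (n - i)))"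
proof -
  let ?h = "\<lambda>i. p i \<otimes> (S ^^ i) q n"
  have h: "?h i = (if n < i then \<zero> else p i \<otimes> (\<sigma> ^^ i) (q (n - i)))" for i
    using assms by (simp add: S_pow_apply)
  have fin: "finite {i. p i \<noteq> \<zero>}"
    using up_finite_support[of p] assms(1) by (simp add: R_simps(1))
  have "(p \<star> q) n = (\<Oplus>i\<in>{i. p i \<noteq> \<zero>}. ?h i)"
    unfolding R_mult by simp
  also have "\<dots> = (\<Oplus>i\<in>{i. p i \<noteq> \<zero>} \<union> {..n}. ?h i)"
    using assms fin unfolding h by (intro add.finprod_mono_neutral_cong_left) auto
  also have "\<dots> = (\<Oplus>i\<in>{..n}. p i \<otimes> (\<sigma> ^^ i) (q (n - i)))"
    using assms fin unfolding h by (intro add.finprod_mono_neutral_cong_right) auto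
  finally show ?thesis .
qed

lemma K_mult_coeff [simp]:
  assumes "a \<in> carrier D" "p \<in> carrier R"
  shows "(K a \<star> p) n = a \<otimes> p n"
  using K_mult[of a p] assms by (simp add: R_simps(1))

lemma mult_y_coeff [simp]:
  assumes "p \<in> carrier R"
  shows "(p \<star> y) 0 = \<zero>" "(p \<star> y) (Suc n) = p n"
  using mult_x_var[of p] assms unfolding y_def by (simp_all add: R_simps(1) del: K_one)

lemma y_mult_coeff [simp]:
  assumes "p \<in> carrier R"
  shows "(y \<star> p) 0 = \<zero>" "(y \<star> p) (Suc n) = \<sigma> (p n)"
  using x_var_mult[of p] assms up_closed[of p] unfolding y_def
  by (simp_all add: R_simps(1) ore_shift_def del: K_one)

lemma R_eqI:
  assumes "p 0 = q 0" "\<And>n. p (Suc n) = q (Suc n)"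
  shows "p = q"
proof
  show "p n = q n" for n
    using assms by (cases n) auto
qed

lemma y_mult: "p \<in> carrier R \<Longrightarrow> y \<star> p = (\<lambda>n. \<sigma> (p n)) \<star> y"
  using carrier_map[of p "\<lambda>_. \<sigma>"] by (intro R_eqI) auto

lemma mult_y: "p \<in> carrier R \<Longrightarrow> p \<star> y = y \<star> (\<lambda>n. \<tau> (p n))"
  using carrier_map[of p "\<lambda>_. \<tau>"] by (intro R_eqI) auto

lemma y_K: "a \<in> carrier D \<Longrightarrow> y \<star> K a = K (\<sigma> a) \<star> y"
proof -
  assume a: "a \<in> carrier D"
  have "(\<lambda>n. \<sigma> (K a n)) = K (\<sigma> a)"
    by (auto simp: ore_const_def)
  then show ?thesis
    using y_mult[of "K a"] a by simp
qed

lemma right_decomp: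
  assumes "p \<in> carrier R"
  shows "p = K (p 0) \<oplus>\<^bsub>R\<^esub> (\<lambda>n. p (Suc n)) \<star> y"
  using assms carrier_tail[OF assms] by (intro R_eqI) auto

lemma left_decomp:
  assumes "p \<in> carrier R"
  shows "p = K (p 0) \<oplus>\<^bsub>R\<^esub> y \<star> (\<lambda>n. \<tau> (p (Suc n)))"
  using assms carrier_map[OF carrier_tail[OF assms], of "\<lambda>_. \<tau>"] by (intro R_eqI) auto

lemma mult_K_coeff [simp]:
  assumes "p \<in> carrier R" "a \<in> carrier D"
  shows "(p \<star> K a) n = p n \<otimes> (\<sigma> ^^ n) a"
proof -
  have "(p \<star> K a) n = (\<Oplus>i\<in>{..n}. p i \<otimes> (\<sigma> ^^ i) (K a (n - i)))"
    using assms by (simp add: mult_apply)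
  also have "\<dots> = (\<Oplus>i\<in>{..n}. if n = i then p i \<otimes> (\<sigma> ^^ i) a else \<zero>)"
    using assms by (intro finsum_cong') (auto simp: ore_const_def)
  also have "\<dots> = p n \<otimes> (\<sigma> ^^ n) a"
    using assms by (subst add.finprod_singleton) auto
  finally show ?thesis .
qed

lemma mult_top:
  assumes "p \<in> carrier R" "q \<in> carrier R" "\<And>i. i > m \<Longrightarrow> p i = \<zero>" "\<And>i. i > d \<Longrightarrow> q i = \<zero>"
  shows "(p \<star> q) (m + d) = p m \<otimes> (\<sigma> ^^ m) (q d)"
proof -
  have "(p \<star> q) (m + d) = (\<Oplus>i\<in>{..m + d}. p i \<otimes> (\<sigma> ^^ i) (q (m + d - i)))"
    using assms by (simp add: mult_apply)
  also have "\<dots> = (\<Oplus>i\<in>{..m + d}. if m = i then p i \<otimes> (\<sigma> ^^ i) (q d) else \<zero>)"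
  proof (intro finsum_cong')
    fix i assume "i \<in> {..m + d}"
    show "p i \<otimes> (\<sigma> ^^ i) (q (m + d - i)) = (if m = i then p i \<otimes> (\<sigma> ^^ i) (q d) else \<zero>)"
      using assms by (cases i m rule: linorder_cases) auto
  qed (use assms in auto)
  also have "\<dots> = p m \<otimes> (\<sigma> ^^ m) (q d)"
    using assms by (subst add.finprod_singleton) auto
  finally show ?thesis .
qed

subsection \<open>Extended \<open>\<sigma>\<close>-prime ideals\<close>

text \<open>Stability gives one direction only. For the other, the preimages \<open>V n\<close> of
  \<open>I\<close> under the powers of \<sigma> ascend, hence become stationary at some
  \<open>n\<close>. If \<open>\<sigma>(a)\<close> is in \<open>I\<close>, then
  \<open>\<tau>^n(a)\<close> lies in \<open>V (n + 1) = V n\<close>, so \<open>a\<close> is in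
  \<open>I\<close>.\<close>

lemma sigma_ideal_iff:
  assumes I: "sigma_ideal I D \<sigma>" and a: "a \<in> carrier D"
  shows "\<sigma> a \<in> I \<longleftrightarrow> a \<in> I"
proof
  interpret I: ideal I D
    using I unfolding sigma_ideal_def by blast
  have stable: "\<sigma> b \<in> I" if "b \<in> I" for b
    using I that unfolding sigma_ideal_def by blast
  then show "a \<in> I \<Longrightarrow> \<sigma> a \<in> I" .
  define V where "V n = {b \<in> carrier D. (\<sigma> ^^ n) b \<in> I}" for n
  have V_ideal: "ideal (V n) D" for n
    by (rule ideal_if_closed)
      (auto simp: V_def \<sigma>_pow_add \<sigma>_pow_mult I.I_l_closed I.I_r_closed)
  obtain M where M: "M \<in> range V" "\<And>Y. Y \<in> range V \<Longrightarrow> M \<subseteq> Y \<Longrightarrow> Y = M"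
    by (rule maximal_in_family[of "range V"]) (use V_ideal in auto)
  then obtain n where n: "M = V n"
    by blast
  have "V n \<subseteq> V (Suc n)"
    using stable unfolding V_def by auto
  then have Vn: "V (Suc n) = V n"
    using M(2)[of "V (Suc n)"] n by blast
  assume "\<sigma> a \<in> I"
  have \<tau>c: "(\<tau> ^^ n) a \<in> carrier D" for n
    using a by (induction n) auto
  have "(\<sigma> ^^ n) ((\<tau> ^^ n) a) = a" for n
  proof (induction n)
    case (Suc n)
    have "(\<sigma> ^^ Suc n) ((\<tau> ^^ Suc n) a) = (\<sigma> ^^ n) (\<sigma> (\<tau> ((\<tau> ^^ n) a)))"
      by (simp add: funpow_swap1)
    also have "\<dots> = a"
      using \<tau>c Suc by simp
    finally show ?case .
  qed simp
  then have "(\<tau> ^^ n) a \<in> V (Suc n)"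
    using \<open>\<sigma> a \<in> I\<close> \<tau>c unfolding V_def by simp
  then show "a \<in> I"
    using \<open>(\<sigma> ^^ n) ((\<tau> ^^ n) a) = a\<close> unfolding Vn unfolding V_def by simp
qed

lemma sigma_ideal_pow_iff:
  assumes I: "sigma_ideal I D \<sigma>" and a: "a \<in> carrier D"
  shows "(\<sigma> ^^ n) a \<in> I \<longleftrightarrow> a \<in> I"
  using a by (induction n) (auto simp: sigma_ideal_iff[OF I])

lemma sigma_ideal_\<tau>: "sigma_ideal I D \<sigma> \<Longrightarrow> a \<in> I \<Longrightarrow> \<tau> a \<in> I"
  using sigma_ideal_iff[of I "\<tau> a"] ideal.Icarr[of I D a] unfolding sigma_ideal_def by auto

text \<open>Rests on \<open>z \<sigma>(w) = \<sigma>(\<tau>(z) w)\<close>, so that stability of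
  \<open>I\<close> under the inverse \<tau> is what counts.\<close>

lemma sigma_colon:
  assumes I: "sigma_ideal I D \<sigma>" and J: "sigma_ideal J D \<sigma>"
  shows "sigma_ideal {w \<in> carrier D. \<forall>z \<in> I. z \<otimes> w \<in> J} D \<sigma>" (is "sigma_ideal ?C D \<sigma>")
  unfolding sigma_ideal_def
proof
  interpret I: ideal I D
    using I unfolding sigma_ideal_def by blast
  show "ideal ?C D"
    using colon_ideal[of J I] J I.Icarr unfolding sigma_ideal_def by blast
  show "\<sigma> ` ?C \<subseteq> ?C"
  proof (rule image_subsetI)
    fix w assume w: "w \<in> ?C"
    have "z \<otimes> \<sigma> w \<in> J" if z: "z \<in> I" for z
    proof -
      have "\<sigma> (\<tau> z \<otimes> w) \<in> J"
        using w sigma_ideal_\<tau>[OF I z] sigma_ideal_iff[OF J, of "\<tau> z \<otimes> w"] I.Icarr[OF z] by simp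
      then show ?thesis
        using w I.Icarr[OF z] by simp
    qed
    then show "\<sigma> w \<in> ?C"
      using w by simp
  qed
qed

lemma CI_iff: "f \<in> CI I \<longleftrightarrow> f \<in> carrier R \<and> (\<forall>n. f n \<in> I)"
  unfolding ore_coeff_ideal_def by simp

lemma CI_ideal:
  assumes "sigma_ideal I D \<sigma>"
  shows "ideal (CI I) R"
  using assms additive_subgroup.zero_closed[OF ideal.axioms(1)]
  unfolding sigma_ideal_def by (intro coeff_ideal_ideal) auto

lemma y_pow_mult:
  assumes "b \<in> carrier R"
  shows "y [^]\<^bsub>R\<^esub> k \<star> b = (S ^^ k) b"
  using assms
proof (induction k arbitrary: b)
  case 0
  then show ?case
    by simp
next
  case (Suc k)
  have "y \<star> b = S b"
    using Suc.prems x_var_mult[of b] unfolding y_def by (simp add: R_simps(1) del: K_one)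
  moreover have "S b \<in> carrier R"
    using Suc.prems by (simp add: R_simps(1))
  ultimately have "y [^]\<^bsub>R\<^esub> Suc k \<star> b = y [^]\<^bsub>R\<^esub> k \<star> S b" "S b \<in> carrier R"
    using Suc.prems by (auto simp: R.m_assoc)
  then show ?case
    using Suc.IH[of "S b"] by (simp add: funpow_swap1)
qed

text \<open>
  If \<open>a R b\<close> has coefficients in \<open>\<pp>\<close> and \<open>u\<close>, \<open>v\<close> are the lowest indices with \<open>a\<^sub>u, b\<^sub>v \<notin> \<pp>\<close>, then
  \<open>a y\<^sup>k b\<close> shows \<open>a\<^sub>u \<sigma>\<^sup>u\<^sup>+\<^sup>k(b\<^sub>v) \<in> \<pp>\<close> for all \<open>k\<close>.
\<close>
lemma CI_Spec:
  assumes p: "sigma_prime_ideal \<pp> D \<sigma>"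
  shows "CI \<pp> \<in> Spec R"
proof (rule SpecI)
  have ps: "sigma_ideal \<pp> D \<sigma>"
    using p unfolding sigma_prime_ideal_def by blast
  interpret p: ideal \<pp> D
    using ps unfolding sigma_ideal_def by blast
  have one: "\<one> \<notin> \<pp>"
    using p p.one_imp_carrier unfolding sigma_prime_ideal_def by blast
  show "ideal (CI \<pp>) R"
    by (rule CI_ideal[OF ps])
  have "\<one>\<^bsub>R\<^esub> 0 = \<one>"
    using ore_const_simps(1)[of \<one>] by simp
  then have "\<one>\<^bsub>R\<^esub> \<notin> CI \<pp>"
    using one by (auto simp: CI_iff intro!: exI[of _ 0])
  then show "CI \<pp> \<noteq> carrier R"
    using R.one_closed by blast
  fix a b assume a: "a \<in> carrier R" and b: "b \<in> carrier R"
    and ab: "\<And>r. r \<in> carrier R \<Longrightarrow> a \<star> r \<star> b \<in> CI \<pp>"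
  show "a \<in> CI \<pp> \<or> b \<in> CI \<pp>"
  proof (rule ccontr)
    assume "\<not> (a \<in> CI \<pp> \<or> b \<in> CI \<pp>)"
    then obtain k l where kl: "a k \<notin> \<pp>" "b l \<notin> \<pp>"
      using a b by (auto simp: CI_iff)
    define u where "u = (LEAST n. a n \<notin> \<pp>)"
    define v where "v = (LEAST n. b n \<notin> \<pp>)"
    have u: "a u \<notin> \<pp>" "\<And>i. i < u \<Longrightarrow> a i \<in> \<pp>"
      using LeastI[of "\<lambda>n. a n \<notin> \<pp>" k] kl(1) not_less_Least[of _ "\<lambda>n. a n \<notin> \<pp>"]
      unfolding u_def by blast+
    have v: "b v \<notin> \<pp>" "\<And>i. i < v \<Longrightarrow> b i \<in> \<pp>"
      using LeastI[of "\<lambda>n. b n \<notin> \<pp>" l] kl(2) not_less_Least[of _ "\<lambda>n. b n \<notin> \<pp>"]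
      unfolding v_def by blast+
    have prod: "a u \<otimes> (\<sigma> ^^ (u + k)) (b v) \<in> \<pp>" for k
    proof -
      let ?c = "(S ^^ k) b"
      have c: "?c = y [^]\<^bsub>R\<^esub> k \<star> b"
        using b by (simp add: y_pow_mult)
      then have cc: "?c \<in> carrier R"
        using b by simp
      have "a \<star> ?c \<in> CI \<pp>"
        using ab[of "y [^]\<^bsub>R\<^esub> k"] a b unfolding c by (simp add: R.m_assoc)
      then have "(\<Oplus>i\<in>{..u + k + v}. a i \<otimes> (\<sigma> ^^ i) (?c (u + k + v - i))) \<in> \<pp>"
        using a cc by (auto simp: CI_iff mult_apply)
      then have "a u \<otimes> (\<sigma> ^^ u) (?c (u + k + v - u)) \<in> \<pp>"
      proof (rule p.finsum_in_remaining[rotated -1])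
        fix i assume i: "i \<in> {..u + k + v}" "i \<noteq> u"
        show "a i \<otimes> (\<sigma> ^^ i) (?c (u + k + v - i)) \<in> \<pp>"
        proof (cases "i < u")
          case True
          then show ?thesis
            using u cc by (intro p.I_r_closed) auto
        next
          case False
          \<comment> \<open>Here \<open>i > u\<close>, so this coefficient is 0 or
            \<open>\<sigma>^k\<close> of the coefficient of \<open>b\<close> at
            \<open>u + v - i < v\<close>.\<close>
          then have "?c (u + k + v - i) \<in> \<pp>"
            using i b v sigma_ideal_pow_iff[OF ps] by (auto simp: S_pow_apply)
          then show ?thesis
            using sigma_ideal_pow_iff[OF ps] cc a by (intro p.I_l_closed) auto
        qed
      qed (use a cc in auto)
      then show ?thesis
        using b by (simp add: S_pow_apply funpow_add)
    qed
    \<comment> \<open>\<sigma>-primeness speaks of ideals, so the elements are enlarged: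
      \<open>J\<close> is the largest \<sigma>-ideal with \<open>a_u J \<subseteq> \<pp>\<close>,
      and \<open>K' = (\<pp> : J)\<close> is a \<sigma>-ideal containing \<open>a_u\<close>.\<close>
    define J where "J = {w \<in> carrier D. \<forall>k. a u \<otimes> (\<sigma> ^^ k) w \<in> \<pp>}"
    have J: "sigma_ideal J D \<sigma>"
      unfolding sigma_ideal_def
    proof
      show "ideal J D"
      proof (rule ideal_if_closed)
        show l: "r \<otimes> w \<in> J" if "w \<in> J" "r \<in> carrier D" for w r
        proof -
          have "a u \<otimes> (\<sigma> ^^ k) (r \<otimes> w) \<in> \<pp>" for k
          proof -
            have "a u \<otimes> (\<sigma> ^^ k) (r \<otimes> w) = (\<sigma> ^^ k) r \<otimes> (a u \<otimes> (\<sigma> ^^ k) w)"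
              using that a unfolding J_def by (simp add: \<sigma>_pow_mult m_lcomm)
            then show ?thesis
              using that p.I_l_closed unfolding J_def by auto
          qed
          then show ?thesis
            using that unfolding J_def by auto
        qed
        show "w \<otimes> r \<in> J" if "w \<in> J" "r \<in> carrier D" for w r
          using l[OF that] that m_comm[of w r] unfolding J_def by simp
      qed (use a in \<open>auto simp: J_def \<sigma>_pow_add r_distr\<close>)
      show "\<sigma> ` J \<subseteq> J"
      proof (rule image_subsetI)
        fix w assume w: "w \<in> J"
        then have "a u \<otimes> (\<sigma> ^^ k) (\<sigma> w) \<in> \<pp>" for k
          unfolding J_def using funpow_swap1[of \<sigma> k w] by (metis (mono_tags, lifting) funpow.simps(2) mem_Collect_eq o_apply)
        then show "\<sigma> w \<in> J"
          using w unfolding J_def by simp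
      qed
    qed
    interpret J: ideal J D
      using J unfolding sigma_ideal_def by blast
    define K' where "K' = {w \<in> carrier D. \<forall>z \<in> J. z \<otimes> w \<in> \<pp>}"
    have K': "sigma_ideal K' D \<sigma>"
      unfolding K'_def by (rule sigma_colon[OF J ps])
    have "J \<cdot> K' \<subseteq> \<pp>"
    proof
      fix z assume "z \<in> J \<cdot> K'"
      then show "z \<in> \<pp>"
        by (rule ideal_prod_closed) (auto simp: K'_def)
    qed
    then have "K' \<subseteq> \<pp> \<or> J \<subseteq> \<pp>"
      using p J K' unfolding sigma_prime_ideal_def by blast
    moreover have "a u \<in> K'"
    proof -
      have "z \<otimes> a u \<in> \<pp>" if "z \<in> J" for z
        using that a m_comm[of z "a u"] unfolding J_def by (auto dest: spec[of _ 0])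
      then show ?thesis
        using a unfolding K'_def by simp
    qed
    moreover have "(\<sigma> ^^ u) (b v) \<in> J"
      using prod b unfolding J_def by (simp add: funpow_add add.commute)
    ultimately have "(\<sigma> ^^ u) (b v) \<in> \<pp>"
      using u by blast
    then show False
      using v(1) b sigma_ideal_pow_iff[OF ps] by simp
  qed
qed

end

subsection \<open>Primes of \<open>D[y; \<sigma>]\<close> and their contractions to \<open>D\<close>\<close>

lemma Spec_ideal: "P \<in> Spec R \<Longrightarrow> ideal P R"
  unfolding Spec_def by blast

lemma Spec_one_notin: "P \<in> Spec R \<Longrightarrow> \<one>\<^bsub>R\<^esub> \<notin> P"
  using ideal.one_imp_carrier unfolding Spec_def by blast

context skew_poly
begin

lemma K_fixed_commute: "a \<in> carrier D \<Longrightarrow> \<sigma> a = a \<Longrightarrow> p \<in> carrier R \<Longrightarrow> K a \<star> p = p \<star> K a"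
proof -
  assume a: "a \<in> carrier D" "\<sigma> a = a" and p: "p \<in> carrier R"
  have "(\<sigma> ^^ n) a = a" for n
    by (induction n) (simp_all add: a(2))
  then show ?thesis
    using a p by (intro ext) (simp add: m_comm)
qed

lemma CI_K: "ideal I D \<Longrightarrow> a \<in> carrier D \<Longrightarrow> K a \<in> CI I \<longleftrightarrow> a \<in> I"
proof -
  assume I: "ideal I D" and a: "a \<in> carrier D"
  have "K a n \<in> I" if "a \<in> I" for n
    using that additive_subgroup.zero_closed[OF ideal.axioms(1)[OF I]] by (cases n) simp_all
  moreover have "a \<in> I" if "K a 0 \<in> I"
    using that by simp
  ultimately show ?thesis
    using a K_closed unfolding CI_iff by blast
qed

text \<open>The element \<open>y\<close> is normal: \<open>r y = y \<tau>(r)\<close> with \<tau>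
  applied to coefficients. Hence \<open>u y\<close> in \<open>P\<close> gives
  \<open>u R y \<subseteq> P\<close>.\<close>

lemma prime_mult_y:
  assumes P: "P \<in> Spec R" "y \<notin> P" and u: "u \<in> carrier R" "u \<star> y \<in> P"
  shows "u \<in> P"
proof -
  interpret P: ideal P R
    using P(1) by (rule Spec_ideal)
  have "u \<star> r \<star> y \<in> P" if r: "r \<in> carrier R" for r
  proof -
    have "(\<lambda>n. \<tau> (r n)) \<in> carrier R"
      using carrier_map[OF r, of "\<lambda>_. \<tau>"] by simp
    have "u \<star> r \<star> y = u \<star> (y \<star> (\<lambda>n. \<tau> (r n)))"
      using u r by (simp add: R.m_assoc flip: mult_y)
    also have "\<dots> = (u \<star> y) \<star> (\<lambda>n. \<tau> (r n))"
      using u \<open>(\<lambda>n. \<tau> (r n)) \<in> carrier R\<close> by (simp add: R.m_assoc)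
    finally have "u \<star> r \<star> y = (u \<star> y) \<star> (\<lambda>n. \<tau> (r n))" .
    then show ?thesis
      using u \<open>(\<lambda>n. \<tau> (r n)) \<in> carrier R\<close> P.I_r_closed by simp
  qed
  then show ?thesis
    using Spec_elementwise[OF P(1) u(1), of y] P(2) by auto
qed

text \<open>\<open>\<sigma>(f) y = y f\<close> lies in \<open>P\<close>, and \<open>y\<close> can be
  cancelled modulo \<open>P\<close>.\<close>

lemma prime_\<sigma>_closed:
  assumes P: "P \<in> Spec R" "y \<notin> P" and f: "f \<in> P"
  shows "(\<lambda>n. \<sigma> (f n)) \<in> P"
proof (rule prime_mult_y[OF P])
  interpret P: ideal P R
    using P(1) by (rule Spec_ideal)
  show "(\<lambda>n. \<sigma> (f n)) \<in> carrier R"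
    using carrier_map[OF P.Icarr[OF f], of "\<lambda>_. \<sigma>"] by simp
  show "(\<lambda>n. \<sigma> (f n)) \<star> y \<in> P"
    using P.I_l_closed[OF f y_closed] y_mult[OF P.Icarr[OF f]] by simp
qed

text \<open>Peeling coefficients off \<open>u\<close> from the left keeps \<open>h\<close> next to a coefficient in \<open>J\<close>.\<close>
lemma CI_mult_in:
  assumes J: "sigma_ideal J D \<sigma>" and P: "ideal P R" and h: "h \<in> carrier R"
    and Jh: "\<And>j. j \<in> J \<Longrightarrow> K j \<star> h \<in> P" and u: "u \<in> CI J"
  shows "u \<star> h \<in> P"
proof -
  interpret P: ideal P R by fact
  interpret J: ideal J D
    using J unfolding sigma_ideal_def by blast
  obtain n where "\<And>m. m \<ge> n \<Longrightarrow> u m = \<zero>"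
    using carrier_bounded[of u] u unfolding CI_iff by blast
  with u show ?thesis
  proof (induction n arbitrary: u)
    case 0
    then have "u = \<zero>\<^bsub>R\<^esub>"
      by (intro carrier_eq_zeroI) auto
    then show ?case
      using h by (simp only: R.l_null P.zero_closed)
  next
    case (Suc n)
    let ?t = "\<lambda>n. \<tau> (u (Suc n))"
    have uc: "u \<in> carrier R" and uJ: "\<And>n. u n \<in> J"
      using Suc.prems by (auto simp: CI_iff)
    have tc: "?t \<in> carrier R"
      using carrier_map[OF carrier_tail[OF uc], of "\<lambda>_. \<tau>"] by simp
    have "?t \<star> h \<in> P"
    proof (rule Suc.IH)
      show "?t \<in> CI J"
        using tc uJ sigma_ideal_\<tau>[OF J] by (simp add: CI_iff)
    qed (use Suc.prems in auto)
    then have "K (u 0) \<star> h \<oplus>\<^bsub>R\<^esub> y \<star> (?t \<star> h) \<in> P"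
      using Jh[OF uJ] P.I_l_closed by simp
    moreover have "u \<star> h = (K (u 0) \<oplus>\<^bsub>R\<^esub> y \<star> ?t) \<star> h"
      using left_decomp[OF uc] by simp
    moreover have "(K (u 0) \<oplus>\<^bsub>R\<^esub> y \<star> ?t) \<star> h
      = K (u 0) \<star> h \<oplus>\<^bsub>R\<^esub> y \<star> (?t \<star> h)"
      using uc tc h by (simp add: R.l_distr R.m_assoc)
    ultimately show ?case
      by (simp only:)
  qed
qed

text \<open>Constants are not central, so \<open>j h\<close> in \<open>P\<close> for a single
  \<open>j\<close> says little about \<open>j R h\<close>. For a \<sigma>-ideal \<open>J\<close> the
  coefficients of \<open>j r\<close> stay in \<open>J\<close>, hence
  \<open>j R h \<subseteq> P\<close> by \<open>CI_mult_in\<close>.\<close>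

lemma prime_of_multiples:
  assumes P: "P \<in> Spec R" and J: "sigma_ideal J D \<sigma>" and j: "j \<in> J" "K j \<notin> P"
    and h: "h \<in> carrier R" and Jh: "\<And>j. j \<in> J \<Longrightarrow> K j \<star> h \<in> P"
  shows "h \<in> P"
proof -
  interpret J: ideal J D
    using J unfolding sigma_ideal_def by blast
  have "K j \<star> r \<star> h \<in> P" if r: "r \<in> carrier R" for r
  proof (rule CI_mult_in[OF J Spec_ideal[OF P] h Jh])
    show "K j \<star> r \<in> CI J"
      using r j J.Icarr J.I_r_closed by (simp add: CI_iff)
  qed
  then show ?thesis
    using Spec_elementwise[OF P, of "K j" h] j J.Icarr h by auto
qed

definition "contraction P = {a \<in> carrier D. K a \<in> P}"

lemma contraction_trivialD:
  assumes "contraction P = {\<zero>}" "a \<in> carrier D" "K a \<in> P"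
  shows "a = \<zero>"
proof -
  have "a \<in> contraction P"
    using assms(2,3) unfolding contraction_def by simp
  then show ?thesis
    using assms(1) by simp
qed

lemma contraction_sigma_ideal:
  assumes P: "P \<in> Spec R" "y \<notin> P"
  shows "sigma_ideal (contraction P) D \<sigma>"
  unfolding sigma_ideal_def
proof
  interpret P: ideal P R
    using P(1) by (rule Spec_ideal)
  show "ideal (contraction P) D"
    by (rule ideal_if_closed) (auto simp: contraction_def K_add K_times P.I_l_closed P.I_r_closed)
  show "\<sigma> ` contraction P \<subseteq> contraction P"
  proof (rule image_subsetI)
    fix a assume "a \<in> contraction P"
    then have a: "a \<in> carrier D" "K a \<in> P"
      unfolding contraction_def by auto
    have "K (\<sigma> a) \<star> y \<in> P"
      using P.I_l_closed[OF a(2) y_closed] y_K[OF a(1)] by simp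
    then show "\<sigma> a \<in> contraction P"
      using prime_mult_y[OF P, of "K (\<sigma> a)"] a(1) unfolding contraction_def by simp
  qed
qed

lemma CI_contraction_subset:
  assumes P: "P \<in> Spec R" "y \<notin> P"
  shows "CI (contraction P) \<subseteq> P"
proof
  interpret P: ideal P R
    using P(1) by (rule Spec_ideal)
  fix u assume u: "u \<in> CI (contraction P)"
  have "u \<star> \<one>\<^bsub>R\<^esub> \<in> P"
    by (rule CI_mult_in[OF contraction_sigma_ideal[OF P] P.ideal_axioms _ _ u]) (auto simp: contraction_def)
  then show "u \<in> P"
    using u by (simp add: CI_iff)
qed

text \<open>For \<open>i\<close> in \<open>I\<close> and \<open>j\<close> in \<open>J\<close> the
  coefficients of \<open>i r j\<close> are \<open>i r_n \<sigma>^n(j)\<close>. They lie in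
  \<open>I J\<close> because \<open>J\<close> is \<sigma>-stable, so
  \<open>i R j \<subseteq> P\<close> and primeness of \<open>P\<close> decides.\<close>

lemma contraction_sigma_prime:
  assumes P: "P \<in> Spec R" "y \<notin> P"
  shows "sigma_prime_ideal (contraction P) D \<sigma>"
  unfolding sigma_prime_ideal_def
proof (intro conjI allI impI)
  interpret P: ideal P R
    using P(1) by (rule Spec_ideal)
  show "sigma_ideal (contraction P) D \<sigma>"
    by (rule contraction_sigma_ideal[OF P])
  have "\<one> \<notin> contraction P"
    using Spec_one_notin[OF P(1)] unfolding contraction_def by simp
  then show "contraction P \<noteq> carrier D"
    by blast
  fix I J assume "sigma_ideal I D \<sigma> \<and> sigma_ideal J D \<sigma> \<and> I \<cdot> J \<subseteq> contraction P"
  then have I: "sigma_ideal I D \<sigma>" and J: "sigma_ideal J D \<sigma>" and IJ: "I \<cdot> J \<subseteq> contraction P"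
    by auto
  interpret I: ideal I D
    using I unfolding sigma_ideal_def by blast
  interpret J: ideal J D
    using J unfolding sigma_ideal_def by blast
  have "i \<in> contraction P \<or> j \<in> contraction P" if ij: "i \<in> I" "j \<in> J" for i j
  proof -
    have "K i \<star> r \<star> K j \<in> P" if r: "r \<in> carrier R" for r
    proof -
      have "i \<otimes> r n \<otimes> (\<sigma> ^^ n) j \<in> contraction P" for n
      proof -
        have "i \<otimes> r n \<in> I"
          using I.I_r_closed ij r by simp
        moreover have "(\<sigma> ^^ n) j \<in> J"
          using sigma_ideal_pow_iff[OF J] ij J.Icarr by simp
        ultimately show ?thesis
          using subsetD[OF IJ ideal_prod.prod] by blast
      qed
      then have "K i \<star> r \<star> K j \<in> CI (contraction P)"
        using r ij I.Icarr J.Icarr by (simp add: CI_iff)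
      then show ?thesis
        using CI_contraction_subset[OF P] by blast
    qed
    then show ?thesis
      using Spec_elementwise[OF P(1), of "K i" "K j"] ij I.Icarr J.Icarr unfolding contraction_def by auto
  qed
  then show "I \<subseteq> contraction P \<or> J \<subseteq> contraction P"
    by blast
qed

lemma CI_contraction:
  assumes I: "ideal I D"
  shows "contraction (CI I) = I"
  using CI_K[OF I] ideal.Icarr[OF I] unfolding contraction_def by blast

lemma Spec0_iff:
  "P \<in> Spec0 D \<sigma> (\<lambda>_. \<zero>) \<longleftrightarrow> P \<in> Spec R \<and> contraction P = {\<zero>}"
proof -
  have "P \<inter> K ` carrier D = {\<zero>\<^bsub>R\<^esub>} \<longleftrightarrow> contraction P = {\<zero>}" if P: "P \<in> Spec R"
  proof -
    interpret P: ideal P R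
      using P by (rule Spec_ideal)
    have "P \<inter> K ` carrier D = K ` contraction P"
      unfolding contraction_def by auto
    moreover have "K ` contraction P = {\<zero>\<^bsub>R\<^esub>} \<longleftrightarrow> contraction P = {\<zero>}"
    proof
      assume eq: "K ` contraction P = {\<zero>\<^bsub>R\<^esub>}"
      have "a = \<zero>" if "a \<in> contraction P" for a
        using eq that K_eq_zero[of a] by blast
      moreover have "\<zero> \<in> contraction P"
        unfolding contraction_def by simp
      ultimately show "contraction P = {\<zero>}"
        by blast
    qed simp
    ultimately show ?thesis
      by simp
  qed
  then show ?thesis
    unfolding Spec0_def by blast
qed

text \<open>The ideal \<open>y R = R y\<close>, as \<open>Y_decomp\<close> shows. In this form it is
  the kernel of the ring homomorphism onto the domain \<open>D\<close> that takes the constant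
  coefficient, which makes it prime.\<close>

definition "Y = {g \<in> carrier R. g 0 = \<zero>}"

lemma mult_coeff_zero: "p \<in> carrier R \<Longrightarrow> q \<in> carrier R \<Longrightarrow> (p \<star> q) 0 = p 0 \<otimes> q 0"
  by (simp add: mult_apply)

lemma one_coeff_zero: "\<one>\<^bsub>R\<^esub> 0 = \<one>"
  using ore_const_simps(1)[of \<one>] by simp

lemma y_coeff: "y 0 = \<zero>" "y (Suc 0) = \<one>"
  using y_mult_coeff[OF R.one_closed] one_coeff_zero by auto

lemma Y_Spec: "Y \<in> Spec R"
proof (rule SpecI)
  show "ideal Y R"
    by (rule R.ideal_if_closed) (auto simp: Y_def mult_coeff_zero)
  have "\<one>\<^bsub>R\<^esub> \<notin> Y"
    unfolding Y_def by (simp add: one_coeff_zero)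
  then show "Y \<noteq> carrier R"
    using R.one_closed by blast
  fix a b assume a: "a \<in> carrier R" and b: "b \<in> carrier R"
    and ab: "\<And>r. r \<in> carrier R \<Longrightarrow> a \<star> r \<star> b \<in> Y"
  have "a \<star> b \<in> Y"
    using ab[OF R.one_closed] a by simp
  then have "a 0 \<otimes> b 0 = \<zero>"
    using a b unfolding Y_def by (simp add: mult_coeff_zero)
  then show "a \<in> Y \<or> b \<in> Y"
    using a b integral[of "a 0" "b 0"] unfolding Y_def by auto
qed

lemma y_in_Y: "y \<in> Y"
  unfolding Y_def by (simp add: y_coeff)

lemma Y_decomp:
  assumes "g \<in> Y"
  obtains s t where "s \<in> carrier R" "g = s \<star> y" "t \<in> carrier R" "g = y \<star> t"
proof -
  have g: "g \<in> carrier R" "g 0 = \<zero>"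
    using assms unfolding Y_def by auto
  have "g = (\<lambda>n. g (Suc n)) \<star> y"
    using g carrier_tail[OF g(1)] by (intro R_eqI) auto
  moreover have "g = y \<star> (\<lambda>n. \<tau> (g (Suc n)))"
    using g carrier_map[OF carrier_tail[OF g(1)], of "\<lambda>_. \<tau>"] by (intro R_eqI) auto
  moreover have "(\<lambda>n. \<tau> (g (Suc n))) \<in> carrier R"
    using carrier_map[OF carrier_tail[OF g(1)], of "\<lambda>_. \<tau>"] by simp
  ultimately show thesis
    using that[OF carrier_tail[OF g(1)]] by blast
qed

lemma Y_subset: "ideal P R \<Longrightarrow> y \<in> P \<Longrightarrow> Y \<subseteq> P"
  by (metis Y_decomp ideal.I_l_closed subsetI)

lemma contraction_Y: "contraction Y = {\<zero>}"
  unfolding contraction_def Y_def by auto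

text \<open>Modulo \<open>y R \<subseteq> P\<close> every \<open>g\<close> in \<open>P\<close>
  equals its constant coefficient, which then lies in \<open>P \<inter> D = 0\<close>.\<close>

lemma eq_Y:
  assumes P: "P \<in> Spec R" "contraction P = {\<zero>}" and y: "y \<in> P"
  shows "P = Y"
proof
  interpret P: ideal P R
    using P(1) by (rule Spec_ideal)
  show "Y \<subseteq> P"
    using Y_subset P.ideal_axioms y by blast
  show "P \<subseteq> Y"
  proof
    fix g assume g: "g \<in> P"
    have gc: "g \<in> carrier R"
      using g P.Icarr by blast
    have "(\<lambda>n. g (Suc n)) \<star> y \<in> P"
      using P.I_l_closed[OF y carrier_tail[OF gc]] .
    then have "K (g 0) \<in> P"
      using P.add_in_cancel[of "K (g 0)" "(\<lambda>n. g (Suc n)) \<star> y"] g gc right_decomp[OF gc] by simp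
    then have "g 0 \<in> contraction P"
      using gc unfolding contraction_def by simp
    then show "g \<in> Y"
      using P(2) gc unfolding Y_def by simp
  qed
qed


subsection \<open>Central elements of minimal degree\<close>

text \<open>The last two clauses amount to centrality: invariant coefficients let \<open>f\<close>
  commute with \<open>y\<close>, and triviality of \<open>\<sigma>^i\<close> wherever
  \<open>f_i\<close> is nonzero lets it commute with constants. The clause
  \<open>f 0 \<noteq> \<zero>\<close> keeps \<open>f\<close> outside \<open>Y\<close>.\<close>

definition min_central :: "(nat \<Rightarrow> 'a) set \<Rightarrow> (nat \<Rightarrow> 'a) \<Rightarrow> nat \<Rightarrow> bool" where
  "min_central P f d \<longleftrightarrow> f \<in> P \<and> 0 < d \<and> f 0 \<noteq> \<zero> \<and> f d \<noteq> \<zero> \<and> (\<forall>i>d. f i = \<zero>) \<and>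
     (\<forall>g \<in> P. (\<forall>i\<ge>d. g i = \<zero>) \<longrightarrow> g = \<zero>\<^bsub>R\<^esub>) \<and> (\<forall>i. \<sigma> (f i) = f i) \<and>
     (\<forall>i. \<forall>a \<in> carrier D. f i \<noteq> \<zero> \<longrightarrow> (\<sigma> ^^ i) a = a)"

text \<open>
  For \<open>g \<in> P\<close> of minimal degree \<open>d\<close>, \<open>g a - \<sigma>\<^sup>d(a) g \<in> P\<close> has lower degree and so vanishes; since
  \<open>g\<^sub>0 \<noteq> 0\<close>, this gives \<open>\<sigma>\<^sup>d = 1\<close>. Multiplying \<open>g\<close> so that its leading coefficient becomes the norm
  of \<open>g\<^sub>d\<close> makes \<open>\<sigma>(g) - g \<in> P\<close> vanish as well.
\<close>
lemma min_central_exists: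
  assumes P: "P \<in> Spec R" "contraction P = {\<zero>}" "P \<noteq> {\<zero>\<^bsub>R\<^esub>}" "y \<notin> P"
  obtains f d where "min_central P f d"
proof -
  interpret P: ideal P R
    using P(1) by (rule Spec_ideal)
  define deg where "deg d \<longleftrightarrow> (\<exists>g \<in> P. g d \<noteq> \<zero> \<and> (\<forall>i>d. g i = \<zero>))" for d
  have topD: "\<exists>m. g m \<noteq> \<zero> \<and> deg m" if g: "g \<in> P" "g \<noteq> \<zero>\<^bsub>R\<^esub>" for g
  proof -
    obtain m where "g m \<noteq> \<zero>" "\<And>i. i > m \<Longrightarrow> g i = \<zero>"
      using carrier_top[OF P.Icarr[OF g(1)] g(2)] by blast
    then show ?thesis
      using g(1) unfolding deg_def by blast
  qed
  define d where "d = (LEAST d. deg d)"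
  obtain g0 where "g0 \<in> P" "g0 \<noteq> \<zero>\<^bsub>R\<^esub>"
    using P(3) P.zero_closed by blast
  then have "deg d"
    using topD LeastI[of deg] unfolding d_def by blast
  then obtain g where g: "g \<in> P" "g d \<noteq> \<zero>" "\<And>i. i > d \<Longrightarrow> g i = \<zero>"
    unfolding deg_def by blast
  have min: "h = \<zero>\<^bsub>R\<^esub>" if h: "h \<in> P" "\<And>i. i \<ge> d \<Longrightarrow> h i = \<zero>" for h
  proof (rule ccontr)
    assume "h \<noteq> \<zero>\<^bsub>R\<^esub>"
    then obtain m where m: "h m \<noteq> \<zero>" "deg m"
      using topD h(1) by blast
    then have "m < d"
      using h(2) not_le by blast
    then show False
      using m(2) not_less_Least unfolding d_def by blast
  qed
  have gc: "g \<in> carrier R"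
    using g P.Icarr by blast
  have "0 < d"
  proof (rule ccontr)
    assume "\<not> 0 < d"
    then have "K (g 0) = g"
      using g(3) by (intro R_eqI) auto
    then have "g 0 \<in> contraction P"
      using g(1) gc unfolding contraction_def by simp
    then show False
      using P(2) g(2) \<open>\<not> 0 < d\<close> by simp
  qed
  \<comment> \<open>Otherwise \<open>g = t y\<close>, and cancelling \<open>y\<close> modulo
    \<open>P\<close> leaves \<open>t\<close> in \<open>P\<close> of degree
    \<open>d - 1\<close>.\<close>
  have "g 0 \<noteq> \<zero>"
  proof
    assume "g 0 = \<zero>"
    let ?t = "\<lambda>n. g (Suc n)"
    have "g = ?t \<star> y"
      using gc carrier_tail[OF gc] \<open>g 0 = \<zero>\<close> by (intro R_eqI) auto
    then have "?t \<in> P"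
      using prime_mult_y[OF P(1,4) carrier_tail[OF gc]] g(1) by simp
    then have "?t = \<zero>\<^bsub>R\<^esub>"
      using g(3) by (intro min) auto
    then have "?t (d - 1) = \<zero>"
      using fun_cong[of ?t "\<zero>\<^bsub>R\<^esub>" "d - 1"] by (simp only: zero_coeff)
    then show False
      using g(2) \<open>0 < d\<close> by simp
  qed
  have eq: "g i \<otimes> (\<sigma> ^^ i) a = (\<sigma> ^^ d) a \<otimes> g i" if a: "a \<in> carrier D" for a i
  proof -
    let ?h = "g \<star> K a \<ominus>\<^bsub>R\<^esub> K ((\<sigma> ^^ d) a) \<star> g"
    have coeff: "?h i = g i \<otimes> (\<sigma> ^^ i) a \<ominus> (\<sigma> ^^ d) a \<otimes> g i" for i
      using gc a by simp
    have "?h \<in> P"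
      using g(1) gc a P.I_l_closed P.I_r_closed by (simp add: R.minus_eq)
    moreover have "?h i = \<zero>" if "i \<ge> d" for i
      unfolding coeff using that g(3)[of i] gc a
      by (cases "i = d") (auto simp: m_comm a_minus_def r_neg)
    ultimately have "?h = \<zero>\<^bsub>R\<^esub>"
      by (rule min)
    then have "?h i = \<zero>"
      by simp
    then show ?thesis
      unfolding coeff using gc a by (simp add: r_right_minus_eq)
  qed
  have \<sigma>_eq: "(\<sigma> ^^ i) a = (\<sigma> ^^ d) a" if "a \<in> carrier D" "g i \<noteq> \<zero>" for a i
    using eq[OF that(1), of i] that gc m_lcancel[of "g i" "(\<sigma> ^^ i) a" "(\<sigma> ^^ d) a"] by (simp add: m_comm)
  have \<sigma>_d: "(\<sigma> ^^ d) a = a" if "a \<in> carrier D" for a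
    using \<sigma>_eq[OF that \<open>g 0 \<noteq> \<zero>\<close>] by simp
  \<comment> \<open>The twisted power \<open>g_d \<sigma>(g_d) ... \<sigma>^(k-1)(g_d)\<close>.
    Since \<open>\<sigma>^d = 1\<close>, \<open>Q d\<close> is the norm of the leading
    coefficient.\<close>
  define Q where "Q k = ((\<lambda>x. g d \<otimes> \<sigma> x) ^^ k) \<one>" for k
  have Q_Suc: "Q (Suc k) = g d \<otimes> \<sigma> (Q k)" for k
    unfolding Q_def by simp
  have Q_closed: "Q k \<in> carrier D" for k
    by (induction k) (use gc in \<open>auto simp: Q_Suc\<close>, simp add: Q_def)
  have Q_nz: "Q k \<noteq> \<zero>" for k
  proof (induction k)
    case 0
    then show ?case
      by (simp add: Q_def)
  next
    case (Suc k)
    then show ?case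
      using gc g(2) Q_closed integral_iff by (simp add: Q_Suc \<sigma>_eq_zero)
  qed
  have Q_Suc': "Q (Suc k) = Q k \<otimes> (\<sigma> ^^ k) (g d)" for k
  proof (induction k)
    case 0
    then show ?case
      using gc by (simp add: Q_def)
  next
    case (Suc k)
    have "Q (Suc (Suc k)) = g d \<otimes> \<sigma> (Q k \<otimes> (\<sigma> ^^ k) (g d))"
      by (simp only: Q_Suc[of "Suc k"] Suc)
    also have "\<dots> = Q (Suc k) \<otimes> (\<sigma> ^^ Suc k) (g d)"
      using gc Q_closed by (simp add: Q_Suc m_assoc)
    finally show ?case .
  qed
  have Q_fixed: "\<sigma> (Q d) = Q d"
  proof -
    \<comment> \<open>Both sides are \<open>Q (d + 1)\<close>, with the extra factor split off on
      the left or on the right; the right one is \<open>\<sigma>^d(g_d) = g_d\<close>.\<close>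
    have "g d \<otimes> \<sigma> (Q d) = g d \<otimes> Q d"
      using Q_Suc[of d] Q_Suc'[of d] gc Q_closed \<sigma>_d by (simp add: m_comm)
    then show ?thesis
      using m_lcancel[of "g d" "\<sigma> (Q d)" "Q d"] gc g(2) Q_closed by simp
  qed
  \<comment> \<open>The cofactor of \<open>g_d\<close> in the norm:
    \<open>g_d \<sigma>(Q (d - 1)) = Q d\<close>, where \<open>d > 0\<close> is used.\<close>
  define M where "M = \<sigma> (Q (d - 1))"
  have M: "M \<in> carrier D" "M \<noteq> \<zero>" "M \<otimes> g d = Q d"
    using Q_closed Q_nz gc Q_Suc[of "d - 1"] \<open>0 < d\<close> by (auto simp: M_def \<sigma>_eq_zero m_comm)
  define f where "f = K M \<star> g"
  have f: "f \<in> P" "f \<in> carrier R" and f_coeff: "\<And>i. f i = M \<otimes> g i"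
    unfolding f_def using g(1) gc M(1) P.I_l_closed by auto
  have f_nz: "f i \<noteq> \<zero> \<longleftrightarrow> g i \<noteq> \<zero>" for i
    using f_coeff M gc integral_iff by simp
  have "\<sigma> (f i) = f i" for i
  proof -
    let ?s = "\<lambda>n. \<sigma> (f n)"
    have s: "?s \<in> P" "?s \<in> carrier R"
      using prime_\<sigma>_closed[OF P(1,4) f(1)] P.Icarr by auto
    then have "?s \<ominus>\<^bsub>R\<^esub> f \<in> P"
      using f by (simp add: R.minus_eq)
    moreover have "(?s \<ominus>\<^bsub>R\<^esub> f) i = \<zero>" if "i \<ge> d" for i
    proof (cases "i = d")
      case True
      then show ?thesis
        using s f M(3) Q_fixed Q_closed by (simp add: f_coeff a_minus_def r_neg del: \<sigma>_simps)
    next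
      case False
      then have "f i = \<zero>"
        using f_nz g(3)[of i] that by auto
      then show ?thesis
        using s f by (simp add: a_minus_def)
    qed
    ultimately have "?s \<ominus>\<^bsub>R\<^esub> f = \<zero>\<^bsub>R\<^esub>"
      by (rule min)
    then have "(?s \<ominus>\<^bsub>R\<^esub> f) i = \<zero>"
      by simp
    then show ?thesis
      using s f by (simp add: r_right_minus_eq)
  qed
  then have "min_central P f d"
    unfolding min_central_def
    using f(1) \<open>0 < d\<close> \<open>g 0 \<noteq> \<zero>\<close> g(2,3) f_nz min \<sigma>_eq \<sigma>_d by auto
  then show thesis
    by (rule that)
qed

section \<open>Consequences for a fixed central element of minimal degree\<close>

context
  fixes P :: "(nat \<Rightarrow> 'a) set" and f :: "nat \<Rightarrow> 'a" and d :: nat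
  assumes P_ideal: "ideal P R" and f_central: "min_central P f d"
begin

interpretation P: ideal P R
  by (rule P_ideal)

lemma min_centralD:
  shows "f \<in> P" "f \<in> carrier R" "0 < d" "f 0 \<noteq> \<zero>" "f d \<noteq> \<zero>" "i > d \<Longrightarrow> f i = \<zero>" "\<sigma> (f i) = f i"
    and "a \<in> carrier D \<Longrightarrow> f i \<noteq> \<zero> \<Longrightarrow> (\<sigma> ^^ i) a = a"
    and "g \<in> P \<Longrightarrow> (\<And>i. i \<ge> d \<Longrightarrow> g i = \<zero>) \<Longrightarrow> g = \<zero>\<^bsub>R\<^esub>"
  using f_central P.Icarr unfolding min_central_def by auto

lemma min_central_pow: "(\<sigma> ^^ k) (f i) = f i"
  by (induction k) (auto simp: min_centralD(7))

lemma mult_min_central: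
  assumes "q \<in> carrier R"
  shows "(q \<star> f) n = (\<Oplus>i\<in>{..n}. q i \<otimes> f (n - i))"
  using assms min_centralD(2) by (simp add: mult_apply min_central_pow)

text \<open>Where \<open>f_i\<close> is nonzero the twist \<open>\<sigma>^i\<close> is trivial, and
  the twists fix the coefficients of \<open>f\<close>. Both products are therefore the ordinary
  commutative convolution.\<close>

lemma min_central_commute:
  assumes "g \<in> carrier R"
  shows "f \<star> g = g \<star> f"
proof
  fix n
  note fc = min_centralD(2)
  have "(f \<star> g) n = (\<Oplus>i\<in>{..n}. f i \<otimes> (\<sigma> ^^ i) (g (n - i)))"
    using assms fc by (simp add: mult_apply)
  also have "\<dots> = (\<Oplus>i\<in>{..n}. f i \<otimes> g (n - i))"
  proof (intro finsum_cong')
    show "f i \<otimes> (\<sigma> ^^ i) (g (n - i)) = f i \<otimes> g (n - i)" for i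
      using min_centralD(8)[of "g (n - i)" i] assms by (cases "f i = \<zero>") auto
  qed (use assms fc in auto)
  also have "\<dots> = (\<Oplus>i\<in>(\<lambda>i. n - i) ` {..n}. f i \<otimes> g (n - i))"
  proof -
    have "(\<lambda>i. n - i) ` {..n} = {..n}"
    proof (intro equalityI subsetI)
      show "i \<in> (\<lambda>i. n - i) ` {..n}" if "i \<in> {..n}" for i
        using that by (intro image_eqI[of _ _ "n - i"]) auto
    qed auto
    then show ?thesis
      by simp
  qed
  also have "\<dots> = (\<Oplus>i\<in>{..n}. f (n - i) \<otimes> g (n - (n - i)))"
    using assms fc by (subst finsum_reindex) (auto simp: inj_on_def)
  also have "\<dots> = (\<Oplus>i\<in>{..n}. g i \<otimes> f (n - i))"
    using assms fc by (intro finsum_cong') (auto simp: m_comm)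
  also have "\<dots> = (g \<star> f) n"
    using assms by (simp add: mult_min_central)
  finally show "(f \<star> g) n = (g \<star> f) n" .
qed

text \<open>Pseudo-division: each round multiplies by the leading coefficient \<open>f_d\<close> and
  subtracts a left multiple of \<open>f\<close>. The remainder stays in \<open>P\<close>, so once
  its degree drops below \<open>d\<close> it vanishes. The constant \<open>c\<close> is a power of
  \<open>f_d\<close>, hence \<sigma>-fixed and central.\<close>

lemma min_central_division:
  assumes "g \<in> P"
  obtains c q where "c \<in> carrier D" "c \<noteq> \<zero>" "\<sigma> c = c" "q \<in> carrier R" "K c \<star> g = q \<star> f"
proof -
  note fc = min_centralD(2)
  have zero: "\<exists>c \<in> carrier D. c \<noteq> \<zero> \<and> \<sigma> c = c \<and> (\<exists>q \<in> carrier R. K c \<star> \<zero>\<^bsub>R\<^esub> = q \<star> f)"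
  proof -
    have "K \<one> \<star> \<zero>\<^bsub>R\<^esub> = \<zero>\<^bsub>R\<^esub> \<star> f"
      using fc by (simp only: K_one R.l_null R.r_null R.one_closed)
    then show ?thesis
      using one_closed one_not_zero \<sigma>_simps(4) R.zero_closed by blast
  qed
  obtain n where "\<And>m. m \<ge> n \<Longrightarrow> g m = \<zero>"
    using carrier_bounded[OF P.Icarr[OF assms]] by blast
  with assms have "\<exists>c \<in> carrier D. c \<noteq> \<zero> \<and> \<sigma> c = c \<and> (\<exists>q \<in> carrier R. K c \<star> g = q \<star> f)"
  proof (induction n arbitrary: g)
    case 0
    then have "g = \<zero>\<^bsub>R\<^esub>"
      by (intro carrier_eq_zeroI) auto
    then show ?case
      using zero by (simp only:)
  next
    case (Suc m)
    have gc: "g \<in> carrier R"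
      using Suc.prems P.Icarr by blast
    show ?case
    proof (cases "m < d")
      case True
      then have "g = \<zero>\<^bsub>R\<^esub>"
        using Suc.prems by (intro min_centralD(9)) auto
      then show ?thesis
        using zero by (simp only:)
    next
      case False
      \<comment> \<open>As the coefficients of \<open>f\<close> are invariant,
        \<open>y^(m-d) f\<close> is a mere shift of \<open>f\<close>, so that \<open>f_d g\<close>
        and \<open>?s f\<close> have the same coefficient \<open>f_d g_m\<close> at
        \<open>m\<close>.\<close>
      let ?s = "K (g m) \<star> y [^]\<^bsub>R\<^esub> (m - d)"
      have sc: "?s \<in> carrier R"
        using gc by simp
      have sf: "(?s \<star> f) i = (if i < m - d then \<zero> else g m \<otimes> f (i - (m - d)))" for i
      proof -
        have "?s \<star> f = K (g m) \<star> (y [^]\<^bsub>R\<^esub> (m - d) \<star> f)"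
          using gc fc by (simp add: R.m_assoc)
        then have "(?s \<star> f) i = g m \<otimes> (y [^]\<^bsub>R\<^esub> (m - d) \<star> f) i"
          using gc fc by simp
        then show ?thesis
          using gc fc by (simp add: y_pow_mult S_pow_apply min_central_pow)
      qed
      let ?g = "K (f d) \<star> g \<ominus>\<^bsub>R\<^esub> ?s \<star> f"
      have gP: "?g \<in> P"
        using Suc.prems(1) min_centralD(1) fc sc P.I_l_closed by (simp add: R.minus_eq)
      have "?g i = \<zero>" if i: "i \<ge> m" for i
      proof -
        have "?g i = f d \<otimes> g i \<ominus> (?s \<star> f) i"
          using gc fc sc by simp
        also have "\<dots> = \<zero>"
        proof (cases "i = m")
          case True
          then show ?thesis
            using False gc fc diff_le_self[of m d]
            by (simp add: sf m_comm a_minus_def r_neg not_less del: diff_le_self)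
        next
          case False
          then have "g i = \<zero>" "f (i - (m - d)) = \<zero>"
            using i \<open>\<not> m < d\<close> Suc.prems(2)[of i] min_centralD(6)[of "i - (m - d)"] by auto
          then show ?thesis
            using gc fc by (simp add: sf a_minus_def)
        qed
        finally show ?thesis .
      qed
      then obtain c q where c: "c \<in> carrier D" "c \<noteq> \<zero>" "\<sigma> c = c"
        and q: "q \<in> carrier R" "K c \<star> ?g = q \<star> f"
        using Suc.IH[OF gP] by blast
      have "K (c \<otimes> f d) \<star> g = K c \<star> (?g \<oplus>\<^bsub>R\<^esub> ?s \<star> f)"
      proof -
        have "?g \<oplus>\<^bsub>R\<^esub> ?s \<star> f = K (f d) \<star> g"
          using gc fc sc by (simp add: R.minus_eq R.a_assoc R.l_neg)
        then show ?thesis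
          using c(1) fc gc by (simp add: K_times R.m_assoc)
      qed
      also have "\<dots> = K c \<star> ?g \<oplus>\<^bsub>R\<^esub> K c \<star> (?s \<star> f)"
        using c(1) fc gc sc P.Icarr[OF gP] by (intro R.r_distr) auto
      also have "\<dots> = (q \<oplus>\<^bsub>R\<^esub> K c \<star> ?s) \<star> f"
        unfolding q(2) using c(1) fc gc sc q(1) by (simp add: R.l_distr R.m_assoc)
      finally have "K (c \<otimes> f d) \<star> g = (q \<oplus>\<^bsub>R\<^esub> K c \<star> ?s) \<star> f" .
      moreover have "q \<oplus>\<^bsub>R\<^esub> K c \<star> ?s \<in> carrier R"
        using q(1) c(1) sc by simp
      moreover have "c \<otimes> f d \<in> carrier D" "c \<otimes> f d \<noteq> \<zero>" "\<sigma> (c \<otimes> f d) = c \<otimes> f d"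
        using c fc min_centralD(5,7) integral_iff by auto
      ultimately show ?thesis
        by blast
    qed
  qed
  then show thesis
    using that by blast
qed

lemma min_central_content_sigma_ideal: "sigma_ideal (Idl (range f)) D \<sigma>"
  unfolding sigma_ideal_def
proof
  have rf: "range f \<subseteq> carrier D"
    using min_centralD(2) by auto
  show I: "ideal (Idl (range f)) D"
    using genideal_ideal rf by blast
  interpret I: ideal "Idl (range f)" D
    by (rule I)
  let ?V = "{x \<in> carrier D. \<sigma> x \<in> Idl (range f)}"
  have "ideal ?V D"
    by (rule ideal_if_closed) (auto simp: I.I_l_closed I.I_r_closed)
  moreover have "range f \<subseteq> ?V"
    using rf genideal_self[OF rf] min_centralD(7) by auto
  ultimately have "Idl (range f) \<subseteq> ?V"
    by (rule genideal_minimal)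
  then show "\<sigma> ` (Idl (range f)) \<subseteq> Idl (range f)"
    by blast
qed

lemma min_central_in_content: "f i \<in> Idl (range f)"
proof -
  have "range f \<subseteq> carrier D"
    using min_centralD(2) by auto
  then show ?thesis
    by (rule subsetD[OF genideal_self rangeI])
qed

text \<open>Pseudo-division gives \<open>c h = q f\<close>. The coefficients of \<open>q f\<close>
  lie in \<open>c c(f)\<close>, so by \<open>gauss\<close> the constant \<open>c\<close> divides
  those of \<open>q\<close> and can be cancelled.\<close>

lemma min_central_Gauss:
  assumes h: "h \<in> P" "\<And>n. h n \<in> Idl (range f)"
  obtains q where "q \<in> carrier R" "h = q \<star> f"
proof -
  note fc = min_centralD(2)
  have hc: "h \<in> carrier R"
    using h P.Icarr by blast
  obtain c q where c: "c \<in> carrier D" "c \<noteq> \<zero>" and q: "q \<in> carrier R" "K c \<star> h = q \<star> f"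
    using min_central_division[OF h(1)] by blast
  have "c divides (q l)" for l
  proof (rule gauss[of q f 0 c])
    show "\<exists>j\<in>Idl (range f). (\<Oplus>i\<in>{..n}. q i \<otimes> f (n - i)) = c \<otimes> j" for n
    proof (intro bexI)
      show "(\<Oplus>i\<in>{..n}. q i \<otimes> f (n - i)) = c \<otimes> h n"
        using fun_cong[OF q(2), of n] hc c q(1) by (simp add: mult_min_central)
    qed (rule h(2))
  qed (use q(1) fc c min_centralD(4) in auto)
  then obtain p where p: "\<And>l. p l \<in> carrier D" "\<And>l. q l = c \<otimes> p l"
    unfolding factor_def by metis
  obtain n where n: "\<And>m. m \<ge> n \<Longrightarrow> q m = \<zero>"
    using carrier_bounded[OF q(1)] by blast
  have "p m = \<zero>" if "m \<ge> n" for m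
    using n[OF that] p[of m] c integral_iff[of c "p m"] by simp
  then have pc: "p \<in> carrier R"
    using p(1) upI[of p n] by (simp add: R_simps(1))
  have "q = K c \<star> p"
    using p pc c by (intro ext) simp
  then have "K c \<star> h = K c \<star> (p \<star> f)"
    using q(2) pc fc c by (simp add: R.m_assoc)
  then have "(K c \<star> h) n = (K c \<star> (p \<star> f)) n" for n
    by (rule fun_cong)
  then have "c \<otimes> h n = c \<otimes> (p \<star> f) n" for n
    using hc pc fc c by simp
  then have "h = p \<star> f"
    using m_lcancel[of c "h _" "(p \<star> f) _"] c hc pc fc by (intro ext) simp
  then show thesis
    using that pc by blast
qed

text \<open>\<open>F = (v/e) f\<close> is an element of \<open>c(f)^-1 f\<close>. For
  \<open>j\<close> in \<open>c(f)\<close> the quotient \<open>b = j v / e\<close> lies in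
  \<open>D\<close> and \<open>j F = b f\<close> is in \<open>P\<close>; then
  \<open>prime_of_multiples\<close> cancels \<open>c(f)\<close>, which contains the nonzero
  \<open>f_d\<close>. The statement on supports later makes \<open>F\<close> commute with
  constants.\<close>

lemma min_central_scaled:
  assumes P: "P \<in> Spec R" "contraction P = {\<zero>}"
    and J': "inverse_pair (Idl (range f)) J' e" and v: "v \<in> J'"
    and F: "\<And>n. F n \<in> carrier D" "\<And>n. v \<otimes> f n = e \<otimes> F n"
  shows "F \<in> P" "F n \<noteq> \<zero> \<Longrightarrow> f n \<noteq> \<zero>"
proof -
  note fc = min_centralD(2)
  interpret J': ideal J' D
    using J' unfolding inverse_pair_def by blast
  interpret J: ideal "Idl (range f)" D
    using min_central_content_sigma_ideal unfolding sigma_ideal_def by blast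
  have e: "e \<in> carrier D" "e \<noteq> \<zero>" and edvd: "\<And>i j. i \<in> Idl (range f) \<Longrightarrow> j \<in> J' \<Longrightarrow> e divides (i \<otimes> j)"
    using J' unfolding inverse_pair_def by auto
  have vc: "v \<in> carrier D"
    using v J'.Icarr by blast
  have nz: "F n = \<zero>" if "f n = \<zero>" for n
    using F[of n] that e vc integral_iff[of e "F n"] by simp
  then show "F n \<noteq> \<zero> \<Longrightarrow> f n \<noteq> \<zero>"
    by blast
  have Fc: "F \<in> carrier R"
    using upI[of F "Suc d"] F(1) nz min_centralD(6) by (simp add: R_simps(1))
  show "F \<in> P"
  proof (rule prime_of_multiples[OF P(1) min_central_content_sigma_ideal min_central_in_content[of d]])
    show "K (f d) \<notin> P"
      using contraction_trivialD[OF P(2), of "f d"] fc min_centralD(5) by auto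
    fix j assume j: "j \<in> Idl (range f)"
    obtain b where b: "b \<in> carrier D" "j \<otimes> v = e \<otimes> b"
      using edvd[OF j v] unfolding factor_def by blast
    have jc: "j \<in> carrier D"
      using j J.Icarr by blast
    have "K j \<star> F = K b \<star> f"
    proof
      fix n
      have "e \<otimes> (j \<otimes> F n) = j \<otimes> (v \<otimes> f n)"
        using e jc F(1) by (simp add: F(2) m_lcomm)
      also have "\<dots> = e \<otimes> (b \<otimes> f n)"
        using jc vc fc b(1) e by (simp add: m_assoc[symmetric] b(2))
      finally have "j \<otimes> F n = b \<otimes> f n"
        using m_lcancel[of e "j \<otimes> F n" "b \<otimes> f n"] e jc F(1) b(1) fc by simp
      then show "(K j \<star> F) n = (K b \<star> f) n"
        using jc b(1) Fc fc by simp
    qed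
    then show "K j \<star> F \<in> P"
      using P.I_l_closed[OF min_centralD(1)] b(1) by simp
  qed (rule Fc)
qed

text \<open>Some element of \<open>c(f)^-1 f\<close> has a coefficient outside \<open>I\<close>,
  although \<open>f\<close> itself may have all its coefficients in \<open>I\<close>; by
  \<open>min_central_scaled\<close> it still belongs to \<open>P\<close>.\<close>

lemma min_central_not_in_CI:
  assumes P: "P \<in> Spec R" "contraction P = {\<zero>}" and I: "ideal I D" "I \<noteq> carrier D"
  shows "\<not> P \<subseteq> CI I"
proof
  assume sub: "P \<subseteq> CI I"
  have J: "ideal (Idl (range f)) D"
    using min_central_content_sigma_ideal unfolding sigma_ideal_def by blast
  have "Idl (range f) \<noteq> {\<zero>}"
    using min_central_in_content[of 0] min_centralD(4) by auto
  then obtain J' e where J': "inverse_pair (Idl (range f)) J' e"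
    using nonzero_ideal_invertible[OF J] by blast
  have fc: "\<And>n. f n \<in> carrier D"
    using min_centralD(2) by simp
  obtain v k F where F: "v \<in> J'" "\<And>n. F n \<in> carrier D" "\<And>n. v \<otimes> f n = e \<otimes> F n" "F k \<notin> I"
    by (rule inverse_pair_scaled_notin[OF fc J' I]) (rule that)
  have "F \<in> P"
    by (rule min_central_scaled(1)[OF P J' F(1,2,3)])
  then show False
    using sub F(4) by (auto simp: CI_iff)
qed

end

subsection \<open>Minimal primes of \<open>D[y; \<sigma>]\<close>\<close>

text \<open>
  Otherwise the colon ideal \<open>\<qq> = (\<pp>\<^sub>0 : \<pp>) = \<pp>\<^sup>-\<^sup>1 \<pp>\<^sub>0\<close> would lie in \<open>\<pp>\<^sub>0\<close>, so that
  \<open>\<pp>\<^sup>-\<^sup>1\<close> would stabilize \<open>\<pp>\<^sub>0\<close> and hence lie in \<open>D\<close>.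
\<close>
lemma sigma_prime_eq:
  assumes p0: "sigma_prime_ideal \<pp>\<^sub>0 D \<sigma>" "\<pp>\<^sub>0 \<noteq> {\<zero>}" and p: "sigma_prime_ideal \<pp> D \<sigma>" and sub: "\<pp>\<^sub>0 \<subseteq> \<pp>"
  shows "\<pp>\<^sub>0 = \<pp>"
proof (rule ccontr)
  assume "\<pp>\<^sub>0 \<noteq> \<pp>"
  have ps: "sigma_ideal \<pp> D \<sigma>" "sigma_ideal \<pp>\<^sub>0 D \<sigma>" "\<pp> \<noteq> carrier D"
    using p p0 unfolding sigma_prime_ideal_def by auto
  interpret p: ideal \<pp> D
    using ps unfolding sigma_ideal_def by blast
  interpret p0: ideal \<pp>\<^sub>0 D
    using ps unfolding sigma_ideal_def by blast
  have "\<pp> \<noteq> {\<zero>}"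
    using p0(2) sub p0.zero_closed by blast
  then obtain p' c where pair: "inverse_pair \<pp> p' c"
    using nonzero_ideal_invertible p.ideal_axioms by blast
  interpret p': ideal p' D
    using pair unfolding inverse_pair_def by blast
  have c: "c \<in> carrier D" "c \<noteq> \<zero>" and cdvd: "\<And>i j. i \<in> \<pp> \<Longrightarrow> j \<in> p' \<Longrightarrow> c divides (i \<otimes> j)"
    using pair unfolding inverse_pair_def by auto
  define q where "q = {w \<in> carrier D. \<forall>z \<in> \<pp>. z \<otimes> w \<in> \<pp>\<^sub>0}"
  have q: "sigma_ideal q D \<sigma>"
    unfolding q_def by (rule sigma_colon[OF ps(1,2)])
  have "\<pp> \<cdot> q \<subseteq> \<pp>\<^sub>0"
  proof
    fix z assume "z \<in> \<pp> \<cdot> q"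
    then show "z \<in> \<pp>\<^sub>0"
      by (rule ideal_prod_closed) (auto simp: q_def)
  qed
  then have "q \<subseteq> \<pp>\<^sub>0"
    using p0(1) q ps(1) sub \<open>\<pp>\<^sub>0 \<noteq> \<pp>\<close> unfolding sigma_prime_ideal_def by blast
  \<comment> \<open>In terms of fractions: \<open>v/c\<close> ranges over \<open>\<pp>^-1\<close>,
    and it is to lie in \<open>D\<close>. For \<open>z\<close> in \<open>\<pp>\<^sub>0\<close> put
    \<open>w = z v / c\<close>. Every \<open>x\<close> in \<open>\<pp>\<close> gives
    \<open>x w = (x v / c) z\<close> in \<open>\<pp>\<^sub>0\<close>, so \<open>w\<close> is in
    \<open>q \<subseteq> \<pp>\<^sub>0\<close>, and \<open>v/c\<close> stabilizes
    \<open>\<pp>\<^sub>0\<close>.\<close>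
  have "c divides v" if v: "v \<in> p'" for v
  proof (rule stabilized_ideal_divides[OF p0.ideal_axioms p0(2) c])
    have vc: "v \<in> carrier D"
      using v p'.Icarr by blast
    then show "v \<in> carrier D" .
    fix z assume z: "z \<in> \<pp>\<^sub>0"
    then have zc: "z \<in> carrier D"
      using p0.Icarr by blast
    obtain w where w: "w \<in> carrier D" "z \<otimes> v = c \<otimes> w"
      using cdvd[of z v] z sub v unfolding factor_def by blast
    have "x \<otimes> w \<in> \<pp>\<^sub>0" if x: "x \<in> \<pp>" for x
    proof -
      have xc: "x \<in> carrier D"
        using x p.Icarr by blast
      obtain b where b: "b \<in> carrier D" "x \<otimes> v = c \<otimes> b"
        using cdvd[OF x v] unfolding factor_def by blast
      have "c \<otimes> (w \<otimes> x) = (z \<otimes> v) \<otimes> x"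
        using c(1) w(1) xc by (simp add: w(2) m_assoc)
      also have "\<dots> = z \<otimes> (x \<otimes> v)"
        using vc xc zc by (simp add: m_ac)
      also have "\<dots> = c \<otimes> (b \<otimes> z)"
        using c(1) b(1) zc by (simp add: b(2) m_ac)
      finally have "w \<otimes> x = b \<otimes> z"
        using m_lcancel[of c "w \<otimes> x" "b \<otimes> z"] c w(1) b(1) xc zc by simp
      then show ?thesis
        using p0.I_l_closed[OF z b(1)] m_comm[OF xc w(1)] by simp
    qed
    then have "w \<in> q"
      using w(1) unfolding q_def by simp
    then show "\<exists>w\<in>\<pp>\<^sub>0. v \<otimes> z = c \<otimes> w"
      using \<open>q \<subseteq> \<pp>\<^sub>0\<close> w(2) vc zc m_comm[of v z] by auto
  qed
  \<comment> \<open>With \<open>\<pp>^-1 \<subseteq> D\<close> every quotient \<open>i j / c\<close>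
    would be a multiple of \<open>i\<close> and so lie in \<open>\<pp>\<close>, but not all of them
    do.\<close>
  moreover obtain i j b where ij: "i \<in> \<pp>" "j \<in> p'" "b \<in> carrier D" "i \<otimes> j = c \<otimes> b" "b \<notin> \<pp>"
    by (rule inverse_pair_not_in_multiple[OF pair p.ideal_axioms ps(3)])
  ultimately obtain b' where b': "b' \<in> carrier D" "j = c \<otimes> b'"
    unfolding factor_def by blast
  have "c \<otimes> b = c \<otimes> (i \<otimes> b')"
    using ij(4) b' c p.Icarr[OF ij(1)] by (simp add: m_lcomm)
  then have "b = i \<otimes> b'"
    using m_lcancel[of c b "i \<otimes> b'"] c ij(3) b'(1) p.Icarr[OF ij(1)] by simp
  then show False
    using ij(1,5) b'(1) p.I_r_closed by blast
qed

definition "extended_primes = {CI \<pp> | \<pp>. sigma_prime_ideal \<pp> D \<sigma> \<and> \<pp> \<noteq> {\<zero>}}"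
definition "zero_primes = {P \<in> Spec0 D \<sigma> (\<lambda>_. \<zero>). P \<noteq> {\<zero>\<^bsub>R\<^esub>}}"

lemma sigma_primeD:
  assumes "sigma_prime_ideal \<pp> D \<sigma>"
  shows "sigma_ideal \<pp> D \<sigma>" "ideal \<pp> D" "\<pp> \<noteq> carrier D"
  using assms unfolding sigma_prime_ideal_def sigma_ideal_def by auto

lemma zero_primes_iff:
  "P \<in> zero_primes \<longleftrightarrow> P \<in> Spec R \<and> contraction P = {\<zero>} \<and> P \<noteq> {\<zero>\<^bsub>R\<^esub>}"
  unfolding zero_primes_def by (simp add: Spec0_iff)

lemma Y_zero_prime: "Y \<in> zero_primes"
proof -
  have "y \<noteq> \<zero>\<^bsub>R\<^esub>"
    using y_coeff(2) zero_coeff[of "Suc 0"] one_not_zero by metis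
  then show ?thesis
    using Y_Spec contraction_Y y_in_Y unfolding zero_primes_iff by blast
qed

lemma primes_Spec:
  assumes "P \<in> extended_primes \<union> zero_primes"
  shows "P \<in> Spec R" "P \<noteq> {\<zero>\<^bsub>R\<^esub>}"
proof -
  have "CI \<pp> \<noteq> {\<zero>\<^bsub>R\<^esub>}" if p: "sigma_prime_ideal \<pp> D \<sigma>" "\<pp> \<noteq> {\<zero>}" for \<pp>
  proof -
    interpret p: ideal \<pp> D
      using p sigma_primeD by blast
    obtain a where a: "a \<in> \<pp>" "a \<noteq> \<zero>"
      using p(2) p.zero_closed by blast
    then have "K a \<in> CI \<pp>" "K a \<noteq> \<zero>\<^bsub>R\<^esub>"
      using CI_K[OF p.ideal_axioms] p.Icarr K_eq_zero by auto
    then show ?thesis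
      by blast
  qed
  then have "P \<in> Spec R \<and> P \<noteq> {\<zero>\<^bsub>R\<^esub>}" if "P \<in> extended_primes"
    using that CI_Spec unfolding extended_primes_def by auto
  moreover have "P \<in> Spec R \<and> P \<noteq> {\<zero>\<^bsub>R\<^esub>}" if "P \<in> zero_primes"
    using that unfolding zero_primes_iff by simp
  ultimately show "P \<in> Spec R" "P \<noteq> {\<zero>\<^bsub>R\<^esub>}"
    using assms by auto
qed

lemma prime_contains:
  assumes P: "P \<in> Spec R" "P \<noteq> {\<zero>\<^bsub>R\<^esub>}"
  obtains P0 where "P0 \<in> extended_primes \<union> zero_primes" "P0 \<subseteq> P"
proof -
  consider "contraction P = {\<zero>}" | "y \<in> P" | "contraction P \<noteq> {\<zero>}" "y \<notin> P"
    by blast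
  then show thesis
  proof cases
    case 1
    then show ?thesis
      using that[of P] P zero_primes_iff by blast
  next
    case 2
    then show ?thesis
      using that[of Y] Y_zero_prime Y_subset Spec_ideal[OF P(1)] by blast
  next
    case 3
    then show ?thesis
      using that[of "CI (contraction P)"] contraction_sigma_prime[OF P(1)] CI_contraction_subset[OF P(1)]
      unfolding extended_primes_def by blast
  qed
qed

text \<open>Take central elements of minimal degree, \<open>f\<close> in \<open>P0\<close> and
  \<open>h\<close> in \<open>P\<close>, with \<open>c f = q h\<close>. Centrality of
  \<open>h\<close> gives \<open>q R h \<subseteq> P0\<close>, and the degree of \<open>q\<close> is
  too small for \<open>P0\<close>, so \<open>h\<close> is in \<open>P0\<close>. Every
  \<open>g\<close> in \<open>P\<close> then has a multiple \<open>c g\<close> in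
  \<open>R h \<subseteq> P0\<close> with a nonzero central constant \<open>c\<close>, which
  \<open>P0\<close> does not contain.\<close>

lemma zero_primes_eq:
  assumes P: "P \<in> zero_primes" and P0: "P0 \<in> zero_primes" and sub: "P0 \<subseteq> P"
  shows "P0 = P"
proof (cases "y \<in> P0")
  case True
  then show ?thesis
    using eq_Y[of P] eq_Y[of P0] P P0 sub unfolding zero_primes_iff by blast
next
  case False
  have Ps: "P \<in> Spec R" "contraction P = {\<zero>}" "P \<noteq> {\<zero>\<^bsub>R\<^esub>}"
    and P0s: "P0 \<in> Spec R" "contraction P0 = {\<zero>}" "P0 \<noteq> {\<zero>\<^bsub>R\<^esub>}"
    using P P0 unfolding zero_primes_iff by auto
  interpret P: ideal P R
    using Spec_ideal[OF Ps(1)] .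
  interpret P0: ideal P0 R
    using Spec_ideal[OF P0s(1)] .
  obtain f d where f: "min_central P0 f d"
    using min_central_exists[OF P0s False] by blast
  note fD = min_centralD[OF P0.ideal_axioms f]
  have "y \<notin> P"
  proof
    assume "y \<in> P"
    then have "f \<in> Y"
      using eq_Y[OF Ps(1,2)] fD(1) sub by blast
    then show False
      using fD(4) unfolding Y_def by simp
  qed
  then obtain h e where h: "min_central P h e"
    using min_central_exists[OF Ps] by blast
  note hD = min_centralD[OF P.ideal_axioms h]
  have "f \<in> P"
    using fD(1) sub by blast
  then obtain c q where c: "c \<in> carrier D" "c \<noteq> \<zero>" "\<sigma> c = c"
    and q: "q \<in> carrier R" "K c \<star> f = q \<star> h"
    by (rule min_central_division[OF P.ideal_axioms h])
  have "q \<star> r \<star> h \<in> P0" if r: "r \<in> carrier R" for r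
  proof -
    have "q \<star> r \<star> h = q \<star> (h \<star> r)"
      using q(1) r hD(2) min_central_commute[OF P.ideal_axioms h r] by (simp add: R.m_assoc)
    also have "\<dots> = K c \<star> f \<star> r"
      using q r hD(2) by (simp add: R.m_assoc)
    finally show ?thesis
      using fD(1,2) c(1) r P0.I_l_closed P0.I_r_closed by simp
  qed
  then have "q \<in> P0 \<or> h \<in> P0"
    using Spec_elementwise[OF P0s(1) q(1) hD(2)] by blast
  \<comment> \<open>Comparing leading terms in \<open>c f = q h\<close> gives
    \<open>deg q + e \<le> d\<close> with \<open>e > 0\<close>, so \<open>q\<close> has degree below
    the minimal degree \<open>d\<close> of \<open>P0\<close>.\<close>
  moreover have "q \<notin> P0"
  proof
    assume "q \<in> P0"
    have "q \<noteq> \<zero>\<^bsub>R\<^esub>"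
    proof
      assume "q = \<zero>\<^bsub>R\<^esub>"
      then have "(K c \<star> f) d = \<zero>"
        using q(2) hD(2) by simp
      then show False
        using c fD(2,5) integral_iff by simp
    qed
    then obtain m where m: "q m \<noteq> \<zero>" "\<And>i. i > m \<Longrightarrow> q i = \<zero>"
      using carrier_top[OF q(1)] by blast
    have "(q \<star> h) (m + e) = q m \<otimes> (\<sigma> ^^ m) (h e)"
      using mult_top[OF q(1) hD(2), of m e] m(2) hD(6) by blast
    then have "c \<otimes> f (m + e) \<noteq> \<zero>"
      using fun_cong[OF q(2), of "m + e"] m(1) q(1) hD(2,5) c(1) fD(2) integral_iff by simp
    then have "m + e \<le> d"
      using fD(6)[of "m + e"] c(1) not_le by fastforce
    then have "q = \<zero>\<^bsub>R\<^esub>"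
      using hD(3) m(2) by (intro fD(9)[OF \<open>q \<in> P0\<close>]) auto
    then show False
      using \<open>q \<noteq> \<zero>\<^bsub>R\<^esub>\<close> by blast
  qed
  ultimately have "h \<in> P0"
    by blast
  have "P \<subseteq> P0"
  proof
    fix g assume g: "g \<in> P"
    then have gc: "g \<in> carrier R"
      using P.Icarr by blast
    obtain c q where c: "c \<in> carrier D" "c \<noteq> \<zero>" "\<sigma> c = c"
      and q: "q \<in> carrier R" "K c \<star> g = q \<star> h"
      by (rule min_central_division[OF P.ideal_axioms h g])
    have "K c \<in> P0 \<or> g \<in> P0"
    proof (rule Spec_elementwise[OF P0s(1) K_closed[OF c(1)] gc])
      fix r assume r: "r \<in> carrier R"
      have "K c \<star> r \<star> g = r \<star> (K c \<star> g)"
        by (simp only: K_fixed_commute[OF c(1,3) r] R.m_assoc[OF r K_closed[OF c(1)] gc])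
      then show "K c \<star> r \<star> g \<in> P0"
        using P0.I_l_closed[OF P0.I_l_closed[OF \<open>h \<in> P0\<close> q(1)] r] q(2) by simp
    qed
    moreover have "K c \<notin> P0"
      using contraction_trivialD[OF P0s(2) c(1)] c(2) by blast
    ultimately show "g \<in> P0"
      by blast
  qed
  then show ?thesis
    using sub by blast
qed

text \<open>Mixed inclusions are impossible. An extended prime has a nonzero contraction and cannot
  lie in a prime with zero contraction. Conversely, a zero prime inside \<open>CI \<pp>\<close>
  avoids \<open>y\<close>, whose coefficient 1 is outside \<open>\<pp>\<close>, and is then excluded
  by \<open>min_central_not_in_CI\<close>.\<close>

lemma primes_eq:
  assumes P: "P \<in> extended_primes \<union> zero_primes" and P0: "P0 \<in> extended_primes \<union> zero_primes"
    and sub: "P0 \<subseteq> P"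
  shows "P0 = P"
proof (cases "P \<in> zero_primes")
  case True
  have "P0 \<in> zero_primes"
  proof (rule ccontr)
    assume "P0 \<notin> zero_primes"
    then obtain \<pp> where p: "P0 = CI \<pp>" "sigma_prime_ideal \<pp> D \<sigma>" "\<pp> \<noteq> {\<zero>}"
      using P0 unfolding extended_primes_def by blast
    interpret p: ideal \<pp> D
      using p sigma_primeD by blast
    have "\<pp> \<subseteq> contraction P"
      using CI_contraction[OF p.ideal_axioms] sub unfolding p(1) contraction_def by blast
    then show False
      using True p(3) p.zero_closed unfolding zero_primes_iff by blast
  qed
  then show ?thesis
    using zero_primes_eq True sub by blast
next
  case False
  then obtain \<pp> where p: "P = CI \<pp>" "sigma_prime_ideal \<pp> D \<sigma>"
    using P unfolding extended_primes_def by blast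
  note pD = sigma_primeD[OF p(2)]
  show ?thesis
  proof (cases "P0 \<in> zero_primes")
    case True
    then have P0s: "P0 \<in> Spec R" "contraction P0 = {\<zero>}" "P0 \<noteq> {\<zero>\<^bsub>R\<^esub>}"
      unfolding zero_primes_iff by auto
    have "y \<notin> P0"
    proof
      assume "y \<in> P0"
      then have "\<one> \<in> \<pp>"
        using sub y_coeff(2) unfolding p(1) by (auto simp: CI_iff dest!: subsetD) metis
      then show False
        using pD(2,3) ideal.one_imp_carrier by blast
    qed
    then obtain f d where "min_central P0 f d"
      using min_central_exists[OF P0s] by blast
    then have False
      using min_central_not_in_CI[OF Spec_ideal[OF P0s(1)] _ P0s(1,2) pD(2,3)] sub p(1) by blast
    then show ?thesis
      by blast
  next
    case False
    then obtain \<pp>\<^sub>0 where p0: "P0 = CI \<pp>\<^sub>0" "sigma_prime_ideal \<pp>\<^sub>0 D \<sigma>" "\<pp>\<^sub>0 \<noteq> {\<zero>}"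
      using P0 unfolding extended_primes_def by blast
    have "\<pp>\<^sub>0 \<subseteq> \<pp>"
      using sub CI_contraction[OF pD(2)] CI_contraction[OF sigma_primeD(2)[OF p0(2)]]
      unfolding p(1) p0(1) contraction_def by blast
    then show ?thesis
      using sigma_prime_eq[OF p0(2,3) p(2)] p(1) p0(1) by blast
  qed
qed

theorem minimal_primes_eq: "minimal_primes R = extended_primes \<union> zero_primes"
proof
  show "minimal_primes R \<subseteq> extended_primes \<union> zero_primes"
  proof
    fix P assume "P \<in> minimal_primes R"
    then have P: "P \<in> Spec R" "P \<noteq> {\<zero>\<^bsub>R\<^esub>}" "\<not> (\<exists>P' \<in> Spec R. P' \<noteq> {\<zero>\<^bsub>R\<^esub>} \<and> P' \<subset> P)"
      unfolding minimal_primes_def by auto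
    obtain P0 where P0: "P0 \<in> extended_primes \<union> zero_primes" "P0 \<subseteq> P"
      by (rule prime_contains[OF P(1,2)])
    then show "P \<in> extended_primes \<union> zero_primes"
      using primes_Spec[OF P0(1)] P(3) by blast
  qed
  show "extended_primes \<union> zero_primes \<subseteq> minimal_primes R"
  proof
    fix P assume P: "P \<in> extended_primes \<union> zero_primes"
    have "\<not> P' \<subset> P" if P': "P' \<in> Spec R" "P' \<noteq> {\<zero>\<^bsub>R\<^esub>}" for P'
    proof
      assume "P' \<subset> P"
      obtain P0 where P0: "P0 \<in> extended_primes \<union> zero_primes" "P0 \<subseteq> P'"
        by (rule prime_contains[OF P'])
      then show False
        using primes_eq[OF P P0(1)] \<open>P' \<subset> P\<close> by blast
    qed
    then show "P \<in> minimal_primes R"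
      using primes_Spec[OF P] unfolding minimal_primes_def by blast
  qed
qed

end

subsection \<open>Invertible ideals\<close>

lemma (in monoid) inv_commute:
  assumes "a \<in> Units G" "c \<in> carrier G" "a \<otimes> c = c \<otimes> a"
  shows "inv a \<otimes> c = c \<otimes> inv a"
proof -
  have "inv a \<otimes> c = inv a \<otimes> (c \<otimes> a) \<otimes> inv a"
    using assms(1,2) Units_closed[OF assms(1)] by (simp add: m_assoc)
  also have "\<dots> = inv a \<otimes> (a \<otimes> c) \<otimes> inv a"
    by (simp only: assms(3))
  also have "\<dots> = c \<otimes> inv a"
    using assms(1,2) Units_closed[OF assms(1)] by (simp add: m_assoc[symmetric])
  finally show ?thesis .
qed

lemma (in ring) ideal_prod_lmult:
  assumes "x \<in> I \<cdot> J" "q \<in> carrier R" "I \<subseteq> carrier R" "J \<subseteq> carrier R"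
    and "\<And>i. i \<in> I \<Longrightarrow> q \<otimes> i \<in> I"
  shows "q \<otimes> x \<in> I \<cdot> J"
proof -
  have "x \<in> {x \<in> carrier R. q \<otimes> x \<in> I \<cdot> J}"
  proof (rule ideal_prod_closed[OF assms(1)])
    show "i \<otimes> j \<in> {x \<in> carrier R. q \<otimes> x \<in> I \<cdot> J}" if ij: "i \<in> I" "j \<in> J" for i j
    proof -
      have "i \<in> carrier R" "j \<in> carrier R"
        using ij assms(3,4) by auto
      then show ?thesis
        using ideal_prod.prod[OF assms(5)[OF ij(1)] ij(2), of R] assms(2) by (simp add: m_assoc)
    qed
  qed (use assms(2) in \<open>auto simp: r_distr intro: ideal_prod.sum\<close>)
  then show ?thesis
    by simp
qed

section \<open>Duals of ideals in the quotient division ring\<close>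

locale div_quotient = R: ring R + Q: ring Q for R and Q (structure) +
  fixes \<iota> :: "'a \<Rightarrow> 'c"
  assumes quotient: "quotient_division_ring R Q \<iota>"
begin

lemma \<iota>_hom: "\<iota> \<in> ring_hom R Q"
  using quotient unfolding quotient_division_ring_def by blast

lemma \<iota>_simps [simp]:
  "a \<in> carrier R \<Longrightarrow> \<iota> a \<in> carrier Q"
  "a \<in> carrier R \<Longrightarrow> b \<in> carrier R \<Longrightarrow> \<iota> (a \<oplus>\<^bsub>R\<^esub> b) = \<iota> a \<oplus> \<iota> b"
  "a \<in> carrier R \<Longrightarrow> b \<in> carrier R \<Longrightarrow> \<iota> (a \<otimes>\<^bsub>R\<^esub> b) = \<iota> a \<otimes> \<iota> b"
  "\<iota> \<one>\<^bsub>R\<^esub> = \<one>"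
  using \<iota>_hom by (auto simp: ring_hom_def)

lemma \<iota>_zero [simp]: "\<iota> \<zero>\<^bsub>R\<^esub> = \<zero>"
  using ring_hom_zero[OF \<iota>_hom R.ring_axioms Q.ring_axioms] .

lemma \<iota>_eq_iff: "a \<in> carrier R \<Longrightarrow> b \<in> carrier R \<Longrightarrow> \<iota> a = \<iota> b \<longleftrightarrow> a = b"
  using quotient unfolding quotient_division_ring_def by (auto dest: inj_onD)

lemma \<iota>_unit: "a \<in> carrier R \<Longrightarrow> a \<noteq> \<zero>\<^bsub>R\<^esub> \<Longrightarrow> \<iota> a \<in> Units Q"
  using quotient \<iota>_eq_iff[of a "\<zero>\<^bsub>R\<^esub>"] unfolding quotient_division_ring_def skew_field_def by auto

lemma \<iota>_image_add: "u \<in> \<iota> ` carrier R \<Longrightarrow> v \<in> \<iota> ` carrier R \<Longrightarrow> u \<oplus> v \<in> \<iota> ` carrier R"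
  by (metis (no_types, lifting) R.a_closed \<iota>_simps(2) image_iff)

text \<open>The candidate for the inverse. Both one-sided conditions are imposed at once, as the
  inverse has to work on both sides; any inverse bimodule of \<open>P\<close> is contained in
  it.\<close>

definition dual :: "'a set \<Rightarrow> 'c set" where
  "dual P = {z \<in> carrier Q. \<forall>g \<in> P. z \<otimes> \<iota> g \<in> \<iota> ` carrier R \<and> \<iota> g \<otimes> z \<in> \<iota> ` carrier R}"

lemma dualD:
  assumes "z \<in> dual P"
  shows "z \<in> carrier Q" "g \<in> P \<Longrightarrow> z \<otimes> \<iota> g \<in> \<iota> ` carrier R" "g \<in> P \<Longrightarrow> \<iota> g \<otimes> z \<in> \<iota> ` carrier R"
  using assms unfolding dual_def by auto

lemma dualI:
  assumes "z \<in> carrier Q" "\<And>g. g \<in> P \<Longrightarrow> z \<otimes> \<iota> g \<in> \<iota> ` carrier R"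
    and "\<And>g. g \<in> P \<Longrightarrow> \<iota> g \<otimes> z \<in> \<iota> ` carrier R"
  shows "z \<in> dual P"
  using assms unfolding dual_def by simp

lemma \<iota>_image_mult:
  assumes "r \<in> carrier R" "u \<in> \<iota> ` carrier R"
  shows "\<iota> r \<otimes> u \<in> \<iota> ` carrier R" "u \<otimes> \<iota> r \<in> \<iota> ` carrier R"
proof -
  obtain s where s: "s \<in> carrier R" "u = \<iota> s"
    using assms(2) by blast
  show "\<iota> r \<otimes> u \<in> \<iota> ` carrier R"
    using s assms(1) by (intro image_eqI[of _ _ "r \<otimes>\<^bsub>R\<^esub> s"]) auto
  show "u \<otimes> \<iota> r \<in> \<iota> ` carrier R"
    using s assms(1) by (intro image_eqI[of _ _ "s \<otimes>\<^bsub>R\<^esub> r"]) auto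
qed

lemma dual_subbimodule:
  assumes "ideal P R"
  shows "subbimodule (dual P) R Q \<iota>"
proof -
  interpret P: ideal P R by fact
  have mult: "\<iota> r \<otimes> z \<in> dual P" "z \<otimes> \<iota> r \<in> dual P" if r: "r \<in> carrier R" and z: "z \<in> dual P" for r z
  proof -
    note zD = dualD[OF z]
    show "\<iota> r \<otimes> z \<in> dual P"
    proof (rule dualI)
      fix g assume g: "g \<in> P"
      have "\<iota> r \<otimes> z \<otimes> \<iota> g = \<iota> r \<otimes> (z \<otimes> \<iota> g)"
        using r zD(1) P.Icarr[OF g] by (simp add: Q.m_assoc)
      then show "\<iota> r \<otimes> z \<otimes> \<iota> g \<in> \<iota> ` carrier R"
        using \<iota>_image_mult(1)[OF r zD(2)[OF g]] by simp
      have "\<iota> g \<otimes> (\<iota> r \<otimes> z) = \<iota> (g \<otimes>\<^bsub>R\<^esub> r) \<otimes> z"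
        using r zD(1) P.Icarr[OF g] by (simp add: Q.m_assoc)
      then show "\<iota> g \<otimes> (\<iota> r \<otimes> z) \<in> \<iota> ` carrier R"
        using zD(3)[OF P.I_r_closed[OF g r]] by simp
    qed (use r zD(1) in simp)
    show "z \<otimes> \<iota> r \<in> dual P"
    proof (rule dualI)
      fix g assume g: "g \<in> P"
      have "\<iota> g \<otimes> (z \<otimes> \<iota> r) = \<iota> g \<otimes> z \<otimes> \<iota> r"
        using r zD(1) P.Icarr[OF g] by (simp add: Q.m_assoc)
      then show "\<iota> g \<otimes> (z \<otimes> \<iota> r) \<in> \<iota> ` carrier R"
        using \<iota>_image_mult(2)[OF r zD(3)[OF g]] by simp
      have "z \<otimes> \<iota> r \<otimes> \<iota> g = z \<otimes> \<iota> (r \<otimes>\<^bsub>R\<^esub> g)"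
        using r zD(1) P.Icarr[OF g] by (simp add: Q.m_assoc)
      then show "z \<otimes> \<iota> r \<otimes> \<iota> g \<in> \<iota> ` carrier R"
        using zD(2)[OF P.I_l_closed[OF g r]] by simp
    qed (use r zD(1) in simp)
  qed
  have "subgroup (dual P) (add_monoid Q)"
  proof (rule Q.add.subgroupI)
    show "dual P \<subseteq> carrier Q"
      using dualD(1) by blast
    have "\<zero> \<in> dual P"
      using P.Icarr by (intro dualI) (auto intro!: image_eqI[of _ _ "\<zero>\<^bsub>R\<^esub>"])
    then show "dual P \<noteq> {}"
      by blast
    show "\<ominus> z \<in> dual P" if z: "z \<in> dual P" for z
    proof -
      have "\<iota> (\<ominus>\<^bsub>R\<^esub> \<one>\<^bsub>R\<^esub>) = \<ominus> \<one>"
        using \<iota>_simps(2)[of "\<ominus>\<^bsub>R\<^esub> \<one>\<^bsub>R\<^esub>" "\<one>\<^bsub>R\<^esub>"]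
        by (intro Q.minus_equality[symmetric]) (auto simp: R.l_neg)
      then have "\<ominus> z = \<iota> (\<ominus>\<^bsub>R\<^esub> \<one>\<^bsub>R\<^esub>) \<otimes> z"
        using dualD(1)[OF z] by (simp add: Q.l_minus)
      then show ?thesis
        using mult(1)[OF _ z, of "\<ominus>\<^bsub>R\<^esub> \<one>\<^bsub>R\<^esub>"] by simp
    qed
    show "z \<oplus> w \<in> dual P" if z: "z \<in> dual P" and w: "w \<in> dual P" for z w
    proof (rule dualI)
      fix g assume g: "g \<in> P"
      have "(z \<oplus> w) \<otimes> \<iota> g = z \<otimes> \<iota> g \<oplus> w \<otimes> \<iota> g"
        using dualD(1)[OF z] dualD(1)[OF w] P.Icarr[OF g] by (simp add: Q.l_distr)
      then show "(z \<oplus> w) \<otimes> \<iota> g \<in> \<iota> ` carrier R"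
        using \<iota>_image_add[OF dualD(2)[OF z g] dualD(2)[OF w g]] by simp
      have "\<iota> g \<otimes> (z \<oplus> w) = \<iota> g \<otimes> z \<oplus> \<iota> g \<otimes> w"
        using dualD(1)[OF z] dualD(1)[OF w] P.Icarr[OF g] by (simp add: Q.r_distr)
      then show "\<iota> g \<otimes> (z \<oplus> w) \<in> \<iota> ` carrier R"
        using \<iota>_image_add[OF dualD(3)[OF z g] dualD(3)[OF w g]] by simp
    qed (use dualD(1)[OF z] dualD(1)[OF w] in simp)
  qed
  then show ?thesis
    unfolding subbimodule_def using mult additive_subgroupI by blast
qed

text \<open>Both products lie in the image of \<open>R\<close> and are closed under left
  multiplication by it, so containing 1 is enough.\<close>

lemma invertible_idealI:
  assumes P: "ideal P R"
    and right: "\<one> \<in> (\<iota> ` P) \<cdot> dual P" and left: "\<one> \<in> dual P \<cdot> (\<iota> ` P)"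
  shows "invertible_ideal P R Q \<iota>"
proof -
  interpret P: ideal P R by fact
  note bi = dual_subbimodule[OF P]
  have \<iota>P: "\<iota> ` P \<subseteq> carrier Q" and dP: "dual P \<subseteq> carrier Q"
    using P.Icarr dualD(1) by auto
  have "(\<iota> ` P) \<cdot> dual P \<subseteq> \<iota> ` carrier R"
  proof
    fix x assume "x \<in> (\<iota> ` P) \<cdot> dual P"
    then show "x \<in> \<iota> ` carrier R"
    proof (rule ideal_prod_closed)
      show "i \<otimes> z \<in> \<iota> ` carrier R" if "i \<in> \<iota> ` P" "z \<in> dual P" for i z
        using that(1) dualD(3)[OF that(2)] by auto
    qed (rule \<iota>_image_add)
  qed
  moreover have "dual P \<cdot> (\<iota> ` P) \<subseteq> \<iota> ` carrier R"
  proof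
    fix x assume "x \<in> dual P \<cdot> (\<iota> ` P)"
    then show "x \<in> \<iota> ` carrier R"
    proof (rule ideal_prod_closed)
      show "z \<otimes> i \<in> \<iota> ` carrier R" if "z \<in> dual P" "i \<in> \<iota> ` P" for i z
        using that(2) dualD(2)[OF that(1)] by auto
    qed (rule \<iota>_image_add)
  qed
  moreover have "\<iota> r \<in> (\<iota> ` P) \<cdot> dual P" if r: "r \<in> carrier R" for r
  proof -
    have "\<iota> r \<otimes> i \<in> \<iota> ` P" if i: "i \<in> \<iota> ` P" for i
    proof -
      obtain p where p: "p \<in> P" "i = \<iota> p"
        using i by blast
      then show ?thesis
        using r P.Icarr[OF p(1)] P.I_l_closed[OF p(1) r] by (intro image_eqI[of _ _ "r \<otimes>\<^bsub>R\<^esub> p"]) auto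
    qed
    then show ?thesis
      using Q.ideal_prod_lmult[OF right _ \<iota>P dP, of "\<iota> r"] r by simp
  qed
  moreover have "\<iota> r \<in> dual P \<cdot> (\<iota> ` P)" if r: "r \<in> carrier R" for r
  proof -
    have "\<iota> r \<otimes> i \<in> dual P" if "i \<in> dual P" for i
      using bi r that unfolding subbimodule_def by blast
    then show ?thesis
      using Q.ideal_prod_lmult[OF left _ dP \<iota>P, of "\<iota> r"] r by simp
  qed
  ultimately have "(\<iota> ` P) \<cdot> dual P = \<iota> ` carrier R" "dual P \<cdot> (\<iota> ` P) = \<iota> ` carrier R"
    by blast+
  then show ?thesis
    using bi unfolding invertible_ideal_def by blast
qed

lemma invertible_primes_eq:
  assumes P: "P \<in> Spec R" "invertible_ideal P R Q \<iota>"
    and P0: "P0 \<in> Spec R" "invertible_ideal P0 R Q \<iota>" and sub: "P0 \<subseteq> P"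
  shows "P0 = P"
proof (rule ccontr)
  assume "P0 \<noteq> P"
  interpret P: ideal P R
    using Spec_ideal[OF P(1)] .
  interpret P0: ideal P0 R
    using Spec_ideal[OF P0(1)] .
  obtain P' where P': "subbimodule P' R Q \<iota>"
    and PP': "(\<iota> ` P) \<cdot> P' = \<iota> ` carrier R" and P'P: "P' \<cdot> (\<iota> ` P) = \<iota> ` carrier R"
    using P(2) unfolding invertible_ideal_def by blast
  obtain P0' where P0': "subbimodule P0' R Q \<iota>"
    and PP0': "(\<iota> ` P0) \<cdot> P0' = \<iota> ` carrier R"
    using P0(2) unfolding invertible_ideal_def by blast
  have P'c: "z \<in> carrier Q" if "z \<in> P'" for z
    using P' that additive_subgroup.a_subset unfolding subbimodule_def by blast
  have P0'c: "z \<in> carrier Q" if "z \<in> P0'" for z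
    using P0' that additive_subgroup.a_subset unfolding subbimodule_def by blast
  have zg: "z \<otimes> \<iota> g \<in> \<iota> ` carrier R" if "z \<in> P'" "g \<in> P" for z g
    using ideal_prod.prod[of z P' "\<iota> g" "\<iota> ` P" Q] that P'P by blast
  have gz: "\<iota> g \<otimes> z \<in> \<iota> ` carrier R" if "z \<in> P'" "g \<in> P" for z g
    using ideal_prod.prod[of "\<iota> g" "\<iota> ` P" z P' Q] that PP' by blast
  \<comment> \<open>A two-sided ideal that takes the place of \<open>P^-1 P0\<close>: it satisfies
    \<open>P N \<subseteq> P0\<close>, so primeness of \<open>P0\<close> yields
    \<open>N \<subseteq> P0\<close>.\<close>
  define N where "N = {r \<in> carrier R. \<forall>p \<in> P. p \<otimes>\<^bsub>R\<^esub> r \<in> P0}"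
  have NI: "r \<in> N" if "r \<in> carrier R" "\<And>p. p \<in> P \<Longrightarrow> p \<otimes>\<^bsub>R\<^esub> r \<in> P0" for r
    using that unfolding N_def by simp
  have N: "ideal N R"
    unfolding N_def by (rule R.right_colon_ideal[OF P.ideal_axioms P0.ideal_axioms])
  have "P \<cdot>\<^bsub>R\<^esub> N \<subseteq> P0"
  proof
    fix x assume "x \<in> P \<cdot>\<^bsub>R\<^esub> N"
    then show "x \<in> P0"
      by (rule ideal_prod_closed) (auto simp: N_def)
  qed
  then have "P \<subseteq> P0 \<or> N \<subseteq> P0"
    using P0(1) P.ideal_axioms N unfolding Spec_def by blast
  then have NP0: "N \<subseteq> P0"
    using sub \<open>P0 \<noteq> P\<close> by blast
  have zP0: "z \<otimes> \<iota> g \<in> \<iota> ` P0" if z: "z \<in> P'" and g: "g \<in> P0" for z g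
  proof -
    obtain r where r: "r \<in> carrier R" "z \<otimes> \<iota> g = \<iota> r"
      using zg[OF z subsetD[OF sub g]] by blast
    have "r \<in> N"
    proof (rule NI[OF r(1)])
      fix p assume p: "p \<in> P"
      obtain s where s: "s \<in> carrier R" "\<iota> p \<otimes> z = \<iota> s"
        using gz[OF z p] by blast
      have "\<iota> (p \<otimes>\<^bsub>R\<^esub> r) = \<iota> p \<otimes> (z \<otimes> \<iota> g)"
        using r P.Icarr[OF p] by simp
      also have "\<dots> = \<iota> (s \<otimes>\<^bsub>R\<^esub> g)"
        using s P'c[OF z] P.Icarr[OF p] P0.Icarr[OF g] by (simp flip: Q.m_assoc)
      finally have "p \<otimes>\<^bsub>R\<^esub> r = s \<otimes>\<^bsub>R\<^esub> g"
        using \<iota>_eq_iff[of "p \<otimes>\<^bsub>R\<^esub> r" "s \<otimes>\<^bsub>R\<^esub> g"] r(1) s(1) P.Icarr[OF p] P0.Icarr[OF g] by simp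
      then show "p \<otimes>\<^bsub>R\<^esub> r \<in> P0"
        using P0.I_l_closed[OF g s(1)] by simp
    qed
    then show ?thesis
      using NP0 r(2) by auto
  qed
  \<comment> \<open>Write 1 as a sum of products from \<open>P0\<close> and \<open>P0'\<close>. As
    \<open>z P0 \<subseteq> P0\<close>, multiplying by \<open>z\<close> stays inside
    \<open>P0 P0' = R\<close>.\<close>
  have P'R: "z \<in> \<iota> ` carrier R" if z: "z \<in> P'" for z
  proof -
    have "\<one> \<in> (\<iota> ` P0) \<cdot> P0'"
      unfolding PP0' by (rule image_eqI[of _ _ "\<one>\<^bsub>R\<^esub>"]) auto
    then have "\<one> \<in> {w \<in> carrier Q. z \<otimes> w \<in> \<iota> ` carrier R}"
    proof (rule ideal_prod_closed)
      fix i j assume i: "i \<in> \<iota> ` P0" and j: "j \<in> P0'"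
      obtain g where g: "g \<in> P0" "i = \<iota> g"
        using i by blast
      have "z \<otimes> i \<otimes> j \<in> (\<iota> ` P0) \<cdot> P0'"
        using ideal_prod.prod[OF zP0[OF z g(1)] j] unfolding g(2) .
      then show "i \<otimes> j \<in> {w \<in> carrier Q. z \<otimes> w \<in> \<iota> ` carrier R}"
        using P'c[OF z] P0'c[OF j] P0.Icarr[OF g(1)] unfolding PP0' g(2) by (simp add: Q.m_assoc)
    next
      fix u v assume "u \<in> {w \<in> carrier Q. z \<otimes> w \<in> \<iota> ` carrier R}" "v \<in> {w \<in> carrier Q. z \<otimes> w \<in> \<iota> ` carrier R}"
      then show "u \<oplus> v \<in> {w \<in> carrier Q. z \<otimes> w \<in> \<iota> ` carrier R}"
        using P'c[OF z] \<iota>_image_add[of "z \<otimes> u" "z \<otimes> v"] by (simp add: Q.r_distr)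
    qed
    then show ?thesis
      using P'c[OF z] by simp
  qed
  \<comment> \<open>Once \<open>P' \<subseteq> R\<close>, the product \<open>P' P = R\<close> is
    contained in \<open>P\<close>, so \<open>P\<close> is not proper.\<close>
  have "\<one> \<in> P' \<cdot> (\<iota> ` P)"
    unfolding P'P by (rule image_eqI[of _ _ "\<one>\<^bsub>R\<^esub>"]) auto
  then have "\<one> \<in> \<iota> ` P"
  proof (rule ideal_prod_closed)
    fix z i assume z: "z \<in> P'" and i: "i \<in> \<iota> ` P"
    obtain r where r: "r \<in> carrier R" "z = \<iota> r"
      using P'R[OF z] by blast
    obtain g where g: "g \<in> P" "i = \<iota> g"
      using i by blast
    show "z \<otimes> i \<in> \<iota> ` P"
      using r g P.Icarr[OF g(1)] P.I_l_closed[OF g(1) r(1)] by (intro image_eqI[of _ _ "r \<otimes>\<^bsub>R\<^esub> g"]) auto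
  next
    fix u v assume u: "u \<in> \<iota> ` P" and v: "v \<in> \<iota> ` P"
    obtain a where a: "a \<in> P" "u = \<iota> a"
      using u by blast
    obtain b where b: "b \<in> P" "v = \<iota> b"
      using v by blast
    show "u \<oplus> v \<in> \<iota> ` P"
      using a b P.Icarr by (intro image_eqI[of _ _ "a \<oplus>\<^bsub>R\<^esub> b"]) auto
  qed
  then obtain g where g: "g \<in> P" "\<iota> g = \<iota> \<one>\<^bsub>R\<^esub>"
    by auto
  then have "\<one>\<^bsub>R\<^esub> \<in> P"
    using \<iota>_eq_iff[of g "\<one>\<^bsub>R\<^esub>"] P.Icarr by auto
  then show False
    using Spec_one_notin[OF P(1)] by blast
qed

end

section \<open>Invertibility of the minimal primes of \<open>D[y; \<sigma>]\<close>\<close>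

locale skew_poly_quotient = skew_poly D \<sigma> + q: div_quotient "ore_extension D \<sigma> (\<lambda>_. \<zero>)" Q \<iota>
  for D (structure) and \<sigma> and Q and \<iota>
begin

abbreviation quot_mult (infixl \<open>\<bullet>\<close> 70) where "u \<bullet> v \<equiv> u \<otimes>\<^bsub>Q\<^esub> v"

text \<open>
  Writing \<open>c = \<Sum> i j\<close> with \<open>i \<in> I\<close>, \<open>j \<in> I'\<close>, it suffices to split each \<open>i j c\<^sup>-\<^sup>1\<close> into a product of an
  element of \<open>P\<close> and one of its dual.
\<close>
lemma invertible_if_splits:
  assumes P: "ideal P R" and I: "ideal I D" and pair: "inverse_pair I I' c"
    and split: "\<And>i j. i \<in> I \<Longrightarrow> j \<in> I' \<Longrightarrow> \<exists>g \<in> P. \<exists>z \<in> q.dual P.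
      \<iota> (K (i \<otimes> j)) \<bullet> inv\<^bsub>Q\<^esub> \<iota> (K c) = \<iota> g \<bullet> z \<and> \<iota> (K (i \<otimes> j)) \<bullet> inv\<^bsub>Q\<^esub> \<iota> (K c) = z \<bullet> \<iota> g"
  shows "invertible_ideal P R Q \<iota>"
proof -
  have c: "c \<in> carrier D" "c \<noteq> \<zero>" "c \<in> I \<cdot> I'" and I': "ideal I' D"
    using pair unfolding inverse_pair_def by auto
  let ?ic = "inv\<^bsub>Q\<^esub> \<iota> (K c)"
  have unit: "\<iota> (K c) \<in> Units Q"
    using q.\<iota>_unit[of "K c"] c K_eq_zero by simp
  \<comment> \<open>For \<open>w = c\<close> membership means that \<open>M\<close> contains 1,
    which is what \<open>q.invertible_idealI\<close> asks for.\<close>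
  let ?A = "\<lambda>M. {w \<in> carrier D. \<iota> (K w) \<bullet> ?ic \<in> M}"
  have add: "u \<oplus> v \<in> ?A (A \<cdot>\<^bsub>Q\<^esub> B)" if "u \<in> ?A (A \<cdot>\<^bsub>Q\<^esub> B)" "v \<in> ?A (A \<cdot>\<^bsub>Q\<^esub> B)" for u v A B
    using that unit ideal_prod.sum[of "\<iota> (K u) \<bullet> ?ic" Q A B "\<iota> (K v) \<bullet> ?ic"]
    by (simp add: K_add q.Q.l_distr)
  have in_A: "i \<otimes> j \<in> ?A ((\<iota> ` P) \<cdot>\<^bsub>Q\<^esub> q.dual P)" "i \<otimes> j \<in> ?A (q.dual P \<cdot>\<^bsub>Q\<^esub> (\<iota> ` P))"
    if ij: "i \<in> I" "j \<in> I'" for i j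
  proof -
    obtain g z where gz: "g \<in> P" "z \<in> q.dual P"
      "\<iota> (K (i \<otimes> j)) \<bullet> ?ic = \<iota> g \<bullet> z" "\<iota> (K (i \<otimes> j)) \<bullet> ?ic = z \<bullet> \<iota> g"
      using split[OF ij] by blast
    show "i \<otimes> j \<in> ?A ((\<iota> ` P) \<cdot>\<^bsub>Q\<^esub> q.dual P)"
      using ideal_prod.prod[OF imageI[OF gz(1), of \<iota>] gz(2), of Q] gz(3)
        ideal.Icarr[OF I ij(1)] ideal.Icarr[OF I' ij(2)] by simp
    show "i \<otimes> j \<in> ?A (q.dual P \<cdot>\<^bsub>Q\<^esub> (\<iota> ` P))"
      using ideal_prod.prod[OF gz(2) imageI[OF gz(1), of \<iota>], of Q] gz(4)
        ideal.Icarr[OF I ij(1)] ideal.Icarr[OF I' ij(2)] by simp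
  qed
  have "c \<in> ?A ((\<iota> ` P) \<cdot>\<^bsub>Q\<^esub> q.dual P)" "c \<in> ?A (q.dual P \<cdot>\<^bsub>Q\<^esub> (\<iota> ` P))"
    by (rule ideal_prod_closed[OF c(3) in_A(1) add], assumption+)
      (rule ideal_prod_closed[OF c(3) in_A(2) add], assumption+)
  then show ?thesis
    using unit by (intro q.invertible_idealI[OF P]) simp_all
qed

text \<open>The elements \<open>c^-1 v\<close> with \<open>v\<close> in \<open>p'\<close> represent
  \<open>\<pp>^-1\<close>. They multiply \<open>CI \<pp>\<close> into \<open>R\<close> from both
  sides; from the right the twists occur, and \<sigma>-stability of \<open>\<pp>\<close> absorbs
  them.\<close>

lemma CI_invertible:
  assumes p: "sigma_ideal \<pp> D \<sigma>" "\<pp> \<noteq> {\<zero>}"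
  shows "invertible_ideal (CI \<pp>) R Q \<iota>"
proof -
  interpret p: ideal \<pp> D
    using p(1) unfolding sigma_ideal_def by blast
  obtain p' c where pair: "inverse_pair \<pp> p' c"
    using nonzero_ideal_invertible[OF p.ideal_axioms p(2)] by blast
  interpret p': ideal p' D
    using pair unfolding inverse_pair_def by blast
  have c: "c \<in> carrier D" "c \<noteq> \<zero>" "c \<in> \<pp> \<cdot> p'"
    and cdvd: "\<And>i j. i \<in> \<pp> \<Longrightarrow> j \<in> p' \<Longrightarrow> \<exists>b \<in> carrier D. i \<otimes> j = c \<otimes> b"
    using pair unfolding inverse_pair_def factor_def by auto
  define ic where "ic = inv\<^bsub>Q\<^esub> \<iota> (K c)"
  have unit: "\<iota> (K c) \<in> Units Q"
    using q.\<iota>_unit[of "K c"] c K_eq_zero by simp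
  have ic: "ic \<in> carrier Q" "ic \<bullet> \<iota> (K c) = \<one>\<^bsub>Q\<^esub>" "\<iota> (K c) \<bullet> ic = \<one>\<^bsub>Q\<^esub>"
    using unit unfolding ic_def by auto
  have comm: "ic \<bullet> \<iota> (K a) = \<iota> (K a) \<bullet> ic" if a: "a \<in> carrier D" for a
  proof -
    have "K c \<star> K a = K a \<star> K c"
      using a c(1) m_comm[of a c] by (simp flip: K_times)
    then have "\<iota> (K c) \<bullet> \<iota> (K a) = \<iota> (K a) \<bullet> \<iota> (K c)"
      using a c(1) by (simp flip: q.\<iota>_simps(3))
    then show ?thesis
      using q.Q.inv_commute[OF unit] a unfolding ic_def by simp
  qed
  have dual: "ic \<bullet> \<iota> (K v) \<in> q.dual (CI \<pp>)" if v: "v \<in> p'" for v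
  proof (rule q.dualI)
    have vc: "v \<in> carrier D"
      using v p'.Icarr by blast
    then show "ic \<bullet> \<iota> (K v) \<in> carrier Q"
      using ic(1) by simp
    fix g assume "g \<in> CI \<pp>"
    then have g: "g \<in> carrier R" "\<And>n. g n \<in> \<pp>"
      unfolding CI_iff by auto
    obtain k where k: "\<And>m. m \<ge> k \<Longrightarrow> g m = \<zero>"
      using carrier_bounded[OF g(1)] by blast
    \<comment> \<open>Coefficientwise quotients again have finite support. The exponent
      \<open>s n\<close> is 0 for multiplication from the left and \<open>n\<close> from the right,
      where the factor has to pass \<open>y^n\<close>.\<close>
    have quot: "h \<in> carrier R"
      if h: "\<And>n. h n \<in> carrier D" "\<And>n. g n \<otimes> (\<sigma> ^^ s n) v = h n \<otimes> (\<sigma> ^^ s n) c" for h s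
    proof -
      have "h m = \<zero>" if "m \<ge> k" for m
      proof -
        have "h m \<otimes> (\<sigma> ^^ s m) c = \<zero>"
          using h(2)[of m, symmetric] k[OF that] vc by simp
        then show ?thesis
          using h(1)[of m] c integral_iff[of "h m" "(\<sigma> ^^ s m) c"] by simp
      qed
      then show ?thesis
        using upI[of h k] h(1) by (simp add: R_simps(1))
    qed
    show "ic \<bullet> \<iota> (K v) \<bullet> \<iota> g \<in> \<iota> ` carrier R"
    proof -
      obtain h where h: "\<And>n. h n \<in> carrier D" "\<And>n. g n \<otimes> v = c \<otimes> h n"
        using cdvd[OF g(2) v] by metis
      then have hc: "h \<in> carrier R"
        using quot[of h "\<lambda>_. 0"] c(1) by (simp add: m_comm)
      have "K v \<star> g = K c \<star> h"
        using vc g(1) c(1) hc h(2) by (intro ext) (simp add: m_comm)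
      then have "\<iota> (K v) \<bullet> \<iota> g = \<iota> (K c) \<bullet> \<iota> h"
        using vc g(1) c(1) hc by (simp flip: q.\<iota>_simps(3))
      then have "ic \<bullet> \<iota> (K v) \<bullet> \<iota> g = ic \<bullet> \<iota> (K c) \<bullet> \<iota> h"
        using ic(1) vc g(1) c(1) hc by (simp add: q.Q.m_assoc)
      then show ?thesis
        using ic(2) hc by simp
    qed
    show "\<iota> g \<bullet> (ic \<bullet> \<iota> (K v)) \<in> \<iota> ` carrier R"
    proof -
      \<comment> \<open>Pull the twist out: \<open>g_n = \<sigma>^n(\<tau>^n(g_n))\<close> with
        \<open>\<tau>^n(g_n)\<close> still in \<open>\<pp>\<close>, so the quotient is
        \<open>\<sigma>^n\<close> of an element of \<open>D\<close>.\<close>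
      have "\<exists>b. b \<in> carrier D \<and> g n \<otimes> (\<sigma> ^^ n) v = b \<otimes> (\<sigma> ^^ n) c" for n
      proof -
        have \<tau>: "(\<tau> ^^ n) x \<in> \<pp> \<and> (\<sigma> ^^ n) ((\<tau> ^^ n) x) = x" if "x \<in> \<pp>" for x
        proof (induction n)
          case (Suc n)
          then have "\<tau> ((\<tau> ^^ n) x) \<in> \<pp>" "\<sigma> (\<tau> ((\<tau> ^^ n) x)) = (\<tau> ^^ n) x"
            using sigma_ideal_\<tau>[OF p(1)] p.Icarr by auto
          then show ?case
            using Suc by (simp add: funpow_swap1[of \<sigma> n])
        qed (use that in simp)
        obtain b where b: "b \<in> carrier D" "(\<tau> ^^ n) (g n) \<otimes> v = c \<otimes> b"
          using cdvd[of "(\<tau> ^^ n) (g n)" v] \<tau>[OF g(2)] v by blast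
        have "(\<sigma> ^^ n) ((\<tau> ^^ n) (g n) \<otimes> v) = g n \<otimes> (\<sigma> ^^ n) v"
          using \<tau>[OF g(2)] vc p.Icarr by (simp add: \<sigma>_pow_mult)
        then have "g n \<otimes> (\<sigma> ^^ n) v = (\<sigma> ^^ n) b \<otimes> (\<sigma> ^^ n) c"
          unfolding b(2) using b(1) c(1) by (simp add: \<sigma>_pow_mult m_comm)
        then show ?thesis
          using b(1) by (intro exI[of _ "(\<sigma> ^^ n) b"]) simp
      qed
      then obtain h where h: "\<And>n. h n \<in> carrier D" "\<And>n. g n \<otimes> (\<sigma> ^^ n) v = h n \<otimes> (\<sigma> ^^ n) c"
        by metis
      then have hc: "h \<in> carrier R"
        using quot[of h "\<lambda>n. n"] by simp
      have "g \<star> K v = h \<star> K c"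
        using vc g(1) c(1) hc h(2) by (intro ext) simp
      then have eq: "\<iota> g \<bullet> \<iota> (K v) = \<iota> h \<bullet> \<iota> (K c)"
        using vc g(1) c(1) hc by (simp flip: q.\<iota>_simps(3))
      have "\<iota> g \<bullet> (ic \<bullet> \<iota> (K v)) = \<iota> g \<bullet> \<iota> (K v) \<bullet> ic"
        unfolding comm[OF vc] using ic(1) vc g(1) by (simp add: q.Q.m_assoc)
      also have "\<dots> = \<iota> h"
        unfolding eq using ic(1,3) c(1) hc by (simp add: q.Q.m_assoc)
      finally show ?thesis
        using hc by simp
    qed
  qed
  show ?thesis
  proof (rule invertible_if_splits[OF CI_ideal[OF p(1)] p.ideal_axioms pair])
    fix i j assume ij: "i \<in> \<pp>" "j \<in> p'"
    have ijc: "i \<in> carrier D" "j \<in> carrier D"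
      using ij p.Icarr p'.Icarr by auto
    have "\<iota> (K (i \<otimes> j)) \<bullet> ic = \<iota> (K i) \<bullet> (ic \<bullet> \<iota> (K j))"
      unfolding comm[OF ijc(2)] using ijc ic(1) by (simp add: K_times q.Q.m_assoc)
    moreover have "\<iota> (K (i \<otimes> j)) \<bullet> ic = ic \<bullet> \<iota> (K j) \<bullet> \<iota> (K i)"
    proof -
      have "\<iota> (K (i \<otimes> j)) \<bullet> ic = ic \<bullet> \<iota> (K (j \<otimes> i))"
        using comm[of "j \<otimes> i"] ijc m_comm[of i j] by simp
      then show ?thesis
        using ijc ic(1) by (simp add: K_times q.Q.m_assoc)
    qed
    moreover have "K i \<in> CI \<pp>"
      using ij(1) CI_K[OF p.ideal_axioms] ijc(1) by simp
    ultimately show "\<exists>g \<in> CI \<pp>. \<exists>z \<in> q.dual (CI \<pp>). \<iota> (K (i \<otimes> j)) \<bullet> inv\<^bsub>Q\<^esub> \<iota> (K c) = \<iota> g \<bullet> z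
        \<and> \<iota> (K (i \<otimes> j)) \<bullet> inv\<^bsub>Q\<^esub> \<iota> (K c) = z \<bullet> \<iota> g"
      using dual[OF ij(2)] unfolding ic_def by blast
  qed
qed

lemma Y_invertible: "invertible_ideal Y R Q \<iota>"
proof -
  have "y \<noteq> \<zero>\<^bsub>R\<^esub>"
    using y_coeff(2) zero_coeff[of "Suc 0"] one_not_zero by metis
  then have unit: "\<iota> y \<in> Units Q"
    using q.\<iota>_unit[of y] by simp
  define iy where "iy = inv\<^bsub>Q\<^esub> \<iota> y"
  have iy: "iy \<in> carrier Q" "iy \<bullet> \<iota> y = \<one>\<^bsub>Q\<^esub>" "\<iota> y \<bullet> iy = \<one>\<^bsub>Q\<^esub>"
    using unit unfolding iy_def by auto
  have dual: "iy \<in> q.dual Y"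
  proof (rule q.dualI[OF iy(1)])
    fix g assume "g \<in> Y"
    then obtain s t where st: "s \<in> carrier R" "g = s \<star> y" "t \<in> carrier R" "g = y \<star> t"
      by (rule Y_decomp)
    have "iy \<bullet> \<iota> g = \<iota> t"
      unfolding st(4) using st(3) iy by (simp flip: q.Q.m_assoc)
    then show "iy \<bullet> \<iota> g \<in> \<iota> ` carrier R"
      using st(3) by simp
    have "\<iota> g \<bullet> iy = \<iota> s"
      unfolding st(2) using st(1) iy by (simp add: q.Q.m_assoc)
    then show "\<iota> g \<bullet> iy \<in> \<iota> ` carrier R"
      using st(1) by simp
  qed
  have "\<iota> y \<in> \<iota> ` Y"
    using y_in_Y by blast
  then show ?thesis
    using ideal_prod.prod[OF _ dual, of "\<iota> y" "\<iota> ` Y" Q] ideal_prod.prod[OF dual, of "\<iota> y" "\<iota> ` Y" Q] iy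
    by (intro q.invertible_idealI Spec_ideal[OF Y_Spec]) auto
qed

text \<open>The factors are \<open>F = (v/e) f\<close> in \<open>P\<close>, from
  \<open>min_central_scaled\<close>, and \<open>f^-1 j\<close> with \<open>j\<close> in
  \<open>c(f)\<close>; their product in either order is \<open>j v / e\<close>. That
  \<open>f^-1 j\<close> lies in the dual is \<open>min_central_Gauss\<close>: multiplying an element
  of \<open>P\<close> by \<open>j\<close> brings its coefficients into \<open>c(f)\<close> and makes
  it a multiple of \<open>f\<close>.\<close>

lemma min_central_invertible:
  assumes P: "P \<in> Spec R" "contraction P = {\<zero>}" and f: "min_central P f d"
  shows "invertible_ideal P R Q \<iota>"
proof -
  interpret P: ideal P R
    using Spec_ideal[OF P(1)] .
  note fD = min_centralD[OF P.ideal_axioms f]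
  note f_comm = min_central_commute[OF P.ideal_axioms f]
  note gauss' = min_central_Gauss[OF P.ideal_axioms f]
  note f_in = min_central_in_content[OF P.ideal_axioms f]
  let ?J = "Idl (range f)"
  have Js: "sigma_ideal ?J D \<sigma>"
    by (rule min_central_content_sigma_ideal[OF P.ideal_axioms f])
  interpret J: ideal ?J D
    using Js unfolding sigma_ideal_def by blast
  have "?J \<noteq> {\<zero>}"
    using f_in[of 0] fD(4) by auto
  then obtain J' e where pair: "inverse_pair ?J J' e"
    using nonzero_ideal_invertible[OF J.ideal_axioms] by blast
  interpret J': ideal J' D
    using pair unfolding inverse_pair_def by blast
  have e: "e \<in> carrier D" "e \<noteq> \<zero>" "e \<in> ?J \<cdot> J'"
    and edvd: "\<And>i j. i \<in> ?J \<Longrightarrow> j \<in> J' \<Longrightarrow> \<exists>b \<in> carrier D. i \<otimes> j = e \<otimes> b"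
    using pair unfolding inverse_pair_def factor_def by auto
  define ie where "ie = inv\<^bsub>Q\<^esub> \<iota> (K e)"
  define if' where "if' = inv\<^bsub>Q\<^esub> \<iota> f"
  have "f \<noteq> \<zero>\<^bsub>R\<^esub>"
    using fD(4) zero_coeff[of 0] by metis
  then have unit: "\<iota> (K e) \<in> Units Q" "\<iota> f \<in> Units Q"
    using q.\<iota>_unit[of "K e"] q.\<iota>_unit[of f] e fD(2) K_eq_zero by auto
  have ie: "ie \<in> carrier Q" "ie \<bullet> \<iota> (K e) = \<one>\<^bsub>Q\<^esub>" "\<iota> (K e) \<bullet> ie = \<one>\<^bsub>Q\<^esub>"
    and if': "if' \<in> carrier Q" "if' \<bullet> \<iota> f = \<one>\<^bsub>Q\<^esub>" "\<iota> f \<bullet> if' = \<one>\<^bsub>Q\<^esub>"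
    using unit unfolding ie_def if'_def by auto
  have if_comm: "if' \<bullet> \<iota> g = \<iota> g \<bullet> if'" if g: "g \<in> carrier R" for g
    using q.Q.inv_commute[OF unit(2), of "\<iota> g"] f_comm[OF g] g fD(2)
    unfolding if'_def by (simp flip: q.\<iota>_simps(3))
  have f_ie: "\<iota> f \<bullet> ie = ie \<bullet> \<iota> f"
    using q.Q.inv_commute[OF unit(1), of "\<iota> f"] f_comm[of "K e"] e(1) fD(2)
    unfolding ie_def by (simp flip: q.\<iota>_simps(3))
  have ie_comm: "ie \<bullet> \<iota> (K a) = \<iota> (K a) \<bullet> ie" if a: "a \<in> carrier D" for a
  proof -
    have "K e \<star> K a = K a \<star> K e"
      using a e(1) m_comm[of a e] by (simp flip: K_times)
    then have "\<iota> (K e) \<bullet> \<iota> (K a) = \<iota> (K a) \<bullet> \<iota> (K e)"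
      using a e(1) by (simp flip: q.\<iota>_simps(3))
    then show ?thesis
      using q.Q.inv_commute[OF unit(1)] a unfolding ie_def by simp
  qed
  have dual: "if' \<bullet> \<iota> (K j) \<in> q.dual P" if j: "j \<in> ?J" for j
  proof (rule q.dualI)
    have jc: "j \<in> carrier D"
      using j J.Icarr by blast
    then show "if' \<bullet> \<iota> (K j) \<in> carrier Q"
      using if'(1) by simp
    fix g assume g: "g \<in> P"
    have gc: "g \<in> carrier R"
      using g P.Icarr by blast
    show "if' \<bullet> \<iota> (K j) \<bullet> \<iota> g \<in> \<iota> ` carrier R"
    proof -
      have "K j \<star> g \<in> P" "\<And>n. (K j \<star> g) n \<in> ?J"
        using P.I_l_closed[OF g] J.I_r_closed[OF j] jc gc by auto
      then obtain q where q: "q \<in> carrier R" "K j \<star> g = q \<star> f"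
        by (rule gauss')
      have "if' \<bullet> \<iota> (K j) \<bullet> \<iota> g = if' \<bullet> \<iota> (q \<star> f)"
        using if'(1) jc gc by (simp add: q.Q.m_assoc flip: q(2))
      also have "\<dots> = \<iota> q"
        using if' q(1) fD(2) if_comm[OF q(1)] by (simp flip: q.Q.m_assoc) (simp add: q.Q.m_assoc)
      finally show ?thesis
        using q(1) by simp
    qed
    show "\<iota> g \<bullet> (if' \<bullet> \<iota> (K j)) \<in> \<iota> ` carrier R"
    proof -
      \<comment> \<open>The coefficients of \<open>g j\<close> are \<open>g_n \<sigma>^n(j)\<close>,
        so the content has to be \<sigma>-stable.\<close>
      have "(\<sigma> ^^ n) j \<in> ?J" for n
        using sigma_ideal_pow_iff[OF Js jc] j by simp
      then have "g \<star> K j \<in> P" "\<And>n. (g \<star> K j) n \<in> ?J"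
        using P.I_r_closed[OF g] J.I_l_closed jc gc by auto
      then obtain q where q: "q \<in> carrier R" "g \<star> K j = q \<star> f"
        by (rule gauss')
      have "\<iota> g \<bullet> (if' \<bullet> \<iota> (K j)) = \<iota> (q \<star> f) \<bullet> if'"
        using if'(1) jc gc if_comm[of "K j"] by (simp add: q.Q.m_assoc flip: q(2))
      also have "\<dots> = \<iota> q"
        using if' q(1) fD(2) by (simp add: q.Q.m_assoc)
      finally show ?thesis
        using q(1) by simp
    qed
  qed
  have key: "\<exists>F \<in> P. \<iota> (K (j \<otimes> v)) \<bullet> ie = if' \<bullet> \<iota> (K j) \<bullet> \<iota> F
      \<and> \<iota> (K (j \<otimes> v)) \<bullet> ie = \<iota> F \<bullet> (if' \<bullet> \<iota> (K j))"
    if j: "j \<in> ?J" and v: "v \<in> J'" for j v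
  proof -
    have jc: "j \<in> carrier D" and vc: "v \<in> carrier D"
      using j v J.Icarr J'.Icarr by auto
    have "\<exists>b. b \<in> carrier D \<and> v \<otimes> f n = e \<otimes> b" for n
      using edvd[OF f_in[of n] v] fD(2) vc m_comm[of v "f n"] by auto
    then obtain F where F: "\<And>n. F n \<in> carrier D" "\<And>n. v \<otimes> f n = e \<otimes> F n"
      by metis
    note sc = min_central_scaled[OF P.ideal_axioms f P pair v F]
    have Fc: "F \<in> carrier R"
      using sc(1) P.Icarr by blast
    \<comment> \<open>\<open>F\<close> has its support inside that of \<open>f\<close>, where the
      twist is trivial. The order of the two factors is therefore immaterial.\<close>
    have FK: "F \<star> K j = K j \<star> F"
    proof
      fix n
      show "(F \<star> K j) n = (K j \<star> F) n"
      proof (cases "F n = \<zero>")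
        case False
        then have "(\<sigma> ^^ n) j = j"
          using fD(8)[OF jc] sc(2) by blast
        then show ?thesis
          using Fc jc by (simp add: m_comm)
      qed (use Fc jc in simp)
    qed
    let ?c = "\<iota> (K (j \<otimes> v))"
    have "K (j \<otimes> v) \<star> f = K e \<star> (K j \<star> F)"
    proof
      fix n
      have "j \<otimes> v \<otimes> f n = j \<otimes> (e \<otimes> F n)"
        using jc vc fD(2) by (simp add: m_assoc flip: F(2))
      then show "(K (j \<otimes> v) \<star> f) n = (K e \<star> (K j \<star> F)) n"
        using jc vc e(1) fD(2) Fc by (simp add: m_lcomm)
    qed
    then have "\<iota> (K (j \<otimes> v) \<star> f) = \<iota> (K e \<star> (K j \<star> F))"
      by (rule arg_cong)
    then have cf: "?c \<bullet> \<iota> f = \<iota> (K e) \<bullet> \<iota> (K j \<star> F)"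
      using jc vc e(1) fD(2) Fc by simp
    have cc: "?c \<in> carrier Q" "\<iota> (K e) \<in> carrier Q" "\<iota> f \<in> carrier Q" "\<iota> (K j \<star> F) \<in> carrier Q"
      using jc vc e(1) fD(2) Fc by (auto simp del: q.\<iota>_simps(3))
    have "ie \<bullet> (\<iota> (K e) \<bullet> \<iota> (K j \<star> F)) = \<iota> (K j \<star> F)"
      using ie cc by (simp flip: q.Q.m_assoc del: q.\<iota>_simps(3))
    then have jF: "\<iota> (K j \<star> F) = ie \<bullet> (?c \<bullet> \<iota> f)"
      by (simp only: cf)
    have "\<dots> = ?c \<bullet> ie \<bullet> \<iota> f"
      using ie_comm[of "j \<otimes> v"] jc vc ie(1) cc q.Q.m_assoc[of ie ?c "\<iota> f"] by simp
    then have "\<iota> (K j \<star> F) \<bullet> if' = ?c \<bullet> ie"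
      unfolding jF using if' ie(1) cc by (simp add: q.Q.m_assoc)
    then have main: "?c \<bullet> ie = if' \<bullet> \<iota> (K j \<star> F)"
      using if_comm[of "K j \<star> F"] jc Fc by simp
    have "if' \<bullet> \<iota> (K j \<star> F) = if' \<bullet> \<iota> (K j) \<bullet> \<iota> F"
      using if'(1) jc Fc by (simp add: q.Q.m_assoc)
    moreover have "if' \<bullet> \<iota> (K j \<star> F) = \<iota> F \<bullet> (if' \<bullet> \<iota> (K j))"
    proof -
      have "if' \<bullet> \<iota> (K j \<star> F) = if' \<bullet> \<iota> F \<bullet> \<iota> (K j)"
        unfolding FK[symmetric] using if'(1) jc Fc by (simp add: q.Q.m_assoc)
      then show ?thesis
        unfolding if_comm[OF Fc] using if'(1) jc Fc by (simp add: q.Q.m_assoc)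
    qed
    ultimately show ?thesis
      unfolding main using sc(1) by auto
  qed
  show ?thesis
  proof (rule invertible_if_splits[OF P.ideal_axioms J.ideal_axioms pair])
    fix j v assume jv: "j \<in> ?J" "v \<in> J'"
    show "\<exists>g \<in> P. \<exists>z \<in> q.dual P. \<iota> (K (j \<otimes> v)) \<bullet> inv\<^bsub>Q\<^esub> \<iota> (K e) = \<iota> g \<bullet> z
        \<and> \<iota> (K (j \<otimes> v)) \<bullet> inv\<^bsub>Q\<^esub> \<iota> (K e) = z \<bullet> \<iota> g"
      using key[OF jv] dual[OF jv(1)] unfolding ie_def by metis
  qed
qed

theorem invertible_iff_minimal:
  assumes P: "P \<in> Spec R" "P \<noteq> {\<zero>\<^bsub>R\<^esub>}"
  shows "invertible_ideal P R Q \<iota> \<longleftrightarrow> P \<in> minimal_primes R"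
proof -
  have inv: "invertible_ideal P R Q \<iota>" if P: "P \<in> extended_primes \<union> zero_primes" for P
  proof (cases "P \<in> zero_primes")
    case True
    then have Ps: "P \<in> Spec R" "contraction P = {\<zero>}" "P \<noteq> {\<zero>\<^bsub>R\<^esub>}"
      unfolding zero_primes_iff by auto
    show ?thesis
    proof (cases "y \<in> P")
      case True
      then show ?thesis
        using eq_Y[OF Ps(1,2)] Y_invertible by simp
    next
      case False
      obtain f d where "min_central P f d"
        by (rule min_central_exists[OF Ps False])
      then show ?thesis
        by (rule min_central_invertible[OF Ps(1,2)])
    qed
  next
    case False
    then show ?thesis
      using P CI_invertible sigma_primeD(1) unfolding extended_primes_def by blast
  qed
  obtain P0 where P0: "P0 \<in> extended_primes \<union> zero_primes" "P0 \<subseteq> P"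
    by (rule prime_contains[OF P])
  have "P0 = P" if "invertible_ideal P R Q \<iota>"
    by (rule q.invertible_primes_eq[OF P(1) that primes_Spec(1)[OF P0(1)] inv[OF P0(1)] P0(2)])
  then show ?thesis
    using inv[of P] P0(1) unfolding minimal_primes_eq by blast
qed

end

subsection \<open>Transfer along ring isomorphisms\<close>

text \<open>Carrying both maps makes the situation symmetric, so each transfer statement is proved
  once and reused through \<open>swapped\<close>.\<close>

locale ring_iso_pair = T: ring T + R: ring R for T (structure) and R +
  fixes \<Phi> :: "'a \<Rightarrow> 'c" and \<Psi> :: "'c \<Rightarrow> 'a"
  assumes \<Phi>_hom: "\<Phi> \<in> ring_hom T R" and \<Psi>_hom: "\<Psi> \<in> ring_hom R T"
    and \<Psi>_\<Phi>: "\<And>a. a \<in> carrier T \<Longrightarrow> \<Psi> (\<Phi> a) = a"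
    and \<Phi>_\<Psi>: "\<And>b. b \<in> carrier R \<Longrightarrow> \<Phi> (\<Psi> b) = b"
begin

lemma swapped: "ring_iso_pair R T \<Psi> \<Phi>"
  using \<Phi>_hom \<Psi>_hom \<Psi>_\<Phi> \<Phi>_\<Psi> by unfold_locales

lemma \<Phi>_simps [simp]:
  "a \<in> carrier T \<Longrightarrow> \<Phi> a \<in> carrier R"
  "a \<in> carrier T \<Longrightarrow> b \<in> carrier T \<Longrightarrow> \<Phi> (a \<oplus> b) = \<Phi> a \<oplus>\<^bsub>R\<^esub> \<Phi> b"
  "a \<in> carrier T \<Longrightarrow> b \<in> carrier T \<Longrightarrow> \<Phi> (a \<otimes> b) = \<Phi> a \<otimes>\<^bsub>R\<^esub> \<Phi> b"
  "\<Phi> \<one> = \<one>\<^bsub>R\<^esub>" "\<Phi> \<zero> = \<zero>\<^bsub>R\<^esub>"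
  using \<Phi>_hom ring_hom_zero[OF \<Phi>_hom T.ring_axioms R.ring_axioms] by (auto simp: ring_hom_def)

lemma \<Phi>_eq_iff: "a \<in> carrier T \<Longrightarrow> b \<in> carrier T \<Longrightarrow> \<Phi> a = \<Phi> b \<longleftrightarrow> a = b"
  using \<Psi>_\<Phi> by metis

lemma \<Psi>_closed [simp]: "b \<in> carrier R \<Longrightarrow> \<Psi> b \<in> carrier T"
  using \<Psi>_hom by (rule ring_hom_closed)

lemma \<Phi>_in_image_iff: "P \<subseteq> carrier T \<Longrightarrow> a \<in> carrier T \<Longrightarrow> \<Phi> a \<in> \<Phi> ` P \<longleftrightarrow> a \<in> P"
  using \<Phi>_eq_iff by blast

lemma image_eq_iff: "P \<subseteq> carrier T \<Longrightarrow> P' \<subseteq> carrier T \<Longrightarrow> \<Phi> ` P = \<Phi> ` P' \<longleftrightarrow> P = P'"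
  using \<Phi>_in_image_iff by blast

lemma image_carrier: "\<Phi> ` carrier T = carrier R"
proof
  show "carrier R \<subseteq> \<Phi> ` carrier T"
    using \<Phi>_\<Psi> \<Psi>_closed by (metis image_eqI subsetI)
qed auto

lemma image_inverse: "P \<subseteq> carrier R \<Longrightarrow> \<Phi> ` \<Psi> ` P = P"
  using \<Phi>_\<Psi> by (force simp: image_image subset_iff)

lemma image_ideal:
  assumes "ideal P T"
  shows "ideal (\<Phi> ` P) R"
proof -
  interpret P: ideal P T by fact
  show ?thesis
  proof (rule R.ideal_if_closed)
    show "u \<oplus>\<^bsub>R\<^esub> v \<in> \<Phi> ` P" if uv: "u \<in> \<Phi> ` P" "v \<in> \<Phi> ` P" for u v
    proof -
      obtain p q where "p \<in> P" "u = \<Phi> p" "q \<in> P" "v = \<Phi> q"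
        using uv by blast
      then show ?thesis
        using P.Icarr by (intro image_eqI[of _ _ "p \<oplus> q"]) auto
    qed
    show "r \<otimes>\<^bsub>R\<^esub> u \<in> \<Phi> ` P" "u \<otimes>\<^bsub>R\<^esub> r \<in> \<Phi> ` P" if u: "u \<in> \<Phi> ` P" and r: "r \<in> carrier R" for u r
    proof -
      obtain p where p: "p \<in> P" "u = \<Phi> p"
        using u by blast
      obtain s where s: "s \<in> carrier T" "r = \<Phi> s"
        using r image_carrier by blast
      show "r \<otimes>\<^bsub>R\<^esub> u \<in> \<Phi> ` P"
        using p s P.Icarr P.I_l_closed by (intro image_eqI[of _ _ "s \<otimes> p"]) auto
      show "u \<otimes>\<^bsub>R\<^esub> r \<in> \<Phi> ` P"
        using p s P.Icarr P.I_r_closed by (intro image_eqI[of _ _ "p \<otimes> s"]) auto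
    qed
  qed (use P.Icarr in \<open>auto intro!: image_eqI[of _ _ "\<zero>"]\<close>)
qed

lemma image_Spec:
  assumes P: "P \<in> Spec T"
  shows "\<Phi> ` P \<in> Spec R"
proof (rule SpecI)
  interpret P: ideal P T
    using Spec_ideal[OF P] .
  have PT: "P \<subseteq> carrier T"
    using P.Icarr by blast
  show "ideal (\<Phi> ` P) R"
    by (rule image_ideal[OF P.ideal_axioms])
  have "P \<noteq> carrier T"
    using P unfolding Spec_def by blast
  then show "\<Phi> ` P \<noteq> carrier R"
    using image_eq_iff[OF PT subset_refl] image_carrier by simp
  fix a b assume "a \<in> carrier R" "b \<in> carrier R"
    and ab: "\<And>r. r \<in> carrier R \<Longrightarrow> a \<otimes>\<^bsub>R\<^esub> r \<otimes>\<^bsub>R\<^esub> b \<in> \<Phi> ` P"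
  have "a \<in> \<Phi> ` carrier T" "b \<in> \<Phi> ` carrier T"
    using \<open>a \<in> carrier R\<close> \<open>b \<in> carrier R\<close> by (simp_all only: image_carrier)
  then obtain a' b' where a': "a' \<in> carrier T" "a = \<Phi> a'" and b': "b' \<in> carrier T" "b = \<Phi> b'"
    by blast
  have "a' \<in> P \<or> b' \<in> P"
  proof (rule Spec_elementwise[OF P a'(1) b'(1)])
    fix r assume r: "r \<in> carrier T"
    have "\<Phi> (a' \<otimes> r \<otimes> b') \<in> \<Phi> ` P"
      using ab[of "\<Phi> r"] a' b' r by simp
    then show "a' \<otimes> r \<otimes> b' \<in> P"
      using \<Phi>_in_image_iff[OF PT, of "a' \<otimes> r \<otimes> b'"] a'(1) b'(1) r by (simp del: \<Phi>_simps)
  qed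
  then show "a \<in> \<Phi> ` P \<or> b \<in> \<Phi> ` P"
    using a' b' by blast
qed

lemma image_nonzero:
  assumes "P \<subseteq> carrier T" "P \<noteq> {\<zero>}"
  shows "\<Phi> ` P \<noteq> {\<zero>\<^bsub>R\<^esub>}"
  using image_eq_iff[OF assms(1), of "{\<zero>}"] assms(2) by simp

lemma Spec_subset: "P \<in> Spec T \<Longrightarrow> P \<subseteq> carrier T"
  using ideal.Icarr[OF Spec_ideal[of P T]] by (rule subsetI)

lemma image_minimal_prime:
  assumes P: "P \<in> minimal_primes T"
  shows "\<Phi> ` P \<in> minimal_primes R"
proof -
  interpret I: ring_iso_pair R T \<Psi> \<Phi>
    by (rule swapped)
  have Ps: "P \<in> Spec T" "P \<noteq> {\<zero>}"
    and min: "\<And>P'. P' \<in> Spec T \<Longrightarrow> P' \<noteq> {\<zero>} \<Longrightarrow> \<not> P' \<subset> P"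
    using P unfolding minimal_primes_def by auto
  have "\<not> P' \<subset> \<Phi> ` P" if P': "P' \<in> Spec R" "P' \<noteq> {\<zero>\<^bsub>R\<^esub>}" for P'
  proof
    assume sub: "P' \<subset> \<Phi> ` P"
    have "\<Psi> ` P' \<noteq> \<Psi> ` \<Phi> ` P"
      using sub I.image_eq_iff[OF I.Spec_subset[OF P'(1)] I.Spec_subset[OF image_Spec[OF Ps(1)]]] by simp
    moreover have "\<Psi> ` P' \<subseteq> \<Psi> ` \<Phi> ` P"
      using sub by (intro image_mono) simp
    ultimately have "\<Psi> ` P' \<subset> P"
      unfolding I.image_inverse[OF Spec_subset[OF Ps(1)]] by (rule psubsetI[rotated])
    then show False
      using min[OF I.image_Spec[OF P'(1)] I.image_nonzero[OF I.Spec_subset[OF P'(1)] P'(2)]] by blast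
  qed
  then show ?thesis
    using image_Spec[OF Ps(1)] image_nonzero[OF Spec_subset[OF Ps(1)] Ps(2)]
    unfolding minimal_primes_def by blast
qed

lemma minimal_primes_image: "minimal_primes R = (`) \<Phi> ` minimal_primes T"
proof
  interpret I: ring_iso_pair R T \<Psi> \<Phi>
    by (rule swapped)
  show "minimal_primes R \<subseteq> (`) \<Phi> ` minimal_primes T"
  proof
    fix P assume P: "P \<in> minimal_primes R"
    then have "P \<subseteq> carrier R"
      using I.Spec_subset unfolding minimal_primes_def by blast
    then have "P = \<Phi> ` \<Psi> ` P"
      by (rule image_inverse[symmetric])
    then show "P \<in> (`) \<Phi> ` minimal_primes T"
      using I.image_minimal_prime[OF P] by blast
  qed
  show "(`) \<Phi> ` minimal_primes T \<subseteq> minimal_primes R"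
    using image_minimal_prime by blast
qed

lemma quotient_division_ring_pullback:
  assumes "quotient_division_ring R Q \<iota>"
  shows "quotient_division_ring T Q (\<iota> \<circ> \<Phi>)"
  unfolding quotient_division_ring_def
proof (intro conjI ballI)
  have Q: "skew_field Q" and hom: "\<iota> \<in> ring_hom R Q" and inj: "inj_on \<iota> (carrier R)"
    using assms unfolding quotient_division_ring_def by auto
  show "skew_field Q"
    by (rule Q)
  show "\<iota> \<circ> \<Phi> \<in> ring_hom T Q"
    using ring_hom_trans[OF \<Phi>_hom hom] .
  show "inj_on (\<iota> \<circ> \<Phi>) (carrier T)"
    using inj \<Phi>_eq_iff by (intro comp_inj_on) (auto simp: image_carrier inj_on_def)
  have pull: "\<exists>r'\<in>carrier T. \<exists>s'\<in>carrier T - {\<zero>}. \<Phi> r' = r \<and> \<Phi> s' = s"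
    if rs: "r \<in> carrier R" "s \<in> carrier R - {\<zero>\<^bsub>R\<^esub>}" for r s
  proof -
    have "\<Psi> s \<noteq> \<zero>"
      using rs(2) \<Phi>_\<Psi>[of s] \<Phi>_simps(5) by auto
    then show ?thesis
      using rs \<Phi>_\<Psi> \<Psi>_closed by (intro bexI[of _ "\<Psi> r"] bexI[of _ "\<Psi> s"]) auto
  qed
  fix z assume "z \<in> carrier Q"
  then have z: "\<exists>r \<in> carrier R. \<exists>s \<in> carrier R - {\<zero>\<^bsub>R\<^esub>}. z = \<iota> r \<otimes>\<^bsub>Q\<^esub> inv\<^bsub>Q\<^esub> (\<iota> s)"
    "\<exists>r \<in> carrier R. \<exists>s \<in> carrier R - {\<zero>\<^bsub>R\<^esub>}. z = inv\<^bsub>Q\<^esub> (\<iota> s) \<otimes>\<^bsub>Q\<^esub> \<iota> r"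
    using assms unfolding quotient_division_ring_def by blast+
  show "\<exists>r\<in>carrier T. \<exists>s\<in>carrier T - {\<zero>}. z = (\<iota> \<circ> \<Phi>) r \<otimes>\<^bsub>Q\<^esub> inv\<^bsub>Q\<^esub> ((\<iota> \<circ> \<Phi>) s)"
    using z(1) pull by (metis comp_apply)
  show "\<exists>r\<in>carrier T. \<exists>s\<in>carrier T - {\<zero>}. z = inv\<^bsub>Q\<^esub> ((\<iota> \<circ> \<Phi>) s) \<otimes>\<^bsub>Q\<^esub> (\<iota> \<circ> \<Phi>) r"
    using z(2) pull by (metis comp_apply)
qed

lemma invertible_ideal_image:
  "invertible_ideal P T Q (\<iota> \<circ> \<Phi>) \<longleftrightarrow> invertible_ideal (\<Phi> ` P) R Q \<iota>"
  unfolding invertible_ideal_def subbimodule_def image_carrier[symmetric] image_comp by simp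

end


subsection \<open>Removing the inner derivation\<close>

locale inner_skew_poly = skew_poly D \<sigma> + d: ore D \<sigma> \<delta>
  for D (structure) and \<sigma> \<delta> +
  fixes a :: 'a
  assumes a_closed [simp]: "a \<in> carrier D"
    and \<delta>_inner: "\<And>b. b \<in> carrier D \<Longrightarrow> \<delta> b = a \<otimes> b \<ominus> \<sigma> b \<otimes> a"
begin

sublocale d: ring d.R
  by (rule d.R_ring)

text \<open>Both rings consist of the same functions and differ only in multiplication. So
  \<open>y\<close> and \<open>K\<close> serve for both, and inside \<open>d.R\<close> the element
  written \<open>y\<close> is the variable \<open>x\<close>.\<close>

lemma y_closed_d [simp]: "y \<in> carrier d.R"
  unfolding y_def by (rule d.x_var_closed)

lemma K_closed_d [simp]: "b \<in> carrier D \<Longrightarrow> K b \<in> carrier d.R"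
  by (rule ring_hom_closed[OF d.K_hom])

lemma \<delta>_eq: "b \<in> carrier D \<Longrightarrow> \<sigma> b \<otimes> a \<oplus> \<delta> b = a \<otimes> b"
  by (simp add: \<delta>_inner minus_eq a_ac r_neg r_neg1 r_neg2)

lemma K_\<delta>_eq:
  assumes "b \<in> carrier D" "K \<in> ring_hom D M"
  shows "K a \<otimes>\<^bsub>M\<^esub> K b = K (\<sigma> b) \<otimes>\<^bsub>M\<^esub> K a \<oplus>\<^bsub>M\<^esub> K (\<delta> b)"
  using assms(1) d.\<delta>_simps(1)[OF assms(1)] arg_cong[OF \<delta>_eq[OF assms(1)], of K]
  by (simp add: ring_hom_add[OF assms(2)] ring_hom_mult[OF assms(2)] del: K_add K_times)

text \<open>The substitution of \<open>x - a\<close> for the variable of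
  \<open>D[y; \<sigma>]\<close>, legitimate because \<open>(x - a) b = \<sigma>(b) x + \<delta>(b) -
  a b = \<sigma>(b) (x - a)\<close>. The trailing \<open>K \<zero>\<close> is the value of the zero
  derivation.\<close>

sublocale F: ore_eval D \<sigma> "\<lambda>_. \<zero>" d.R K "y \<ominus>\<^bsub>d.R\<^esub> K a"
proof unfold_locales
  fix b assume b: "b \<in> carrier D"
  have xR: "y \<otimes>\<^bsub>d.R\<^esub> K b = K (\<sigma> b) \<otimes>\<^bsub>d.R\<^esub> y \<oplus>\<^bsub>d.R\<^esub> K (\<delta> b)"
    using d.x_var_K[OF b] unfolding y_def .
  have cancel: "u \<oplus>\<^bsub>d.R\<^esub> v \<ominus>\<^bsub>d.R\<^esub> (w \<oplus>\<^bsub>d.R\<^esub> v) = u \<ominus>\<^bsub>d.R\<^esub> w"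
    if "u \<in> carrier d.R" "v \<in> carrier d.R" "w \<in> carrier d.R" for u v w
    using that by (simp add: d.minus_eq d.minus_add d.a_ac d.r_neg1 d.r_neg2)
  have "(y \<ominus>\<^bsub>d.R\<^esub> K a) \<otimes>\<^bsub>d.R\<^esub> K b
    = K (\<sigma> b) \<otimes>\<^bsub>d.R\<^esub> y \<oplus>\<^bsub>d.R\<^esub> K (\<delta> b) \<ominus>\<^bsub>d.R\<^esub> K a \<otimes>\<^bsub>d.R\<^esub> K b"
    using b d.\<delta>_simps(1)[OF b] by (simp add: d.minus_eq d.l_distr d.l_minus xR)
  also have "\<dots> = K (\<sigma> b) \<otimes>\<^bsub>d.R\<^esub> y \<ominus>\<^bsub>d.R\<^esub> K (\<sigma> b) \<otimes>\<^bsub>d.R\<^esub> K a"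
    unfolding K_\<delta>_eq[OF b d.K_hom] using b d.\<delta>_simps(1)[OF b] by (intro cancel) simp_all
  also have "\<dots> = K (\<sigma> b) \<otimes>\<^bsub>d.R\<^esub> (y \<ominus>\<^bsub>d.R\<^esub> K a) \<oplus>\<^bsub>d.R\<^esub> K \<zero>"
    using b ring_hom_zero[OF d.K_hom ring_axioms d.R_ring]
    by (simp add: d.minus_eq d.r_distr d.r_minus del: K_zero)
  finally show "(y \<ominus>\<^bsub>d.R\<^esub> K a) \<otimes>\<^bsub>d.R\<^esub> K b = K (\<sigma> b) \<otimes>\<^bsub>d.R\<^esub> (y \<ominus>\<^bsub>d.R\<^esub> K a) \<oplus>\<^bsub>d.R\<^esub> K \<zero>" .
qed (simp_all add: d.K_hom)

sublocale G: ore_eval D \<sigma> \<delta> R K "y \<oplus>\<^bsub>R\<^esub> K a"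
proof unfold_locales
  fix b assume b: "b \<in> carrier D"
  have "(y \<oplus>\<^bsub>R\<^esub> K a) \<otimes>\<^bsub>R\<^esub> K b = K (\<sigma> b) \<otimes>\<^bsub>R\<^esub> y \<oplus>\<^bsub>R\<^esub> K a \<otimes>\<^bsub>R\<^esub> K b"
    using b by (simp add: R.l_distr y_K)
  also have "\<dots> = K (\<sigma> b) \<otimes>\<^bsub>R\<^esub> (y \<oplus>\<^bsub>R\<^esub> K a) \<oplus>\<^bsub>R\<^esub> K (\<delta> b)"
    unfolding K_\<delta>_eq[OF b K_hom] using b d.\<delta>_simps(1)[OF b] by (simp add: R.r_distr R.a_assoc)
  finally show "(y \<oplus>\<^bsub>R\<^esub> K a) \<otimes>\<^bsub>R\<^esub> K b = K (\<sigma> b) \<otimes>\<^bsub>R\<^esub> (y \<oplus>\<^bsub>R\<^esub> K a) \<oplus>\<^bsub>R\<^esub> K (\<delta> b)" .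
qed (simp_all add: K_hom)

lemma F_y: "F.ev y = y \<ominus>\<^bsub>d.R\<^esub> K a" and G_y: "G.ev y = y \<oplus>\<^bsub>R\<^esub> K a"
  using F.ev_x_var G.ev_x_var by (simp_all only: y_def)

lemma id_hom: "(\<lambda>p. p) \<in> ring_hom M M"
  by (simp add: ring_hom_def)

lemma G_F: "p \<in> carrier R \<Longrightarrow> G.ev (F.ev p) = p"
proof -
  assume p: "p \<in> carrier R"
  have "(G.ev \<circ> F.ev) p = (\<lambda>p. p) p"
  proof (rule hom_eqI[OF ring_hom_trans[OF F.ev_hom G.ev_hom] id_hom])
    have cl: "y \<ominus>\<^bsub>d.R\<^esub> K a \<in> carrier d.R"
      by simp
    have "G.ev (y \<ominus>\<^bsub>d.R\<^esub> K a) \<oplus>\<^bsub>R\<^esub> G.ev (K a) = G.ev (y \<ominus>\<^bsub>d.R\<^esub> K a \<oplus>\<^bsub>d.R\<^esub> K a)"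
      by (rule ring_hom_add[OF G.ev_hom cl, symmetric]) simp
    also have "y \<ominus>\<^bsub>d.R\<^esub> K a \<oplus>\<^bsub>d.R\<^esub> K a = y"
      by (simp add: d.minus_eq d.a_assoc d.l_neg)
    finally have "G.ev (y \<ominus>\<^bsub>d.R\<^esub> K a) \<oplus>\<^bsub>R\<^esub> K a = y \<oplus>\<^bsub>R\<^esub> K a"
      by (simp only: G_y G.ev_K[OF a_closed])
    then have "G.ev (y \<ominus>\<^bsub>d.R\<^esub> K a) = y"
      using ring_hom_closed[OF G.ev_hom cl] by (simp only: R.add.r_cancel K_closed a_closed y_closed)
    then show "(G.ev \<circ> F.ev) x_var = x_var"
      by (simp only: comp_apply F_y flip: y_def)
    show "p \<in> up D"
      using p by (simp add: R_simps(1))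
  qed (simp add: F.ev_K G.ev_K)
  then show ?thesis
    by simp
qed

lemma F_G: "p \<in> carrier d.R \<Longrightarrow> F.ev (G.ev p) = p"
proof -
  assume p: "p \<in> carrier d.R"
  have "(F.ev \<circ> G.ev) p = (\<lambda>p. p) p"
  proof (rule d.hom_eqI[OF ring_hom_trans[OF G.ev_hom F.ev_hom] id_hom])
    have "F.ev (y \<oplus>\<^bsub>R\<^esub> K a) = F.ev y \<oplus>\<^bsub>d.R\<^esub> F.ev (K a)"
      by (rule ring_hom_add[OF F.ev_hom]) simp_all
    also have "\<dots> = y \<ominus>\<^bsub>d.R\<^esub> K a \<oplus>\<^bsub>d.R\<^esub> K a"
      by (simp only: F_y F.ev_K[OF a_closed])
    also have "\<dots> = y"
      by (simp add: d.minus_eq d.a_assoc d.l_neg)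
    finally show "(F.ev \<circ> G.ev) x_var = x_var"
      by (simp only: comp_apply G_y flip: y_def)
    show "p \<in> up D"
      using p by (simp add: d.R_simps(1))
  qed (simp add: F.ev_K G.ev_K)
  then show ?thesis
    by simp
qed

sublocale iso: ring_iso_pair R d.R F.ev G.ev
  by unfold_locales (fact F.ev_hom G.ev_hom G_F F_G)+

sublocale iso': ring_iso_pair d.R R G.ev F.ev
  by (rule iso.swapped)

text \<open>The isomorphism changes coefficients, so neither inclusion is literal. Each evaluation
  maps a polynomial with coefficients in \<open>\<pp>\<close> into any ideal containing the
  constants from \<open>\<pp>\<close>. On the \<open>d.R\<close> side the coefficient ideal is an
  ideal because \<open>\<delta>(b) = a b - \<sigma>(b) a\<close> keeps \<open>\<pp>\<close>
  stable.\<close>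

lemma image_CI:
  assumes p: "sigma_ideal \<pp> D \<sigma>"
  shows "F.ev ` CI \<pp> = ore_coeff_ideal D \<sigma> \<delta> \<pp>"
proof
  interpret p: ideal \<pp> D
    using p unfolding sigma_ideal_def by blast
  have stable: "\<delta> b \<in> \<pp>" if b: "b \<in> \<pp>" for b
  proof -
    have "\<sigma> b \<in> \<pp>"
      using p b unfolding sigma_ideal_def by blast
    then show ?thesis
      using b p.Icarr p.I_l_closed p.I_r_closed unfolding \<delta>_inner[OF p.Icarr[OF b]] minus_eq by simp
  qed
  have ideal: "ideal (ore_coeff_ideal D \<sigma> \<delta> \<pp>) d.R"
    using p stable by (intro d.coeff_ideal_ideal) (auto simp: sigma_ideal_def)
  have K_in: "K b \<in> CI \<pp>" if "b \<in> \<pp>" for b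
    using CI_K[OF p.ideal_axioms] that p.Icarr by blast
  then have K_in_d: "K b \<in> ore_coeff_ideal D \<sigma> \<delta> \<pp>" if "b \<in> \<pp>" for b
    using that K_closed_d[OF p.Icarr[OF that]] unfolding ore_coeff_ideal_def by blast
  show "F.ev ` CI \<pp> \<subseteq> ore_coeff_ideal D \<sigma> \<delta> \<pp>"
    using F.ev_in_ideal[OF ideal K_in_d] by blast
  have "G.ev ` ore_coeff_ideal D \<sigma> \<delta> \<pp> \<subseteq> CI \<pp>"
    using G.ev_in_ideal[OF CI_ideal[OF p] K_in] by blast
  then have "F.ev ` G.ev ` ore_coeff_ideal D \<sigma> \<delta> \<pp> \<subseteq> F.ev ` CI \<pp>"
    by (rule image_mono)
  moreover have "ore_coeff_ideal D \<sigma> \<delta> \<pp> \<subseteq> carrier d.R"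
    unfolding ore_coeff_ideal_def by blast
  ultimately show "ore_coeff_ideal D \<sigma> \<delta> \<pp> \<subseteq> F.ev ` CI \<pp>"
    using iso.image_inverse by simp
qed

lemma image_Spec0_iff:
  assumes P: "P \<in> Spec R"
  shows "F.ev ` P \<in> Spec0 D \<sigma> \<delta> \<longleftrightarrow> P \<in> Spec0 D \<sigma> (\<lambda>_. \<zero>)"
proof -
  have PR: "P \<subseteq> carrier R"
    by (rule iso.Spec_subset[OF P])
  have "F.ev ` (P \<inter> K ` carrier D) = F.ev ` P \<inter> F.ev ` K ` carrier D"
    by (rule inj_on_image_Int[of _ "carrier R"]) (use PR iso.\<Phi>_eq_iff in \<open>auto intro!: inj_onI\<close>)
  also have "F.ev ` K ` carrier D = K ` carrier D"
    by (simp add: image_image F.ev_K)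
  finally have "F.ev ` P \<inter> K ` carrier D = F.ev ` (P \<inter> K ` carrier D)" ..
  moreover have "F.ev ` (P \<inter> K ` carrier D) = {\<zero>\<^bsub>d.R\<^esub>} \<longleftrightarrow> P \<inter> K ` carrier D = {\<zero>\<^bsub>R\<^esub>}"
    using iso.image_eq_iff[of "P \<inter> K ` carrier D" "{\<zero>\<^bsub>R\<^esub>}"] PR by auto
  ultimately show ?thesis
    using iso.image_Spec[OF P] P unfolding Spec0_def by simp
qed

lemma image_zero_primes: "(`) F.ev ` zero_primes = {P \<in> Spec0 D \<sigma> \<delta>. P \<noteq> {\<zero>\<^bsub>d.R\<^esub>}}"
proof (intro equalityI image_subsetI subsetI)
  fix P assume "P \<in> zero_primes"
  then have P: "P \<in> Spec0 D \<sigma> (\<lambda>_. \<zero>)" "P \<in> Spec R" "P \<noteq> {\<zero>\<^bsub>R\<^esub>}"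
    unfolding zero_primes_def Spec0_def by auto
  then show "F.ev ` P \<in> {P \<in> Spec0 D \<sigma> \<delta>. P \<noteq> {\<zero>\<^bsub>d.R\<^esub>}}"
    using image_Spec0_iff iso.image_nonzero[OF iso.Spec_subset] by simp
next
  fix P assume "P \<in> {P \<in> Spec0 D \<sigma> \<delta>. P \<noteq> {\<zero>\<^bsub>d.R\<^esub>}}"
  then have P: "P \<in> Spec0 D \<sigma> \<delta>" "P \<in> Spec d.R" "P \<noteq> {\<zero>\<^bsub>d.R\<^esub>}"
    unfolding Spec0_def by auto
  have PR: "P \<subseteq> carrier d.R"
    by (rule iso'.Spec_subset[OF P(2)])
  have "G.ev ` P \<in> Spec0 D \<sigma> (\<lambda>_. \<zero>)"
    using image_Spec0_iff[OF iso'.image_Spec[OF P(2)]] P(1) iso.image_inverse[OF PR] by simp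
  then have "G.ev ` P \<in> zero_primes"
    using iso'.image_nonzero[OF PR P(3)] unfolding zero_primes_def by simp
  then show "P \<in> (`) F.ev ` zero_primes"
    using iso.image_inverse[OF PR, symmetric] by (intro image_eqI[of _ _ "G.ev ` P"])
qed

lemma image_extended_primes:
  "(`) F.ev ` extended_primes
    = {ore_coeff_ideal D \<sigma> \<delta> \<pp> | \<pp>. sigma_prime_ideal \<pp> D \<sigma> \<and> \<pp> \<noteq> {\<zero>}}"
proof -
  have "(`) F.ev ` extended_primes = {F.ev ` CI \<pp> | \<pp>. sigma_prime_ideal \<pp> D \<sigma> \<and> \<pp> \<noteq> {\<zero>}}"
    unfolding extended_primes_def by blast
  also have "\<dots> = {ore_coeff_ideal D \<sigma> \<delta> \<pp> | \<pp>. sigma_prime_ideal \<pp> D \<sigma> \<and> \<pp> \<noteq> {\<zero>}}"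
    using image_CI sigma_primeD(1) by (intro Collect_cong) metis
  finally show ?thesis .
qed

lemma minimal_primes_ore:
  "{ore_coeff_ideal D \<sigma> \<delta> \<pp> | \<pp>. sigma_prime_ideal \<pp> D \<sigma> \<and> \<pp> \<noteq> {\<zero>}}
    \<union> {P \<in> Spec0 D \<sigma> \<delta>. P \<noteq> {\<zero>\<^bsub>d.R\<^esub>}} = minimal_primes d.R"
  using iso.minimal_primes_image image_extended_primes image_zero_primes
  by (simp add: image_Un minimal_primes_eq)

lemma invertible_iff_minimal_ore:
  assumes Q: "quotient_division_ring d.R Q \<iota>" and P: "P \<in> Spec d.R" "P \<noteq> {\<zero>\<^bsub>d.R\<^esub>}"
  shows "invertible_ideal P d.R Q \<iota> \<longleftrightarrow> P \<in> minimal_primes d.R"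
proof -
  have "ring Q"
    using Q unfolding quotient_division_ring_def skew_field_def by blast
  then interpret quot: skew_poly_quotient D \<sigma> Q "\<iota> \<circ> F.ev"
    using iso.quotient_division_ring_pullback[OF Q] skew_poly_axioms R.ring_axioms
    by (intro skew_poly_quotient.intro div_quotient.intro div_quotient_axioms.intro)
  have PR: "P \<subseteq> carrier d.R"
    by (rule iso'.Spec_subset[OF P(1)])
  have PP: "F.ev ` G.ev ` P = P"
    by (rule iso.image_inverse[OF PR])
  have "invertible_ideal P d.R Q \<iota> \<longleftrightarrow> invertible_ideal (G.ev ` P) R Q (\<iota> \<circ> F.ev)"
    using iso.invertible_ideal_image[of "G.ev ` P" Q \<iota>] PP by simp
  also have "\<dots> \<longleftrightarrow> G.ev ` P \<in> minimal_primes R"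
    by (rule quot.invertible_iff_minimal[OF iso'.image_Spec[OF P(1)] iso'.image_nonzero[OF PR P(2)]])
  also have "\<dots> \<longleftrightarrow> P \<in> minimal_primes d.R"
    using iso.image_minimal_prime[of "G.ev ` P"] iso'.image_minimal_prime[of P] PP by auto
  finally show ?thesis .
qed

end

theorem theorem3:
  fixes D :: "('a, 'm) ring_scheme" and \<sigma> \<delta> :: "'a \<Rightarrow> 'a"
    and R :: "(nat \<Rightarrow> 'a) ring"
  assumes "dedekind_domain D"
    and "\<sigma> \<in> ring_iso D D" and "\<exists>b \<in> carrier D. \<sigma> b \<noteq> b"
    and "inner_skew_derivation D \<sigma> \<delta>" and "\<exists>b \<in> carrier D. \<delta> b \<noteq> \<zero>\<^bsub>D\<^esub>"
    and "R = ore_extension D \<sigma> \<delta>"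
  shows "{ore_coeff_ideal D \<sigma> \<delta> \<pp> | \<pp>. sigma_prime_ideal \<pp> D \<sigma> \<and> \<pp> \<noteq> {\<zero>\<^bsub>D\<^esub>}}
           \<union> {P \<in> Spec0 D \<sigma> \<delta>. P \<noteq> {\<zero>\<^bsub>R\<^esub>}} = minimal_primes R
       \<and> (\<forall>(Q :: ('q, 'n) ring_scheme) \<iota>. quotient_division_ring R Q \<iota> \<longrightarrow>
            (\<forall>P \<in> Spec R. P \<noteq> {\<zero>\<^bsub>R\<^esub>} \<longrightarrow>
               (invertible_ideal P R Q \<iota> \<longleftrightarrow> P \<in> minimal_primes R)))"
proof -
  obtain a where a: "a \<in> carrier D"
    and \<delta>: "\<And>b. b \<in> carrier D \<Longrightarrow> \<delta> b = a \<otimes>\<^bsub>D\<^esub> b \<ominus>\<^bsub>D\<^esub> \<sigma> b \<otimes>\<^bsub>D\<^esub> a"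
    using assms(4) unfolding inner_skew_derivation_def by blast
  interpret D: skew_poly D \<sigma>
    using assms(1,2) unfolding dedekind_domain_iff skew_poly_def skew_poly_axioms_def by blast
  interpret inner_skew_poly D \<sigma> \<delta> a
    using assms(4) D.\<sigma>_hom a \<delta> by unfold_locales (auto simp: inner_skew_derivation_def)
  show ?thesis
    unfolding assms(6) using minimal_primes_ore invertible_iff_minimal_ore by blast
qed

end
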